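(* Let $\Sigma_0=\mathcal{H}/\Lambda$ be a compact oriented surface of genus $g\ge2$, where $\mathcal{H}$ is the Lobachevskii upper half-plane and $\Lambda$ is a lattice in $PSL(2,\mathbb{R})$. Let $U$ (real-valued) and $\psi=(\psi_1,\psi_2)$ be functions on $\mathcal{H}$ with $\mathcal{D}\psi=0$, satisfying $$U(\gamma(z))=|cz+d|^2U(z),\quad \psi_1(\gamma(z))=(cz+d)\psi_1(z),\quad \psi_2(\gamma(z))=(c\bar z+d)\psi_2(z)$$ for $z\in\mathcal{H}$ and $\gamma\in\Lambda$ represented by the matrix $\begin{pmatrix}a&b\\c&d\end{pmatrix}$, $a,b,c,d\in\mathbb{R}$, $ad-bc=1$, and defining via the formulas (W) an immersion of the universal covering $\mathcal{H}$ of $\Sigma_0$ into $\mathbb{R}^3$. Then this immersion converts into an immersion of $\Sigma_0$ if and only if $$\int_{\Sigma_0}\bar\psi_1^2\,d\bar z\wedge\omega=\int_{\Sigma_0}\psi_2^2\,d\bar z\wedge\omega=\int_{\Sigma_0}\bar\psi_1\psi_2\,d\bar z\wedge\omega=0$$ for any holomorphic differential $\omega$ on $\Sigma_0$.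
   Context: Notation: $\partial=\partial/\partial z=\frac12(\partial_x-i\partial_y)$, $\bar\partial=\partial/\partial\bar z$. The Dirac operator with real-valued potential $U$ is $$\mathcal{D}=\begin{pmatrix}0&\partial\\-\bar\partial&0\end{pmatrix}+\begin{pmatrix}U&0\\0&U\end{pmatrix}.$$ A vector function $\psi=(\psi_1,\psi_2)$ with $\mathcal{D}\psi=0$ defines, up to translations, a map $X=(X^1,X^2,X^3)$ into $\mathbb{R}^3$ by the formulas (W): $$X^1=\frac i2\int\left((\bar\psi_2^2+\psi_1^2)\,dz-(\bar\psi_1^2+\psi_2^2)\,d\bar z\right),\quad X^2=\frac12\int\left((\bar\psi_2^2-\psi_1^2)\,dz-(\bar\psi_1^2-\psi_2^2)\,d\bar z\right),$$ $$X^3=\int\left(\psi_1\bar\psi_2\,dz+\bar\psi_1\psi_2\,d\bar z\right).$$ Here $\gamma(z)=\frac{az+b}{cz+d}$. The forms $\bar\psi_1^2d\bar z$, $\psi_2^2d\bar z$, $\bar\psi_1\psi_2d\bar z$ are correctly defined $1$-forms on $\Sigma_0$. The immersion "converts into an immersion of $\Sigma_0$" if the map $X:\mathcal{H}\to\mathbb{R}^3$ is $\Lambda$-invariant, i.e. descends to $\Sigma_0=\mathcal{H}/\Lambda$. *)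

theory Defs
  imports
    "HOL-Complex_Analysis.Complex_Analysis"
    "HOL-Homology.Homology"
begin

section \<open>Quotient topologies\<close>

definition quotient_topology_of :: "'a topology \<Rightarrow> ('a \<Rightarrow> 'b) \<Rightarrow> 'b topology" where
  "quotient_topology_of T q =
     topology (\<lambda>V. V \<subseteq> q ` topspace T \<and> openin T {x \<in> topspace T. q x \<in> V})"

lemma openin_quotient_topology_of:
  "openin (quotient_topology_of T q) V \<longleftrightarrow>
     V \<subseteq> q ` topspace T \<and> openin T {x \<in> topspace T. q x \<in> V}"
proof -
  let ?P = "\<lambda>V. V \<subseteq> q ` topspace T \<and> openin T {x \<in> topspace T. q x \<in> V}"
  have "istopology ?P"
    unfolding istopology_def
  proof (intro conjI allI impI)
    fix S R assume S: "?P S" and R: "?P R"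
    have "{x \<in> topspace T. q x \<in> S \<inter> R}
            = {x \<in> topspace T. q x \<in> S} \<inter> {x \<in> topspace T. q x \<in> R}" by auto
    then show "openin T {x \<in> topspace T. q x \<in> S \<inter> R}"
      using S R by auto
    show "S \<inter> R \<subseteq> q ` topspace T" using S by auto
  next
    fix K assume K: "\<forall>S\<in>K. ?P S"
    have "{x \<in> topspace T. q x \<in> \<Union>K} = (\<Union>S\<in>K. {x \<in> topspace T. q x \<in> S})" by auto
    then show "openin T {x \<in> topspace T. q x \<in> \<Union>K}"
      using K by auto
    show "\<Union>K \<subseteq> q ` topspace T" using K by auto
  qed
  then show ?thesis
    unfolding quotient_topology_of_def by (simp add: topology_inverse')
qed

lemma topspace_quotient_topology_of:
  "topspace (quotient_topology_of T q) = q ` topspace T"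
proof
  show "topspace (quotient_topology_of T q) \<subseteq> q ` topspace T"
    using openin_quotient_topology_of[of T q] openin_topspace by blast
  have "{x \<in> topspace T. q x \<in> q ` topspace T} = topspace T" by auto
  then have "openin (quotient_topology_of T q) (q ` topspace T)"
    by (simp add: openin_quotient_topology_of)
  then show "q ` topspace T \<subseteq> topspace (quotient_topology_of T q)"
    by (rule openin_subset)
qed

lemma quotient_map_quotient_topology_of:
  "quotient_map T (quotient_topology_of T q) q"
  by (auto simp: quotient_map_def topspace_quotient_topology_of openin_quotient_topology_of)


section \<open>\<open>PSL(2,\<real>)\<close> and its action on the upper half-plane\<close>

abbreviation upper_half_plane :: "complex set" ("\<H>") where
  "\<H> \<equiv> {z. Im z > 0}"

definition SL2R :: "(real^2^2) monoid" where
  "SL2R = \<lparr>carrier = {A. det A = 1}, mult = (**), one = mat 1\<rparr>"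

text \<open>An element of \<open>PSL2R\<close> is a coset \<open>{A, -A}\<close>; its members are the matrices that represent it.
  For a set \<open>\<Lambda>\<close> of such elements, \<open>\<Union>\<Lambda>\<close> is thus the set of all matrices representing
  elements of \<open>\<Lambda>\<close>.\<close>

definition PSL2R :: "(real^2^2) set monoid" where
  "PSL2R = SL2R Mod {mat 1, - mat 1}"

definition PSL2R_topology :: "(real^2^2) set topology" where
  "PSL2R_topology = quotient_topology_of (top_of_set (carrier SL2R)) (\<lambda>A. {A, - A})"

definition mob :: "real^2^2 \<Rightarrow> complex \<Rightarrow> complex" where
  "mob A = moebius (of_real (A$1$1)) (of_real (A$1$2)) (of_real (A$2$1)) (of_real (A$2$2))"

definition orbit_of :: "(real^2^2) set set \<Rightarrow> complex \<Rightarrow> complex set" where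
  "orbit_of \<Lambda> z = {mob A z | A. A \<in> \<Union>\<Lambda>}"

definition fundamental_set :: "(real^2^2) set set \<Rightarrow> complex set \<Rightarrow> bool" where
  "fundamental_set \<Lambda> F \<longleftrightarrow>
     F \<in> sets borel \<and> F \<subseteq> \<H> \<and> (\<forall>z\<in>\<H>. \<exists>!w. w \<in> F \<and> w \<in> orbit_of \<Lambda> z)"

text \<open>A lattice is a discrete subgroup of finite covolume. Finite covolume for the Haar measure on
  \<open>PSL(2,\<real>)\<close> amounts to finite area of \<open>\<H>/\<Lambda>\<close> for the invariant measure \<open>dx dy / y\<^sup>2\<close>, since
  \<open>\<H> = PSL(2,\<real>)/PSO(2)\<close> with \<open>PSO(2)\<close> compact.\<close>

definition hyperbolic_area :: "complex measure" where
  "hyperbolic_area = density lborel (\<lambda>z. ennreal (1 / (Im z)\<^sup>2))"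

definition lattice_PSL2R :: "(real^2^2) set set \<Rightarrow> bool" where
  "lattice_PSL2R \<Lambda> \<longleftrightarrow>
     subgroup \<Lambda> PSL2R \<and>
     subtopology PSL2R_topology \<Lambda> = discrete_topology \<Lambda> \<and>
     (\<exists>F. fundamental_set \<Lambda> F \<and> emeasure hyperbolic_area F < \<infinity>)"

definition acts_freely :: "(real^2^2) set set \<Rightarrow> bool" where
  "acts_freely \<Lambda> \<longleftrightarrow>
     (\<forall>\<gamma>\<in>\<Lambda>. \<gamma> \<noteq> \<one>\<^bsub>PSL2R\<^esub> \<longrightarrow> (\<forall>A\<in>\<gamma>. \<forall>z\<in>\<H>. mob A z \<noteq> z))"

definition quotient_surface :: "(real^2^2) set set \<Rightarrow> complex set topology" where
  "quotient_surface \<Lambda> = quotient_topology_of (top_of_set \<H>) (orbit_of \<Lambda>)"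

text \<open>For a compact connected oriented surface, \<open>H\<^sub>1\<close> is free abelian of rank twice the genus.\<close>

definition has_genus :: "'a topology \<Rightarrow> nat \<Rightarrow> bool" where
  "has_genus T g \<longleftrightarrow> homology_group 1 T \<cong> free_Abelian_group {..<2 * g}"


section \<open>Differentials on the quotient surface\<close>

text \<open>Differential forms on \<open>\<H>/\<Lambda>\<close> are represented by \<open>\<Lambda>\<close>-invariant forms on \<open>\<H>\<close>. The form
  \<open>f dz\<close> is invariant under \<open>z \<mapsto> mob A z\<close> iff it equals its pullback
  \<open>f (mob A z) (mob A)' z dz\<close>.\<close>

definition holomorphic_differential :: "(real^2^2) set set \<Rightarrow> (complex \<Rightarrow> complex) \<Rightarrow> bool" where
  "holomorphic_differential \<Lambda> f \<longleftrightarrow>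
     f holomorphic_on \<H> \<and>
     (\<forall>A\<in>\<Union>\<Lambda>. \<forall>z\<in>\<H>. f (mob A z) * deriv (mob A) z = f z)"

text \<open>\<open>wedge_integral \<Lambda> p f\<close> is the integral of \<open>(p d(cnj z)) \<and> (f dz)\<close> over \<open>\<H>/\<Lambda>\<close>, computed
  on a fundamental set (for invariant forms the choice does not matter);
  the factor comes from \<open>d(cnj z) \<and> dz = 2 \<i> dx \<and> dy\<close>.\<close>

definition wedge_integral ::
  "(real^2^2) set set \<Rightarrow> (complex \<Rightarrow> complex) \<Rightarrow> (complex \<Rightarrow> complex) \<Rightarrow> complex" where
  "wedge_integral \<Lambda> p f =
     2 * \<i> * (LINT z:(SOME F. fundamental_set \<Lambda> F)|lborel. p z * f z)"


section \<open>The Dirac equation\<close>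

definition del_z :: "(complex \<Rightarrow> complex) \<Rightarrow> complex \<Rightarrow> complex" where
  "del_z f z = (frechet_derivative f (at z) 1 - \<i> * frechet_derivative f (at z) \<i>) / 2"

definition del_zbar :: "(complex \<Rightarrow> complex) \<Rightarrow> complex \<Rightarrow> complex" where
  "del_zbar f z = (frechet_derivative f (at z) 1 + \<i> * frechet_derivative f (at z) \<i>) / 2"

text \<open>Differentiability here is over the reals.\<close>

definition C1_on_H :: "(complex \<Rightarrow> complex) \<Rightarrow> bool" where
  "C1_on_H f \<longleftrightarrow>
     (\<forall>z\<in>\<H>. f differentiable (at z)) \<and>
     (\<forall>v. continuous_on \<H> (\<lambda>z. frechet_derivative f (at z) v))"

definition dirac ::
  "(complex \<Rightarrow> real) \<Rightarrow> (complex \<Rightarrow> complex) \<times> (complex \<Rightarrow> complex) \<Rightarrow> complex \<Rightarrow> complex \<times> complex"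
where
  "dirac U \<psi> z =
     (del_z (snd \<psi>) z + of_real (U z) * fst \<psi> z,
      - del_zbar (fst \<psi>) z + of_real (U z) * snd \<psi> z)"

text \<open>Only one of the two matrices \<open>\<plusminus>A\<close> representing \<open>\<gamma>\<close> can satisfy the transformation law of a
  nonzero \<open>\<psi>\<close> (the choice of signs is a spin structure), whence \<open>\<exists>A\<in>\<gamma>\<close>.\<close>

definition automorphic ::
  "(real^2^2) set set \<Rightarrow> (complex \<Rightarrow> real) \<Rightarrow> (complex \<Rightarrow> complex) \<times> (complex \<Rightarrow> complex) \<Rightarrow> bool"
where
  "automorphic \<Lambda> U \<psi> \<longleftrightarrow>
     (\<forall>\<gamma>\<in>\<Lambda>. \<exists>A\<in>\<gamma>. \<forall>z\<in>\<H>.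
        U (mob A z) = (cmod (of_real (A$2$1) * z + of_real (A$2$2)))\<^sup>2 * U z \<and>
        fst \<psi> (mob A z) = (of_real (A$2$1) * z + of_real (A$2$2)) * fst \<psi> z \<and>
        snd \<psi> (mob A z) = (of_real (A$2$1) * cnj z + of_real (A$2$2)) * snd \<psi> z)"


section \<open>The Weierstrass representation\<close>

text \<open>The integrands: the value of the \<open>k\<close>-th 1-form at the point \<open>z\<close> on the tangent vector \<open>v\<close>,
  with \<open>dz\<close> evaluating to \<open>v\<close> and \<open>d(cnj z)\<close> to \<open>cnj v\<close>.\<close>

definition weierstrass_form ::
  "(complex \<Rightarrow> complex) \<times> (complex \<Rightarrow> complex) \<Rightarrow> complex \<Rightarrow> complex \<Rightarrow> complex^3" where
  "weierstrass_form \<psi> z v =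
     (let p = fst \<psi> z; q = snd \<psi> z in
      vector
       [\<i> / 2 * (((cnj q)\<^sup>2 + p\<^sup>2) * v - ((cnj p)\<^sup>2 + q\<^sup>2) * cnj v),
        1 / 2 * (((cnj q)\<^sup>2 - p\<^sup>2) * v - ((cnj p)\<^sup>2 - q\<^sup>2) * cnj v),
        p * cnj q * v + cnj p * q * cnj v])"

text \<open>\<open>X\<close> is a primitive of these forms, i.e. it is given by the integral formulas up to a
  translation.\<close>

definition weierstrass_map ::
  "(complex \<Rightarrow> complex) \<times> (complex \<Rightarrow> complex) \<Rightarrow> (complex \<Rightarrow> real^3) \<Rightarrow> bool" where
  "weierstrass_map \<psi> X \<longleftrightarrow>
     (\<forall>c. valid_path c \<and> path_image c \<subseteq> \<H> \<longrightarrow>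
        (\<forall>k. complex_of_real (X (pathfinish c) $ k - X (pathstart c) $ k) =
               integral {0..1} (\<lambda>t. weierstrass_form \<psi> (c t)
                                   (vector_derivative c (at t within {0..1})) $ k)))"

definition immersion_of_H :: "(complex \<Rightarrow> real^3) \<Rightarrow> bool" where
  "immersion_of_H X \<longleftrightarrow>
     (\<exists>X' :: complex \<Rightarrow> complex \<Rightarrow>\<^sub>L (real^3).
        continuous_on \<H> X' \<and>
        (\<forall>z\<in>\<H>. (X has_derivative blinfun_apply (X' z)) (at z) \<and> inj (blinfun_apply (X' z))))"

definition descends_to_quotient :: "(real^2^2) set set \<Rightarrow> (complex \<Rightarrow> 'b) \<Rightarrow> bool" where
  "descends_to_quotient \<Lambda> X \<longleftrightarrow> (\<forall>A\<in>\<Union>\<Lambda>. \<forall>z\<in>\<H>. X (mob A z) = X z)"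

end

theory Submission
  imports Defs "HOL-Probability.Probability_Measure"
begin

text \<open>Write \<open>u\<close> for a coordinate of \<open>X\<close>. Its differential is \<open>\<Lambda>\<close>-invariant, so
  \<open>u \<circ> A = u + \<rho>(A)\<close> for \<open>A \<in> \<Lambda>\<close>, and \<open>X\<close> descends iff all periods \<open>\<rho>(A)\<close> vanish. Up to linear
  combinations the three integrands are the \<open>d(cnj z)\<close>-parts of the differentials of the coordinates.

  Harmonic representative: averaging over hyperbolic discs of a large fixed radius contracts the
  invariant continuous functions of mean zero, because such a disc contains a translate of a compact
  set that meets every orbit. Iterating the average on \<open>u\<close> therefore converges to some \<open>h\<close> with the
  same periods that is fixed by this average. Averages of different radii commute (the isometry
  exchanging two points identifies the two convolution kernels), so \<open>h\<close> is fixed by the averages of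
  all radii, and hence \<open>h = Re W\<close> for a holomorphic \<open>W\<close> whose derivative is a holomorphic differential.

  Stokes: with \<open>E\<^sub>s(u, W)\<close> the integral of \<open>(u(w) - u(z)) (W(w) - W(z))\<close> over all pairs of points at
  distance less than \<open>s\<close>, modulo the diagonal action of \<open>\<Lambda>\<close>, the rescaled limit as \<open>s \<rightarrow> 0\<close> is a
  constant multiple of the integral of \<open>\<partial>u/\<partial>(cnj z) W'\<close>. If \<open>u\<close> is invariant and \<open>W\<close> is
  holomorphic, then \<open>E\<^sub>s(u, W) = 0\<close> for every \<open>s\<close>, by exchanging the two points and using the mean value
  property of \<open>W\<close>. This is one direction. For the other, apply it to \<open>u - h\<close>: orthogonality of \<open>u\<close> to
  \<open>W'\<close> makes the integral of \<open>\<bar>W'\<bar>\<^sup>2\<close> vanish, so \<open>h\<close> is constant and its periods are zero.\<close>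

text \<open>The fundamental set is merely Borel, so there is no boundary along which to integrate by
  parts, and only the continuity of the gradient of \<open>u\<close> is used, so no Laplacian is
  applied to it. Everything is therefore expressed through functions of pairs of points invariant
  under the diagonal action. This has two advantages. Periods cancel in differences, so even for an
  equivariant \<open>u\<close> the increments belong to the quotient and are bounded by compactness.
  And an integral over pairs modulo the group does not see the order of the two points, which is the
  only integration by parts in the proof. The averages weight a disc by Euclidean area in a chart
  centred at the point. That weight depends only on the hyperbolic distance, so averaging commutes
  with isometries; and the charts are holomorphic, so holomorphic functions are fixed by the
  averages of every radius exactly, not just up to an error term. The group is handled as a group of
  matrices containing both signs; the integrands are quadratic in the spinors, so the sign choice of
  the spin structure drops out.\<close>

no_notation fps_nth (infixl \<open>$\<close> 75)

section \<open>Holomorphic change of variables\<close>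

text \<open>The Jacobian formula \<open>has_measure_differentiable_image\<close> speaks about
  \<open>real^'n\<close>, so substitutions in the complex plane are carried out on
  \<open>real^2\<close> and brought back along this identification.\<close>

definition vec_cx :: "real^2 \<Rightarrow> complex" where
  "vec_cx x = Complex (x$1) (x$2)"

definition cx_vec :: "complex \<Rightarrow> real^2" where
  "cx_vec z = vector [Re z, Im z]"

lemma vec_cx_cx_vec [simp]: "vec_cx (cx_vec z) = z"
  by (simp add: vec_cx_def cx_vec_def)

lemma cx_vec_vec_cx [simp]: "cx_vec (vec_cx x) = x"
  by (simp add: vec_cx_def cx_vec_def vec_eq_iff forall_2)

lemma linear_vec_cx: "linear vec_cx"
  by (rule linearI) (auto simp: vec_cx_def complex_eq_iff)

lemma linear_cx_vec: "linear cx_vec"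
  by (rule linearI) (auto simp: cx_vec_def vec_eq_iff forall_2)

lemma bounded_linear_vec_cx: "bounded_linear vec_cx"
  using linear_vec_cx linear_conv_bounded_linear by blast

lemma bounded_linear_cx_vec: "bounded_linear cx_vec"
  using linear_cx_vec linear_conv_bounded_linear by blast

lemma vec_cx_measurable [measurable]: "vec_cx \<in> borel_measurable borel"
  by (intro borel_measurable_continuous_onI linear_continuous_on bounded_linear_vec_cx)

text \<open>A Borel measure that gives every box the product of its side lengths is
  \<open>lborel\<close>, and the preimage of a box is the box with the same sides.\<close>

lemma lborel_distr_vec_cx: "lborel = distr lborel borel vec_cx"
proof (rule lborel_eqI)
  fix l u :: complex assume le: "\<And>b. b \<in> Basis \<Longrightarrow> l \<bullet> b \<le> u \<bullet> b"
  have 1: "Re l \<le> Re u" "Im l \<le> Im u"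
    using le[of 1] le[of \<i>] by (auto simp: Basis_complex_def)
  have B: "Basis = {axis 1 1, axis 2 1 :: real^2}"
    by (auto simp: Basis_vec_def UNIV_2)
  have ne: "axis 1 1 \<noteq> (axis 2 1 :: real^2)"
    by (simp add: axis_eq_axis)
  have "vec_cx -` box l u = box (cx_vec l) (cx_vec u)"
    by (auto simp: box_def Basis_complex_def B inner_axis vec_cx_def cx_vec_def)
  moreover have "emeasure lborel (box (cx_vec l) (cx_vec u)) = (\<Prod>b\<in>Basis. (cx_vec u - cx_vec l) \<bullet> b)"
    using 1 by (subst emeasure_lborel_box_eq) (auto simp: B inner_axis cx_vec_def)
  moreover have "(\<Prod>b\<in>Basis. (cx_vec u - cx_vec l) \<bullet> b) = (Re u - Re l) * (Im u - Im l)"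
    using ne by (simp add: B inner_axis cx_vec_def)
  moreover have "(\<Prod>b\<in>Basis. (u - l) \<bullet> b) = (Re u - Re l) * (Im u - Im l)"
    by (simp add: Basis_complex_def)
  ultimately show "emeasure (distr lborel borel vec_cx) (box l u) = (\<Prod>b\<in>Basis. (u - l) \<bullet> b)"
    by (simp add: emeasure_distr)
qed simp

text \<open>The matrix has the rows \<open>(Re a, - Im a)\<close> and \<open>(Im a, Re a)\<close>;
  this is the Jacobian of a holomorphic map with derivative \<open>a\<close>.\<close>

lemma det_matrix_cx_mult:
  "det (matrix (\<lambda>x. cx_vec (a * vec_cx x))) = (cmod a)\<^sup>2"
  by (simp add: cmod_power2 power2_eq_square[of "Re a"] power2_eq_square[of "Im a"] det_2 matrix_def cx_vec_def vec_cx_def axis_def)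

text \<open>The Jacobian formula for \<open>g\<close>, read on \<open>real^2\<close>. Values in
  \<open>ennreal\<close> make it applicable without any check of finiteness.\<close>

lemma emeasure_holomorphic_image:
  assumes S: "S \<in> sets borel"
    and der: "\<And>z. z \<in> S \<Longrightarrow> (g has_field_derivative g' z) (at z within S)"
    and inj: "inj_on g S" and gS: "g ` S \<in> sets borel"
    and meas: "set_borel_measurable borel S g'"
  shows "emeasure lborel (g ` S) = (\<integral>\<^sup>+z\<in>S. ennreal ((cmod (g' z))\<^sup>2) \<partial>lborel)"
proof -
  define S2 where "S2 = cx_vec ` S"
  define g2 where "g2 = (\<lambda>x. cx_vec (g (vec_cx x)))"
  have S2v: "S2 = vec_cx -` S" "vec_cx ` S2 = S"
    unfolding S2_def by (auto simp: image_iff) (metis cx_vec_vec_cx)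
  have S2b: "S2 \<in> sets borel"
    using measurable_sets[OF vec_cx_measurable S] S2v by simp
  have g2v: "g2 ` S2 = vec_cx -` (g ` S)"
    unfolding S2_def g2_def by (auto simp: image_iff) (metis cx_vec_vec_cx)
  have g2b: "g2 ` S2 \<in> sets borel"
    using measurable_sets[OF vec_cx_measurable gS] g2v by simp
  have em: "emeasure lborel (vec_cx -` B) = emeasure lborel B" if "B \<in> sets borel" for B
    using that arg_cong[OF lborel_distr_vec_cx, of "\<lambda>M. emeasure M B"] by (simp add: emeasure_distr)
  have meas': "(\<lambda>z. indicator S z * (cmod (g' z))\<^sup>2) \<in> borel_measurable borel"
  proof -
    have "(\<lambda>z. (norm (indicator S z *\<^sub>R g' z))\<^sup>2) \<in> borel_measurable borel"
      using meas unfolding set_borel_measurable_def by measurable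
    moreover have "(\<lambda>z. (norm (indicator S z *\<^sub>R g' z))\<^sup>2) = (\<lambda>z. indicator S z * (cmod (g' z))\<^sup>2)"
      by (auto simp: indicator_def)
    ultimately show ?thesis by simp
  qed
  define D where "D = (\<lambda>x. indicator S (vec_cx x) * (cmod (g' (vec_cx x)))\<^sup>2)"
  have D0: "D x \<ge> 0" for x by (simp add: D_def indicator_def)
  have Dm: "D \<in> borel_measurable borel"
    unfolding D_def using measurable_compose[OF vec_cx_measurable meas'] by simp
  have rhs: "(\<integral>\<^sup>+z\<in>S. ennreal ((cmod (g' z))\<^sup>2) \<partial>lborel) = (\<integral>\<^sup>+x. ennreal (D x) \<partial>lborel)"
  proof -
    have "(\<integral>\<^sup>+z\<in>S. ennreal ((cmod (g' z))\<^sup>2) \<partial>lborel)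
        = (\<integral>\<^sup>+z. ennreal (indicator S z * (cmod (g' z))\<^sup>2) \<partial>lborel)"
      by (intro nn_integral_cong) (auto simp: indicator_def)
    also have "\<dots> = (\<integral>\<^sup>+x. ennreal (D x) \<partial>lborel)"
      unfolding D_def using meas' by (subst lborel_distr_vec_cx) (subst nn_integral_distr, auto)
    finally show ?thesis .
  qed
  have der2: "(g2 has_derivative (\<lambda>x. cx_vec (g' (vec_cx y) * vec_cx x))) (at y within S2)"
    if "y \<in> S2" for y
  proof -
    have "vec_cx y \<in> S" using that S2v by auto
    then have "(g has_derivative (\<lambda>x. g' (vec_cx y) * x)) (at (vec_cx y) within vec_cx ` S2)"
      using der[of "vec_cx y"] S2v by (simp add: has_field_derivative_def)
    from diff_chain_within[OF bounded_linear.has_derivative[OF bounded_linear_vec_cx has_derivative_ident] this]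
    have "((\<lambda>x. g (vec_cx x)) has_derivative (\<lambda>x. g' (vec_cx y) * vec_cx x)) (at y within S2)"
      by (simp add: o_def)
    from bounded_linear.has_derivative[OF bounded_linear_cx_vec this]
    show ?thesis unfolding g2_def .
  qed
  have inj2: "inj_on g2 S2"
  proof (rule inj_onI)
    fix x y assume "x \<in> S2" "y \<in> S2" "g2 x = g2 y"
    then have "g (vec_cx x) = g (vec_cx y)" unfolding g2_def by (metis vec_cx_cx_vec)
    then have "vec_cx x = vec_cx y" using inj \<open>x \<in> S2\<close> \<open>y \<in> S2\<close> S2v by (auto dest: inj_onD)
    then show "x = y" by (metis cx_vec_vec_cx)
  qed
  \<comment> \<open>An equivalence between finite measure and finite integral. One direction settles
    the finite case; the other shows that an infinite integral excludes a finite measure.\<close>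
  have key: "g2 ` S2 \<in> lmeasurable \<and> measure lebesgue (g2 ` S2) = m
     \<longleftrightarrow> (D has_integral m) UNIV" for m
  proof -
    have "g2 ` S2 \<in> lmeasurable \<and> measure lebesgue (g2 ` S2) = m \<longleftrightarrow>
       ((\<lambda>x. \<bar>det (matrix (\<lambda>v. cx_vec (g' (vec_cx x) * vec_cx v)))\<bar>) has_integral m) S2"
      using S2b der2 inj2 by (intro has_measure_differentiable_image) auto
    also have "\<dots> \<longleftrightarrow> ((\<lambda>x. (cmod (g' (vec_cx x)))\<^sup>2) has_integral m) S2"
      by (simp add: det_matrix_cx_mult)
    also have "\<dots> \<longleftrightarrow> ((\<lambda>x. if x \<in> S2 then (cmod (g' (vec_cx x)))\<^sup>2 else 0) has_integral m) UNIV"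
      by (simp add: has_integral_restrict_UNIV)
    also have "(\<lambda>x. if x \<in> S2 then (cmod (g' (vec_cx x)))\<^sup>2 else 0) = D"
      by (auto simp: D_def S2v indicator_def)
    finally show ?thesis .
  qed
  have "emeasure lborel (g2 ` S2) = (\<integral>\<^sup>+x. ennreal (D x) \<partial>lborel)"
  proof (cases "(\<integral>\<^sup>+x. ennreal (D x) \<partial>lborel) < \<infinity>")
    case True
    then obtain r where r: "(\<integral>\<^sup>+x. ennreal (D x) \<partial>lborel) = ennreal r" "r \<ge> 0"
      by (cases "\<integral>\<^sup>+x. ennreal (D x) \<partial>lborel") auto
    then have "(D has_integral r) UNIV"
      using Dm D0 by (intro nn_integral_has_integral) auto
    then have "g2 ` S2 \<in> lmeasurable" "measure lebesgue (g2 ` S2) = r" using key by auto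
    then have "emeasure lebesgue (g2 ` S2) = ennreal r"
      by (metis emeasure_eq_measure2 fmeasurableD2 infinity_ennreal_def emeasure_eq_ennreal_measure)
    then show ?thesis using g2b r by simp
  next
    case False
    have "emeasure lborel (g2 ` S2) = \<infinity>"
    proof (rule ccontr)
      assume "\<not> ?thesis"
      then have "g2 ` S2 \<in> lmeasurable" using g2b
        by (intro fmeasurableI) (auto simp: less_top)
      then have "(D has_integral (measure lebesgue (g2 ` S2))) UNIV" using key by auto
      then have "(\<integral>\<^sup>+x. ennreal (D x) \<partial>lborel) = ennreal (measure lebesgue (g2 ` S2))"
        using D0 by (intro nn_integral_has_integral_lborel Dm) auto
      then show False using False by simp
    qed
    then show ?thesis using False by (simp add: not_less top.extremum_unique)
  qed
  moreover have "emeasure lborel (g2 ` S2) = emeasure lborel (g ` S)"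
    using em[OF gS] g2v by simp
  ultimately show ?thesis using rhs by simp
qed

text \<open>Two measures are compared on Borel sets: \<open>lborel\<close> restricted to the image
  of \<open>S\<close>, and the push-forward under \<open>g\<close> of the measure with density
  \<open>D\<close>. On a Borel set this is the preceding formula, applied to the part of
  \<open>S\<close> that \<open>g\<close> sends into it.\<close>

lemma nn_integral_holomorphic_substitution:
  assumes "open S" and hol: "g holomorphic_on S" and inj: "inj_on g S"
    and f: "f \<in> borel_measurable borel"
  shows "(\<integral>\<^sup>+w\<in>g ` S. f w \<partial>lborel) = (\<integral>\<^sup>+z\<in>S. f (g z) * ennreal ((cmod (deriv g z))\<^sup>2) \<partial>lborel)"
proof -
  have opT: "open (g ` S)" by (rule open_mapping_thm3) fact+
  have contg: "continuous_on S g" using hol holomorphic_on_imp_continuous_on by blast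
  have contg': "continuous_on S (deriv g)"
    using hol \<open>open S\<close> holomorphic_deriv holomorphic_on_imp_continuous_on by blast
  define D where "D = (\<lambda>z. indicator S z * ennreal ((cmod (deriv g z))\<^sup>2))"
  \<comment> \<open>Extended by 0 to be Borel on the whole plane; the density \<open>D\<close>
    vanishes outside \<open>S\<close>, so the extension carries no mass.\<close>
  define g0 where "g0 = (\<lambda>z. if z \<in> S then g z else 0)"
  have g0m [measurable]: "g0 \<in> borel_measurable borel"
    unfolding g0_def using \<open>open S\<close> contg
    by (intro borel_measurable_continuous_on_if) auto
  have g'm: "set_borel_measurable borel A (deriv g)" if "A \<in> sets borel" "A \<subseteq> S" for A
  proof -
    have "(\<lambda>z. if z \<in> S then deriv g z else 0) \<in> borel_measurable borel"
      using \<open>open S\<close> contg' by (intro borel_measurable_continuous_on_if) auto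
    then have "(\<lambda>z. indicator A z *\<^sub>R (if z \<in> S then deriv g z else 0)) \<in> borel_measurable borel"
      using that by measurable
    moreover have "(\<lambda>z. indicator A z *\<^sub>R (if z \<in> S then deriv g z else 0)) = (\<lambda>z. indicator A z *\<^sub>R deriv g z)"
      using that by (intro ext) (auto simp: indicator_def)
    ultimately show ?thesis unfolding set_borel_measurable_def by simp
  qed
  have Dm [measurable]: "D \<in> borel_measurable borel"
  proof -
    have "(\<lambda>z. ennreal ((cmod (indicator S z *\<^sub>R deriv g z))\<^sup>2)) \<in> borel_measurable borel"
      using g'm[of S] \<open>open S\<close> unfolding set_borel_measurable_def by measurable
    moreover have "(\<lambda>z. ennreal ((cmod (indicator S z *\<^sub>R deriv g z))\<^sup>2)) = D"
      by (auto simp: D_def indicator_def)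
    ultimately show ?thesis by (simp only:)
  qed
  have Tm [measurable]: "g ` S \<in> sets borel" and Sm [measurable]: "S \<in> sets borel"
    using opT \<open>open S\<close> by auto
  note f [measurable]
  have eq: "density lborel (indicator (g ` S)) = distr (density lborel D) borel g0"
  proof (rule measure_eqI)
    fix B assume "B \<in> sets (density lborel (indicator (g ` S)))"
    then have B [measurable]: "B \<in> sets borel" by simp
    define S' where "S' = S \<inter> g0 -` B"
    have S'm [measurable]: "S' \<in> sets borel"
      unfolding S'_def using measurable_sets[OF g0m B] by simp
    have S's: "S' \<subseteq> S" by (auto simp: S'_def)
    have im: "g ` S' = g ` S \<inter> B" by (auto simp: S'_def g0_def)
    have "emeasure (density lborel (indicator (g ` S))) B = emeasure lborel (g ` S')"
      unfolding im by (subst emeasure_density)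
         (auto simp: nn_integral_indicator[symmetric] indicator_inter_arith[symmetric] simp del: nn_integral_indicator)
    also have "\<dots> = (\<integral>\<^sup>+z\<in>S'. ennreal ((cmod (deriv g z))\<^sup>2) \<partial>lborel)"
    proof (rule emeasure_holomorphic_image)
      show "(g has_field_derivative deriv g z) (at z within S')" if "z \<in> S'" for z
        using that S's hol \<open>open S\<close> holomorphic_derivI by blast
      show "inj_on g S'" using inj S's inj_on_subset by blast
      show "g ` S' \<in> sets borel" unfolding im by simp
    qed (use g'm S's S'm in auto)
    also have "\<dots> = emeasure (distr (density lborel D) borel g0) B"
      by (simp add: emeasure_distr emeasure_density measurable_sets_borel[OF g0m B])
         (auto simp: D_def S'_def indicator_def intro!: nn_integral_cong)
    finally show "emeasure (density lborel (indicator (g ` S))) B = emeasure (distr (density lborel D) borel g0) B" .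
  qed simp
  have "(\<integral>\<^sup>+w\<in>g ` S. f w \<partial>lborel) = (\<integral>\<^sup>+w. f w \<partial>density lborel (indicator (g ` S)))"
    by (subst nn_integral_density) (auto simp: mult.commute)
  also have "\<dots> = (\<integral>\<^sup>+z. f (g0 z) \<partial>density lborel D)"
    unfolding eq by (subst nn_integral_distr) auto
  also have "\<dots> = (\<integral>\<^sup>+z. D z * f (g0 z) \<partial>lborel)"
    by (subst nn_integral_density) auto
  also have "\<dots> = (\<integral>\<^sup>+z\<in>S. f (g z) * ennreal ((cmod (deriv g z))\<^sup>2) \<partial>lborel)"
    by (intro nn_integral_cong) (auto simp: D_def g0_def indicator_def mult.commute)
  finally show ?thesis .
qed

section \<open>Disc charts of the half-plane and the hyperbolic measure\<close>

text \<open>The Cayley map from the unit disc to the half-plane that sends 0 to \<open>z\<close>;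
  \<open>H_to_disc\<close> is its inverse. The modulus of \<open>H_to_disc z w\<close> is tanh of
  half the hyperbolic distance from \<open>z\<close> to \<open>w\<close>, so Euclidean discs about 0
  in this chart are hyperbolic discs about \<open>z\<close>.\<close>

definition disc_to_H :: "complex \<Rightarrow> complex \<Rightarrow> complex" where
  "disc_to_H z \<zeta> = (z - cnj z * \<zeta>) / (1 - \<zeta>)"

definition H_to_disc :: "complex \<Rightarrow> complex \<Rightarrow> complex" where
  "H_to_disc z w = (w - z) / (w - cnj z)"

lemma disc_to_H_0 [simp]: "disc_to_H z 0 = z"
  by (simp add: disc_to_H_def)

lemma Im_disc_to_H:
  assumes "\<zeta> \<noteq> 1"
  shows "Im (disc_to_H z \<zeta>) = Im z * (1 - (cmod \<zeta>)\<^sup>2) / (cmod (1 - \<zeta>))\<^sup>2"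
proof -
  have "disc_to_H z \<zeta> = (z - cnj z * \<zeta>) * cnj (1 - \<zeta>) / ((1 - \<zeta>) * cnj (1 - \<zeta>))"
    using assms by (simp add: disc_to_H_def)
  also have "\<dots> = (z - cnj z * \<zeta>) * cnj (1 - \<zeta>) / of_real ((cmod (1 - \<zeta>))\<^sup>2)"
    by (simp only: complex_norm_square)
  finally have "Im (disc_to_H z \<zeta>) = Im ((z - cnj z * \<zeta>) * cnj (1 - \<zeta>)) / (cmod (1 - \<zeta>))\<^sup>2"
    by simp
  also have "Im ((z - cnj z * \<zeta>) * cnj (1 - \<zeta>)) = Im z * (1 - (cmod \<zeta>)\<^sup>2)"
    by (simp add: cmod_power2) (simp add: algebra_simps power2_eq_square)
  finally show ?thesis .
qed

lemma disc_to_H_in_H: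
  assumes "z \<in> \<H>" "cmod \<zeta> < 1"
  shows "disc_to_H z \<zeta> \<in> \<H>"
proof -
  have "\<zeta> \<noteq> 1" using assms by auto
  moreover have "(cmod \<zeta>)\<^sup>2 < 1" using assms by (simp add: power_less_one_iff)
  ultimately show ?thesis using assms by (simp add: Im_disc_to_H)
qed

lemma H_to_disc_to_H:
  assumes "Im z \<noteq> 0" "w \<noteq> cnj z"
  shows "disc_to_H z (H_to_disc z w) = w"
proof -
  have "z \<noteq> cnj z" using assms by (auto simp: complex_eq_iff)
  have "1 - H_to_disc z w = (z - cnj z) / (w - cnj z)"
    using assms by (simp add: H_to_disc_def field_simps)
  moreover have "z - cnj z * H_to_disc z w = w * (z - cnj z) / (w - cnj z)"
    using assms by (simp add: H_to_disc_def divide_simps) (simp add: algebra_simps)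
  ultimately show ?thesis
    using \<open>z \<noteq> cnj z\<close> assms by (simp add: disc_to_H_def)
qed

lemma disc_to_H_to_disc:
  assumes "Im z \<noteq> 0" "\<zeta> \<noteq> 1"
  shows "H_to_disc z (disc_to_H z \<zeta>) = \<zeta>"
proof -
  have "z \<noteq> cnj z" using assms by (auto simp: complex_eq_iff)
  have "disc_to_H z \<zeta> - cnj z = (z - cnj z) / (1 - \<zeta>)"
    using assms by (simp add: disc_to_H_def divide_simps) (simp add: algebra_simps)
  moreover have "disc_to_H z \<zeta> - z = \<zeta> * (z - cnj z) / (1 - \<zeta>)"
    using assms by (simp add: disc_to_H_def divide_simps) (simp add: algebra_simps)
  ultimately show ?thesis
    using \<open>z \<noteq> cnj z\<close> assms by (simp add: H_to_disc_def)
qed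

text \<open>The squared distances of \<open>w\<close> to \<open>cnj z\<close> and to
  \<open>z\<close> differ by \<open>4 * Im z * Im w\<close>.\<close>

lemma norm_H_to_disc_less_1:
  assumes "z \<in> \<H>" "w \<in> \<H>"
  shows "cmod (H_to_disc z w) < 1"
proof -
  have "(cmod (w - z))\<^sup>2 < (cmod (w - cnj z))\<^sup>2"
    using assms by (simp add: cmod_power2) (simp add: power2_eq_square algebra_simps)
  then have "cmod (w - z) < cmod (w - cnj z)"
    by (rule power2_less_imp_less) simp
  then show ?thesis by (simp add: H_to_disc_def norm_divide divide_less_eq)
qed

lemma norm_H_to_disc_commute: "cmod (H_to_disc z w) = cmod (H_to_disc w z)"
proof -
  have "cmod (w - cnj z) = cmod (cnj (w - cnj z))" by (rule complex_mod_cnj[symmetric])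
  also have "\<dots> = cmod (z - cnj w)" by (simp add: norm_minus_commute)
  finally show ?thesis by (simp add: H_to_disc_def norm_divide norm_minus_commute[of w z])
qed

lemma disc_to_H_image:
  assumes "z \<in> \<H>"
  shows "disc_to_H z ` ball 0 1 = \<H>"
proof
  show "disc_to_H z ` ball 0 1 \<subseteq> \<H>"
    using disc_to_H_in_H[OF assms] by auto
  show "\<H> \<subseteq> disc_to_H z ` ball 0 1"
  proof
    fix w assume w: "w \<in> \<H>"
    have "w \<noteq> cnj z" using w assms by auto
    then have "w = disc_to_H z (H_to_disc z w)" using assms by (simp add: H_to_disc_to_H)
    moreover have "H_to_disc z w \<in> ball 0 1" using norm_H_to_disc_less_1[OF assms w] by simp
    ultimately show "w \<in> disc_to_H z ` ball 0 1" by (rule image_eqI)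
  qed
qed

lemma inj_on_disc_to_H:
  assumes "z \<in> \<H>"
  shows "inj_on (disc_to_H z) (ball 0 1)"
proof (rule inj_on_inverseI)
  fix \<zeta> :: complex assume "\<zeta> \<in> ball 0 1"
  then show "H_to_disc z (disc_to_H z \<zeta>) = \<zeta>" using assms by (intro disc_to_H_to_disc) auto
qed

lemma disc_to_H_has_field_derivative:
  assumes "\<zeta> \<noteq> 1"
  shows "(disc_to_H z has_field_derivative (z - cnj z) / (1 - \<zeta>)\<^sup>2) (at \<zeta> within S)"
proof -
  have nz: "1 - \<zeta> \<noteq> 0" using assms by simp
  have "(disc_to_H z has_field_derivative
      ((- cnj z) * (1 - \<zeta>) - (z - cnj z * \<zeta>) * (- 1)) / ((1 - \<zeta>) * (1 - \<zeta>))) (at \<zeta> within S)"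
    unfolding disc_to_H_def[abs_def] using nz by (intro derivative_eq_intros | simp)+
  also have "(- cnj z) * (1 - \<zeta>) - (z - cnj z * \<zeta>) * (- 1) = z - cnj z"
    by (simp add: algebra_simps)
  finally show ?thesis by (simp add: power2_eq_square)
qed

lemma disc_to_H_holomorphic: "disc_to_H z holomorphic_on ball 0 1"
proof (rule holomorphic_onI)
  fix \<zeta> :: complex assume "\<zeta> \<in> ball 0 1"
  then have "\<zeta> \<noteq> 1" by auto
  then show "disc_to_H z field_differentiable at \<zeta> within ball 0 1"
    using disc_to_H_has_field_derivative field_differentiable_def by blast
qed

lemma H_to_disc_holomorphic: "z \<in> \<H> \<Longrightarrow> H_to_disc z holomorphic_on \<H>"
  unfolding H_to_disc_def by (intro holomorphic_intros) (auto simp: complex_eq_iff)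

lemma open_H [simp]: "open \<H>"
  by (simp add: open_halfspace_Im_gt)

lemma H_borel [measurable, simp]: "\<H> \<in> sets borel"
  by (rule borel_open) simp

lemma convex_H: "convex \<H>"
  by (simp add: convex_halfspace_Im_gt)


text \<open>The density is cut off outside \<H>, so that integrals over the whole plane are
  integrals over \<H>.\<close>

definition hyp :: "complex measure" where
  "hyp = density lborel (\<lambda>z. indicator \<H> z * ennreal (1 / (Im z)\<^sup>2))"

lemma sets_hyp [measurable_cong, simp]: "sets hyp = sets borel"
  by (simp add: hyp_def)

lemma space_hyp [simp]: "space hyp = UNIV"
  by (simp add: hyp_def)

lemma nn_integral_hyp:
  assumes [measurable]: "f \<in> borel_measurable borel"
  shows "(\<integral>\<^sup>+z. f z \<partial>hyp) = (\<integral>\<^sup>+z\<in>\<H>. f z * ennreal (1 / (Im z)\<^sup>2) \<partial>lborel)"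
  unfolding hyp_def by (subst nn_integral_density) (auto simp: mult_ac)

lemma AE_hyp_H: "AE z in hyp. z \<in> \<H>"
  unfolding hyp_def by (subst AE_density) (auto simp: indicator_def)

lemma sigma_finite_hyp: "sigma_finite_measure hyp"
  unfolding hyp_def
  by (subst sigma_finite_measure.sigma_finite_iff_density_finite[OF lborel.sigma_finite_measure_axioms])
     (auto simp: indicator_def)

interpretation hyp: sigma_finite_measure hyp
  by (rule sigma_finite_hyp)

text \<open>At \<zeta> the chart has height
  \<open>Im z * (1 - |\<zeta>|^2) / |1 - \<zeta>|^2\<close> and a derivative of modulus
  \<open>2 * Im z / |1 - \<zeta>|^2\<close>. In the quotient of the squares \<open>z\<close>
  cancels: the density is the same around every point.\<close>

lemma nn_integral_hyp_disc:
  assumes z: "z \<in> \<H>" and f [measurable]: "f \<in> borel_measurable borel"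
  shows "(\<integral>\<^sup>+w. f w \<partial>hyp)
       = (\<integral>\<^sup>+\<zeta>\<in>ball 0 1. f (disc_to_H z \<zeta>) * ennreal (4 / (1 - (cmod \<zeta>)\<^sup>2)\<^sup>2) \<partial>lborel)"
proof -
  have "(\<integral>\<^sup>+w. f w \<partial>hyp)
      = (\<integral>\<^sup>+w\<in>disc_to_H z ` ball 0 1. (f w * ennreal (1 / (Im w)\<^sup>2)) \<partial>lborel)"
    using z by (simp add: nn_integral_hyp disc_to_H_image)
  also have "\<dots> = (\<integral>\<^sup>+\<zeta>\<in>ball 0 1. (f (disc_to_H z \<zeta>) * ennreal (1 / (Im (disc_to_H z \<zeta>))\<^sup>2))
        * ennreal ((cmod (deriv (disc_to_H z) \<zeta>))\<^sup>2) \<partial>lborel)"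
    by (rule nn_integral_holomorphic_substitution)
       (auto simp: disc_to_H_holomorphic inj_on_disc_to_H[OF z])
  also have "\<dots> = (\<integral>\<^sup>+\<zeta>\<in>ball 0 1. f (disc_to_H z \<zeta>) * ennreal (4 / (1 - (cmod \<zeta>)\<^sup>2)\<^sup>2) \<partial>lborel)"
  proof (intro nn_integral_cong)
    fix \<zeta> :: complex
    show "f (disc_to_H z \<zeta>) * ennreal (1 / (Im (disc_to_H z \<zeta>))\<^sup>2) * ennreal ((cmod (deriv (disc_to_H z) \<zeta>))\<^sup>2)
        * indicator (ball 0 1) \<zeta> = f (disc_to_H z \<zeta>) * ennreal (4 / (1 - (cmod \<zeta>)\<^sup>2)\<^sup>2) * indicator (ball 0 1) \<zeta>"
    proof (cases "\<zeta> \<in> ball 0 1")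
      case True
      then have 1: "\<zeta> \<noteq> 1" by auto
      have 2: "(cmod \<zeta>)\<^sup>2 < 1" using True by (simp add: power_less_one_iff)
      have 3: "cmod (1 - \<zeta>) > 0" using 1 by simp
      have "z - cnj z = of_real (2 * Im z) * \<i>" by (simp add: complex_eq_iff)
      then have d: "cmod (z - cnj z) = 2 * Im z" using z by (simp add: norm_mult del: of_real_mult)
      have "(cmod (deriv (disc_to_H z) \<zeta>))\<^sup>2 = 4 * (Im z)\<^sup>2 / (cmod (1 - \<zeta>)) ^ 4"
        using DERIV_imp_deriv[OF disc_to_H_has_field_derivative[OF 1, where S=UNIV and z=z]] d
        by (simp add: norm_divide norm_power power_divide power_mult_distrib flip: power_mult)
      then have "1 / (Im (disc_to_H z \<zeta>))\<^sup>2 * (cmod (deriv (disc_to_H z) \<zeta>))\<^sup>2 = 4 / (1 - (cmod \<zeta>)\<^sup>2)\<^sup>2"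
        using 1 2 3 z by (simp add: Im_disc_to_H power_divide power_mult_distrib flip: power_mult)
      then have "ennreal (1 / (Im (disc_to_H z \<zeta>))\<^sup>2) * ennreal ((cmod (deriv (disc_to_H z) \<zeta>))\<^sup>2)
          = ennreal (4 / (1 - (cmod \<zeta>)\<^sup>2)\<^sup>2)"
        by (simp add: ennreal_mult'[symmetric])
      then show ?thesis by (simp add: mult.assoc)
    qed simp
  qed
  finally show ?thesis .
qed

section \<open>The uniform measure on the unit disc and the averaging kernel\<close>

definition unit_disc_measure :: "complex measure" where
  "unit_disc_measure = uniform_measure lborel (ball 0 1)"

definition disc_area :: real where
  "disc_area = measure lborel (ball (0::complex) 1)"

lemma disc_area_pos: "disc_area > 0"
  unfolding disc_area_def by (simp add: content_ball_pos)

lemma emeasure_disc: "emeasure lborel (ball (0::complex) 1) = ennreal disc_area"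
  unfolding disc_area_def using emeasure_lborel_ball_finite[of "0::complex" 1]
  by (intro emeasure_eq_ennreal_measure) auto

lemma prob_space_unit_disc: "prob_space unit_disc_measure"
  unfolding unit_disc_measure_def
  by (rule prob_space_uniform_measure) (use disc_area_pos in \<open>auto simp: emeasure_disc\<close>)

interpretation udisc: prob_space unit_disc_measure
  by (rule prob_space_unit_disc)

lemma sets_unit_disc [measurable_cong, simp]: "sets unit_disc_measure = sets borel"
  by (simp add: unit_disc_measure_def)

lemma space_unit_disc [simp]: "space unit_disc_measure = UNIV"
  by (simp add: unit_disc_measure_def)

lemma AE_unit_disc: "AE \<eta> in unit_disc_measure. cmod \<eta> < 1"
  unfolding unit_disc_measure_def
  by (rule AE_uniform_measureI) auto

lemma nn_integral_unit_disc:
  assumes [measurable]: "f \<in> borel_measurable borel"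
  shows "(\<integral>\<^sup>+\<eta>. f \<eta> \<partial>unit_disc_measure) = (\<integral>\<^sup>+\<eta>\<in>ball 0 1. f \<eta> \<partial>lborel) / ennreal disc_area"
  unfolding unit_disc_measure_def
  by (subst nn_integral_uniform_measure) (auto simp: emeasure_disc)

text \<open>Multiplication by \<open>e\<close> maps the disc onto itself with Jacobian 1. Isometries
  of \<H> act between disc charts by such rotations, so this is the source of the isometry
  invariance of averages.\<close>

lemma unit_disc_rotate:
  assumes e: "cmod e = 1"
  shows "distr unit_disc_measure borel ((*) e) = unit_disc_measure"
proof (rule measure_eqI)
  fix B assume "B \<in> sets (distr unit_disc_measure borel ((*) e))"
  then have B [measurable]: "B \<in> sets borel" by simp
  have e0: "e \<noteq> 0" using e by auto
  have im: "(*) e ` ball 0 1 = ball 0 1"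
  proof -
    have "w \<in> (*) e ` ball 0 1" if "cmod w < 1" for w
      by (rule image_eqI[of _ _ "w / e"]) (use that e e0 in \<open>auto simp: norm_divide\<close>)
    then show ?thesis using e by (auto simp: norm_mult)
  qed
  have "(\<integral>\<^sup>+w\<in>(*) e ` ball 0 1. indicator B w \<partial>lborel)
     = (\<integral>\<^sup>+z\<in>ball 0 1. indicator B (e * z) * ennreal ((cmod (deriv ((*) e) z))\<^sup>2) \<partial>lborel)"
    by (rule nn_integral_holomorphic_substitution) (use e0 in \<open>auto intro!: holomorphic_intros inj_onI\<close>)
  then have "(\<integral>\<^sup>+w\<in>ball 0 1. indicator B w \<partial>lborel) = (\<integral>\<^sup>+z\<in>ball 0 1. indicator B (e * z) \<partial>lborel)"
    unfolding im by (simp add: e)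
  then have "(\<integral>\<^sup>+w. indicator B w \<partial>unit_disc_measure) = (\<integral>\<^sup>+z. indicator B (e * z) \<partial>unit_disc_measure)"
    by (simp add: nn_integral_unit_disc del: nn_integral_indicator)
  also have "\<dots> = (\<integral>\<^sup>+z. indicator B z \<partial>distr unit_disc_measure borel ((*) e))"
    by (subst nn_integral_distr) auto
  finally show "emeasure (distr unit_disc_measure borel ((*) e)) B = emeasure unit_disc_measure B"
    by simp
qed simp

lemma integral_unit_disc_rotate:
  fixes f :: "complex \<Rightarrow> 'b::{banach, second_countable_topology}"
  assumes e: "cmod e = 1" and f [measurable]: "f \<in> borel_measurable borel"
  shows "(\<integral>\<eta>. f (e * \<eta>) \<partial>unit_disc_measure) = (\<integral>\<eta>. f \<eta> \<partial>unit_disc_measure)"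
proof -
  have "(\<integral>\<eta>. f \<eta> \<partial>unit_disc_measure) = (\<integral>\<eta>. f \<eta> \<partial>distr unit_disc_measure borel ((*) e))"
    by (simp add: unit_disc_rotate[OF e])
  also have "\<dots> = (\<integral>\<eta>. f (e * \<eta>) \<partial>unit_disc_measure)"
    by (subst integral_distr) auto
  finally show ?thesis ..
qed

text \<open>In the disc chart at \<open>z\<close> the hyperbolic measure has density \<open>4 / (1 - \<bar>\<zeta>\<bar>\<^sup>2)\<^sup>2\<close>; the kernel cancels
  it, so that averaging against it is averaging over a Euclidean disc of radius \<open>s\<close> in the chart.\<close>

definition avg_kernel :: "real \<Rightarrow> complex \<Rightarrow> complex \<Rightarrow> real" where
  "avg_kernel s z w = (if cmod (H_to_disc z w) < s
     then (1 - (cmod (H_to_disc z w))\<^sup>2)\<^sup>2 / (4 * disc_area * s\<^sup>2) else 0)"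

lemma avg_kernel_commute: "avg_kernel s z w = avg_kernel s w z"
  by (simp add: avg_kernel_def norm_H_to_disc_commute[of z w])

lemma avg_kernel_nonneg: "avg_kernel s z w \<ge> 0"
  using disc_area_pos by (auto simp: avg_kernel_def)

lemma cnj_measurable [measurable]: "cnj \<in> borel_measurable borel"
  by (intro borel_measurable_continuous_onI continuous_intros)

lemma H_to_disc_measurable  [measurable]:
  assumes [measurable]: "f \<in> borel_measurable M" "g \<in> borel_measurable M"
  shows "(\<lambda>x. H_to_disc (f x) (g x)) \<in> borel_measurable M"
  unfolding H_to_disc_def by measurable

lemma disc_to_H_measurable  [measurable]:
  assumes [measurable]: "f \<in> borel_measurable M" "g \<in> borel_measurable M"
  shows "(\<lambda>x. disc_to_H (f x) (g x)) \<in> borel_measurable M"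
  unfolding disc_to_H_def by measurable

lemma avg_kernel_measurable  [measurable]:
  assumes [measurable]: "f \<in> borel_measurable M" "g \<in> borel_measurable M"
  shows "(\<lambda>x. avg_kernel s (f x) (g x)) \<in> borel_measurable M"
  unfolding avg_kernel_def by measurable

text \<open>Writes an average in the chart at \<open>z\<close> as an integral over \<H> against a
  kernel that is symmetric in the two points, a symmetry which the chart hides.\<close>

lemma nn_integral_avg_kernel:
  assumes z: "z \<in> \<H>" and s: "0 < s" "s < 1" and f [measurable]: "f \<in> borel_measurable borel"
  shows "(\<integral>\<^sup>+\<eta>. f (disc_to_H z (of_real s * \<eta>)) \<partial>unit_disc_measure)
       = (\<integral>\<^sup>+w. f w * ennreal (avg_kernel s z w) \<partial>hyp)"
proof -
  \<comment> \<open>The density of the uniform distribution on the disc of radius \<open>s\<close>;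
    its \<open>s\<^sup>2\<close> is cancelled later by the Jacobian of the scaling by
    \<open>s\<close>.\<close>
  let ?c = "1 / (disc_area * s\<^sup>2)"
  have [measurable]: "ball (0::complex) r \<in> sets borel" for r by simp
  have c0: "?c \<ge> 0" using disc_area_pos by simp
  have im: "(*) (of_real s) ` ball 0 1 = ball (0::complex) s"
  proof -
    have "w \<in> (*) (of_real s) ` ball 0 1" if "cmod w < s" for w
      by (rule image_eqI[of _ _ "w / of_real s"]) (use that s in \<open>auto simp: norm_divide\<close>)
    then show ?thesis using s by (auto simp: norm_mult mult_less_cancel_left2)
  qed
  have "(\<integral>\<^sup>+w. f w * ennreal (avg_kernel s z w) \<partial>hyp)
    = (\<integral>\<^sup>+\<zeta>\<in>ball 0 1. f (disc_to_H z \<zeta>) * ennreal (avg_kernel s z (disc_to_H z \<zeta>)) * ennreal (4 / (1 - (cmod \<zeta>)\<^sup>2)\<^sup>2) \<partial>lborel)"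
    by (rule nn_integral_hyp_disc[OF z]) measurable
  also have "\<dots> = (\<integral>\<^sup>+\<zeta>. ennreal ?c * (f (disc_to_H z \<zeta>) * indicator (ball 0 s) \<zeta>) \<partial>lborel)"
  proof (intro nn_integral_cong)
    fix \<zeta> :: complex
    show "f (disc_to_H z \<zeta>) * ennreal (avg_kernel s z (disc_to_H z \<zeta>)) * ennreal (4 / (1 - (cmod \<zeta>)\<^sup>2)\<^sup>2) * indicator (ball 0 1) \<zeta>
       = ennreal ?c * (f (disc_to_H z \<zeta>) * indicator (ball 0 s) \<zeta>)"
    proof (cases "cmod \<zeta> < s")
      case True
      then have l1: "cmod \<zeta> < 1" "\<zeta> \<noteq> 1" using s by auto
      have 2: "(cmod \<zeta>)\<^sup>2 < 1" using l1 by (simp add: power_less_one_iff)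
      have "H_to_disc z (disc_to_H z \<zeta>) = \<zeta>" using z l1 by (intro disc_to_H_to_disc) auto
      then have "avg_kernel s z (disc_to_H z \<zeta>) * (4 / (1 - (cmod \<zeta>)\<^sup>2)\<^sup>2) = ?c"
        using True 2 by (simp add: avg_kernel_def)
      then have "ennreal (avg_kernel s z (disc_to_H z \<zeta>)) * ennreal (4 / (1 - (cmod \<zeta>)\<^sup>2)\<^sup>2) = ennreal ?c"
        by (simp only: ennreal_mult'[symmetric, OF avg_kernel_nonneg])
      then have "f (disc_to_H z \<zeta>) * ennreal (avg_kernel s z (disc_to_H z \<zeta>)) * ennreal (4 / (1 - (cmod \<zeta>)\<^sup>2)\<^sup>2)
          = f (disc_to_H z \<zeta>) * ennreal ?c"
        by (simp only: mult.assoc)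
      then show ?thesis using True l1 by (simp add: mult.commute)
    next
      case False
      then have "avg_kernel s z (disc_to_H z \<zeta>) = 0" if "cmod \<zeta> < 1"
      proof -
        have "H_to_disc z (disc_to_H z \<zeta>) = \<zeta>" using z that by (intro disc_to_H_to_disc) auto
        then show ?thesis using False by (simp add: avg_kernel_def)
      qed
      then show ?thesis using False by (auto simp: indicator_def)
    qed
  qed
  also have "\<dots> = ennreal ?c * (\<integral>\<^sup>+\<zeta>\<in>(*) (of_real s) ` ball 0 1. f (disc_to_H z \<zeta>) \<partial>lborel)"
    unfolding im by (rule nn_integral_cmult) measurable
  also have "(\<integral>\<^sup>+\<zeta>\<in>(*) (of_real s) ` ball 0 1. f (disc_to_H z \<zeta>) \<partial>lborel)
    = (\<integral>\<^sup>+\<eta>\<in>ball 0 1. f (disc_to_H z (of_real s * \<eta>)) * ennreal ((cmod (deriv ((*) (of_real s)) \<eta>))\<^sup>2) \<partial>lborel)"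
    by (rule nn_integral_holomorphic_substitution) (use s in \<open>auto intro!: holomorphic_intros inj_onI\<close>)
  also have "\<dots> = (\<integral>\<^sup>+\<eta>. ennreal (s\<^sup>2) * (f (disc_to_H z (of_real s * \<eta>)) * indicator (ball 0 1) \<eta>) \<partial>lborel)"
    by (intro nn_integral_cong) (simp add: mult_ac)
  also have "\<dots> = ennreal (s\<^sup>2) * (\<integral>\<^sup>+\<eta>\<in>ball 0 1. f (disc_to_H z (of_real s * \<eta>)) \<partial>lborel)"
    by (rule nn_integral_cmult) measurable
  also have "ennreal ?c * (ennreal (s\<^sup>2) * (\<integral>\<^sup>+\<eta>\<in>ball 0 1. f (disc_to_H z (of_real s * \<eta>)) \<partial>lborel))
    = (\<integral>\<^sup>+\<eta>\<in>ball 0 1. f (disc_to_H z (of_real s * \<eta>)) \<partial>lborel) / ennreal disc_area"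
  proof -
    have "ennreal ?c * ennreal (s\<^sup>2) = ennreal (1 / disc_area)"
      using s disc_area_pos by (simp add: ennreal_mult'[symmetric])
    also have "\<dots> = 1 / ennreal disc_area"
      using disc_area_pos by (simp add: divide_ennreal[symmetric])
    finally have k: "ennreal ?c * ennreal (s\<^sup>2) = 1 / ennreal disc_area" .
    show ?thesis unfolding mult.assoc[symmetric] k
      by (simp add: divide_ennreal_def mult.commute)
  qed
  also have "\<dots> = (\<integral>\<^sup>+\<eta>. f (disc_to_H z (of_real s * \<eta>)) \<partial>unit_disc_measure)"
    by (rule nn_integral_unit_disc[symmetric]) measurable
  finally show ?thesis ..
qed

section \<open>Mean values and Moebius maps\<close>

text \<open>Rotating by the angle \<open>pi / n\<close> changes the sign of the integrand, so the
  integral equals its own negative.\<close>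

lemma integral_unit_disc_power:
  assumes "n > 0"
  shows "(\<integral>\<eta>. \<eta> ^ n \<partial>unit_disc_measure) = 0"
proof -
  let ?e = "cis (pi / n)"
  have "(\<integral>\<eta>. \<eta> ^ n \<partial>unit_disc_measure) = (\<integral>\<eta>. (?e * \<eta>) ^ n \<partial>unit_disc_measure)"
    by (rule integral_unit_disc_rotate[symmetric]) auto
  also have "\<dots> = (\<integral>\<eta>. - (\<eta> ^ n) \<partial>unit_disc_measure)"
    using assms Complex.DeMoivre[of "pi / n" n] by (simp add: power_mult_distrib)
  finally show ?thesis by simp
qed

text \<open>The power series is integrated term by term, and rotation kills every term but the
  constant one.\<close>

lemma integral_unit_disc_holomorphic:
  assumes g: "g holomorphic_on ball 0 R" and R: "R > 1"
  shows "(\<integral>\<eta>. (if cmod \<eta> < 1 then g \<eta> else 0) \<partial>unit_disc_measure) = g 0"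
proof -
  define a where "a n = (deriv ^^ n) g 0 / fact n" for n
  have sums: "(\<lambda>n. a n * w ^ n) sums g w" if "w \<in> ball 0 R" for w
    using holomorphic_power_series[OF g that] by (simp add: a_def)
  \<comment> \<open>Convergence at a point beyond the unit circle makes the coefficients absolutely
    summable, which justifies exchanging sum and integral.\<close>
  obtain r where r: "1 < r" "r < R" using dense[OF R] by blast
  have "summable (\<lambda>n. a n * (of_real r) ^ n)"
    using sums[of "of_real r"] r by (simp add: sums_iff)
  then have "summable (\<lambda>n. norm (a n * 1 ^ n))"
    by (rule powser_insidea) (use r in auto)
  then have ab: "summable (\<lambda>n. norm (a n))" by simp
  have bd: "norm (a n * \<eta> ^ n) \<le> norm (a n)" if "cmod \<eta> < 1" for n \<eta>
    using that by (simp add: norm_mult norm_power mult_left_le power_le_one)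
  have int: "integrable unit_disc_measure (\<lambda>\<eta>. a n * \<eta> ^ n)" for n
    by (rule udisc.integrable_const_bound[where B="norm (a n)"])
       (use AE_unit_disc in \<open>auto intro: bd\<close>)
  have gm: "(\<lambda>w. if w \<in> ball 0 1 then g w else 0) \<in> borel_measurable borel"
    using g R by (intro borel_measurable_continuous_on_if holomorphic_on_imp_continuous_on)
      (auto intro: holomorphic_on_subset)
  have "(\<integral>\<eta>. (if cmod \<eta> < 1 then g \<eta> else 0) \<partial>unit_disc_measure) = (\<integral>\<eta>. suminf (\<lambda>n. a n * \<eta> ^ n) \<partial>unit_disc_measure)"
  proof (rule integral_cong_AE)
    show "AE \<eta> in unit_disc_measure. (if cmod \<eta> < 1 then g \<eta> else 0) = suminf (\<lambda>n. a n * \<eta> ^ n)"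
      using AE_unit_disc
    proof eventually_elim
      case (elim \<eta>)
      then have "(\<lambda>n. a n * \<eta> ^ n) sums g \<eta>" using R by (intro sums) simp
      then show ?case using elim by (simp add: sums_iff)
    qed
    show "(\<lambda>\<eta>. if cmod \<eta> < 1 then g \<eta> else 0) \<in> borel_measurable unit_disc_measure"
      using gm by simp
  qed measurable
  also have "\<dots> = suminf (\<lambda>n. \<integral>\<eta>. a n * \<eta> ^ n \<partial>unit_disc_measure)"
  proof (rule integral_suminf[OF int])
    show "AE \<eta> in unit_disc_measure. summable (\<lambda>n. norm (a n * \<eta> ^ n))"
      using AE_unit_disc
      by eventually_elim (rule summable_comparison_test'[OF ab, of 0], use bd in auto)
    show "summable (\<lambda>n. \<integral>\<eta>. norm (a n * \<eta> ^ n) \<partial>unit_disc_measure)"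
    proof (rule summable_comparison_test'[OF ab, of 0])
      fix n
      have "(\<integral>\<eta>. norm (a n * \<eta> ^ n) \<partial>unit_disc_measure) \<le> (\<integral>\<eta>. norm (a n) \<partial>unit_disc_measure)"
        using AE_unit_disc by (intro integral_mono_AE integrable_norm int) (auto intro: bd)
      then show "norm (\<integral>\<eta>. norm (a n * \<eta> ^ n) \<partial>unit_disc_measure) \<le> norm (a n)"
        using udisc.prob_space by simp
    qed
  qed
  also have "\<dots> = suminf (\<lambda>n. a n * (if n = 0 then 1 else 0))"
    using udisc.prob_space by (intro suminf_cong) (auto simp: integral_unit_disc_power)
  also have "\<dots> = (\<Sum>n\<in>{0}. a n * (if n = 0 then 1 else 0))"
    by (rule suminf_finite) auto
  also have "\<dots> = g 0" by (simp add: a_def)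
  finally show ?thesis .
qed

section \<open>Moebius transformations as isometries of the half-plane\<close>

definition aut_factor :: "real^2^2 \<Rightarrow> complex \<Rightarrow> complex" where
  "aut_factor A z = of_real (A$2$1) * z + of_real (A$2$2)"

lemma mob_eq: "mob A z = (of_real (A$1$1) * z + of_real (A$1$2)) / aut_factor A z"
  by (simp add: mob_def moebius_def aut_factor_def)

lemma det_eq_1_complex:
  fixes A :: "real^2^2"
  shows "det A = 1 \<Longrightarrow> complex_of_real (A$1$1) * of_real (A$2$2) - of_real (A$1$2) * of_real (A$2$1) = 1"
  by (simp add: det_2 flip: of_real_mult of_real_diff)

lemma aut_factor_cnj: "aut_factor A (cnj z) = cnj (aut_factor A z)"
  by (simp add: aut_factor_def)

lemma mob_cnj: "mob A (cnj z) = cnj (mob A z)"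
  by (simp add: mob_eq aut_factor_cnj)

lemma aut_factor_nonzero:
  assumes "det A = 1" "Im z \<noteq> 0"
  shows "aut_factor A z \<noteq> 0"
proof
  assume "aut_factor A z = 0"
  moreover have "Im (aut_factor A z) = A$2$1 * Im z" "Re (aut_factor A z) = A$2$1 * Re z + A$2$2"
    by (simp_all add: aut_factor_def)
  ultimately have "A$2$1 * Im z = 0" "A$2$1 * Re z + A$2$2 = 0" by simp_all
  then have "A$2$1 = 0" "A$2$2 = 0" using assms by auto
  then show False using assms by (simp add: det_2)
qed

text \<open>The source of the transformation rules below: for the points \<open>z\<close> and
  \<open>cnj z\<close> it gives the imaginary part, and dividing the instances for \<open>w\<close>
  against \<open>z\<close> and \<open>w\<close> against \<open>cnj z\<close> gives the behaviour of
  the chart.\<close>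

lemma mob_diff:
  assumes "det A = 1" "aut_factor A z \<noteq> 0" "aut_factor A w \<noteq> 0"
  shows "mob A w - mob A z = (w - z) / (aut_factor A w * aut_factor A z)"
proof -
  have "(of_real (A$1$1) * w + of_real (A$1$2)) * aut_factor A z
      - (of_real (A$1$1) * z + of_real (A$1$2)) * aut_factor A w
      = (of_real (A$1$1) * of_real (A$2$2) - of_real (A$1$2) * of_real (A$2$1)) * (w - z)"
    by (simp add: aut_factor_def algebra_simps)
  also have "\<dots> = w - z" by (simp add: det_eq_1_complex[OF assms(1)])
  finally show ?thesis
    using assms by (simp add: mob_eq diff_frac_eq)
qed

lemma Im_mob:
  assumes "det A = 1" "Im z \<noteq> 0"
  shows "Im (mob A z) = Im z / (cmod (aut_factor A z))\<^sup>2"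
proof -
  have nz: "aut_factor A z \<noteq> 0" "aut_factor A (cnj z) \<noteq> 0"
    using assms aut_factor_nonzero by auto
  have "mob A z - cnj (mob A z) = (z - cnj z) / (aut_factor A z * cnj (aut_factor A z))"
    using mob_diff[OF assms(1) nz(2,1)] by (simp add: mob_cnj aut_factor_cnj)
  also have "\<dots> = (z - cnj z) / of_real ((cmod (aut_factor A z))\<^sup>2)"
    by (simp only: complex_norm_square)
  finally have "Im (mob A z - cnj (mob A z)) = Im ((z - cnj z) / of_real ((cmod (aut_factor A z))\<^sup>2))"
    by simp
  then show ?thesis by simp
qed

lemma mob_in_H: "det A = 1 \<Longrightarrow> z \<in> \<H> \<Longrightarrow> mob A z \<in> \<H>"
  using aut_factor_nonzero[of A z] by (simp add: Im_mob)

text \<open>The factor has modulus 1, so between the charts at \<open>z\<close> and at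
  \<open>mob A z\<close> the isometry is a rotation of the disc.\<close>

lemma H_to_disc_mob:
  assumes "det A = 1" "z \<in> \<H>" "w \<in> \<H>"
  shows "H_to_disc (mob A z) (mob A w) = cnj (aut_factor A z) / aut_factor A z * H_to_disc z w"
proof -
  have nz: "aut_factor A z \<noteq> 0" "aut_factor A w \<noteq> 0" "aut_factor A (cnj z) \<noteq> 0"
    using assms aut_factor_nonzero by auto
  have "w \<noteq> cnj z" using assms by auto
  have "mob A w - mob A z = (w - z) / (aut_factor A w * aut_factor A z)"
    by (rule mob_diff) (use assms nz in auto)
  moreover have "mob A w - cnj (mob A z) = (w - cnj z) / (aut_factor A w * cnj (aut_factor A z))"
    using mob_diff[OF assms(1) nz(3,2)] by (simp add: mob_cnj aut_factor_cnj)
  ultimately have "H_to_disc (mob A z) (mob A w)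
      = ((w - z) / (aut_factor A w * aut_factor A z)) / ((w - cnj z) / (aut_factor A w * cnj (aut_factor A z)))"
    by (simp only: H_to_disc_def)
  then show ?thesis
    using nz by (simp add: H_to_disc_def)
qed

lemma norm_H_to_disc_mob:
  assumes "det A = 1" "z \<in> \<H>" "w \<in> \<H>"
  shows "cmod (H_to_disc (mob A z) (mob A w)) = cmod (H_to_disc z w)"
  using aut_factor_nonzero[of A z] assms by (simp add: H_to_disc_mob norm_mult norm_divide)

lemma disc_to_H_mob:
  assumes "det A = 1" "z \<in> \<H>" "cmod \<zeta> < 1"
  shows "disc_to_H (mob A z) (cnj (aut_factor A z) / aut_factor A z * \<zeta>) = mob A (disc_to_H z \<zeta>)"
proof -
  let ?w = "disc_to_H z \<zeta>"
  have w: "?w \<in> \<H>" by (rule disc_to_H_in_H) fact+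
  have "H_to_disc z ?w = \<zeta>" using assms by (intro disc_to_H_to_disc) auto
  then have "H_to_disc (mob A z) (mob A ?w) = cnj (aut_factor A z) / aut_factor A z * \<zeta>"
    using H_to_disc_mob[OF assms(1,2) w] by simp
  moreover have "disc_to_H (mob A z) (H_to_disc (mob A z) (mob A ?w)) = mob A ?w"
    using mob_in_H[OF assms(1,2)] mob_in_H[OF assms(1) w] by (intro H_to_disc_to_H) auto
  ultimately show ?thesis by simp
qed

lemma mob_mult:
  assumes "det B = 1" "z \<in> \<H>"
  shows "mob (A ** B) z = mob A (mob B z)"
proof -
  have nz: "aut_factor B z \<noteq> 0" using assms aut_factor_nonzero by auto
  let ?p = "of_real (B$1$1) * z + of_real (B$1$2)"
  have e: "(A ** B)$i$j = A$i$1 * B$1$j + A$i$2 * B$2$j" for i j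
    by (simp add: matrix_matrix_mult_def sum_2)
  have "mob A (mob B z) = (of_real (A$1$1) * (?p / aut_factor B z) + of_real (A$1$2)) /
      (of_real (A$2$1) * (?p / aut_factor B z) + of_real (A$2$2))"
    by (simp add: mob_eq[of A] aut_factor_def[of A] mob_eq[of B])
  also have "\<dots> = (of_real (A$1$1) * ?p + of_real (A$1$2) * aut_factor B z) /
      (of_real (A$2$1) * ?p + of_real (A$2$2) * aut_factor B z)"
    using nz by (simp add: divide_simps)
  also have "\<dots> = mob (A ** B) z"
    by (simp add: mob_eq aut_factor_def e algebra_simps)
  finally show ?thesis ..
qed

lemma mob_one [simp]: "mob (mat 1) z = z"
  by (simp add: mob_eq aut_factor_def mat_def)

lemma mob_uminus [simp]: "mob (- A) z = mob A z"
proof -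
  have "mob (- A) z = - (of_real (A$1$1) * z + of_real (A$1$2)) / - aut_factor A z"
    by (simp add: mob_eq aut_factor_def)
  then show ?thesis unfolding minus_divide_divide by (simp only: mob_eq)
qed

lemma mob_has_field_derivative:
  assumes "det A = 1" "z \<in> \<H>"
  shows "(mob A has_field_derivative 1 / (aut_factor A z)\<^sup>2) (at z within S)"
proof -
  have nz: "aut_factor A z \<noteq> 0" using assms aut_factor_nonzero by auto
  have e: "of_real (A$1$1) * aut_factor A z - (of_real (A$1$1) * z + of_real (A$1$2)) * of_real (A$2$1) = 1"
    using det_eq_1_complex[OF assms(1)] by (simp add: aut_factor_def algebra_simps)
  have "(mob A has_field_derivative (of_real (A$1$1) * aut_factor A z
      - (of_real (A$1$1) * z + of_real (A$1$2)) * of_real (A$2$1)) / (aut_factor A z * aut_factor A z)) (at z within S)"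
    unfolding mob_eq[abs_def] using nz unfolding aut_factor_def
    by (auto intro!: derivative_eq_intros)
  then show ?thesis unfolding e by (simp add: power2_eq_square)
qed

lemma deriv_mob: "det A = 1 \<Longrightarrow> z \<in> \<H> \<Longrightarrow> deriv (mob A) z = 1 / (aut_factor A z)\<^sup>2"
  by (rule DERIV_imp_deriv mob_has_field_derivative)+

lemma mob_holomorphic: "det A = 1 \<Longrightarrow> mob A holomorphic_on \<H>"
  using mob_has_field_derivative unfolding holomorphic_on_def field_differentiable_def by blast

lemma mob_measurable [measurable]: "mob A \<in> borel_measurable borel"
  unfolding mob_eq[abs_def] aut_factor_def by measurable

lemma det_matrix_inv:
  fixes A :: "real^2^2"
  assumes "det A = 1"
  shows "A ** matrix_inv A = mat 1" "matrix_inv A ** A = mat 1" "det (matrix_inv A) = 1"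
    "matrix_inv (matrix_inv A) = A"
proof -
  have inv: "B ** matrix_inv B = mat 1 \<and> matrix_inv B ** B = mat 1" if "det B = 1" for B :: "real^2^2"
  proof -
    have "invertible B" using that by (simp add: invertible_det_nz)
    then show ?thesis unfolding invertible_def matrix_inv_def by (rule someI_ex)
  qed
  show 1: "A ** matrix_inv A = mat 1" and 2: "matrix_inv A ** A = mat 1"
    using inv[OF assms] by auto
  show 3: "det (matrix_inv A) = 1"
    using arg_cong[OF 1, of det] assms by (simp add: det_mul)
  have "matrix_inv (matrix_inv A) = (A ** matrix_inv A) ** matrix_inv (matrix_inv A)"
    by (simp add: 1)
  also have "\<dots> = A"
    using inv[OF 3] by (simp flip: matrix_mul_assoc)
  finally show "matrix_inv (matrix_inv A) = A" .
qed

lemma mob_inverse: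
  assumes "det A = 1" "z \<in> \<H>"
  shows "mob (matrix_inv A) (mob A z) = z" "mob A (mob (matrix_inv A) z) = z"
  using assms by (simp_all flip: mob_mult add: det_matrix_inv)

lemma mob_image_H:
  assumes "det A = 1" shows "mob A ` \<H> = \<H>"
proof
  show "mob A ` \<H> \<subseteq> \<H>" using mob_in_H[OF assms] by blast
  show "\<H> \<subseteq> mob A ` \<H>"
  proof
    fix z assume z: "z \<in> \<H>"
    have "z = mob A (mob (matrix_inv A) z)" using mob_inverse[OF assms z] by simp
    then show "z \<in> mob A ` \<H>"
      by (rule image_eqI) (rule mob_in_H[OF det_matrix_inv(3)[OF assms] z])
  qed
qed

lemma inj_on_mob: "det A = 1 \<Longrightarrow> inj_on (mob A) \<H>"
  by (rule inj_on_inverseI[where g="mob (matrix_inv A)"]) (rule mob_inverse)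

text \<open>The Jacobian contributes \<open>|aut_factor A z|^(-4)\<close>, and so does the square of
  the imaginary part; the two cancel in the density.\<close>

lemma nn_integral_hyp_mob:
  assumes A: "det A = 1" and f [measurable]: "f \<in> borel_measurable borel"
  shows "(\<integral>\<^sup>+z. f (mob A z) \<partial>hyp) = (\<integral>\<^sup>+z. f z \<partial>hyp)"
proof -
  have "(\<integral>\<^sup>+z. f z \<partial>hyp) = (\<integral>\<^sup>+z\<in>mob A ` \<H>. (f z * ennreal (1 / (Im z)\<^sup>2)) \<partial>lborel)"
    by (simp add: nn_integral_hyp mob_image_H[OF A])
  also have "\<dots> = (\<integral>\<^sup>+z\<in>\<H>. (f (mob A z) * ennreal (1 / (Im (mob A z))\<^sup>2))
      * ennreal ((cmod (deriv (mob A) z))\<^sup>2) \<partial>lborel)"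
    by (rule nn_integral_holomorphic_substitution)
       (auto simp: mob_holomorphic[OF A] inj_on_mob[OF A])
  also have "\<dots> = (\<integral>\<^sup>+z\<in>\<H>. f (mob A z) * ennreal (1 / (Im z)\<^sup>2) \<partial>lborel)"
  proof (intro nn_integral_cong)
    fix z
    show "f (mob A z) * ennreal (1 / (Im (mob A z))\<^sup>2) * ennreal ((cmod (deriv (mob A) z))\<^sup>2) * indicator \<H> z
       = f (mob A z) * ennreal (1 / (Im z)\<^sup>2) * indicator \<H> z"
    proof (cases "z \<in> \<H>")
      case True
      then have nz: "aut_factor A z \<noteq> 0" using aut_factor_nonzero[OF A, of z] by simp
      have "1 / (Im (mob A z))\<^sup>2 * (cmod (deriv (mob A) z))\<^sup>2 = 1 / (Im z)\<^sup>2"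
        using True nz A by (simp add: Im_mob deriv_mob norm_divide norm_power power_divide)
      then have "ennreal (1 / (Im (mob A z))\<^sup>2) * ennreal ((cmod (deriv (mob A) z))\<^sup>2) = ennreal (1 / (Im z)\<^sup>2)"
        by (simp add: ennreal_mult'[symmetric])
      then show ?thesis by (simp add: mult.assoc)
    qed simp
  qed
  also have "\<dots> = (\<integral>\<^sup>+z. f (mob A z) \<partial>hyp)"
    by (simp add: nn_integral_hyp)
  finally show ?thesis ..
qed

section \<open>Unfolding over a fundamental set\<close>

text \<open>\<open>G\<close> consists of matrices and contains each group element with both signs.
  \<open>F\<close> meets every orbit exactly once and serves for integration, but it is only Borel
  and possibly unbounded. \<open>K\<close> is compact and serves for estimates, but may meet an
  orbit several times.\<close>

locale surface_group =
  fixes G :: "(real^2^2) set" and F K :: "complex set"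
  assumes det_one: "A \<in> G \<Longrightarrow> det A = 1"
    and mult_closed: "A \<in> G \<Longrightarrow> B \<in> G \<Longrightarrow> A ** B \<in> G"
    and inv_closed: "A \<in> G \<Longrightarrow> matrix_inv A \<in> G"
    and uminus_closed: "A \<in> G \<Longrightarrow> - A \<in> G"
    and free: "A \<in> G \<Longrightarrow> z \<in> \<H> \<Longrightarrow> mob A z = z \<Longrightarrow> A = mat 1 \<or> A = - mat 1"
    and countable_G: "countable G"
    and F_borel [measurable]: "F \<in> sets borel"
    and F_sub: "F \<subseteq> \<H>"
    and F_meets: "z \<in> \<H> \<Longrightarrow> \<exists>A\<in>G. mob A z \<in> F"
    and F_unique: "A \<in> G \<Longrightarrow> z \<in> F \<Longrightarrow> mob A z \<in> F \<Longrightarrow> mob A z = z"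
    and K_compact: "compact K"
    and K_sub: "K \<subseteq> \<H>"
    and K_meets: "z \<in> \<H> \<Longrightarrow> \<exists>A\<in>G. mob A z \<in> K"
begin

lemma uminus_neq: "A \<in> G \<Longrightarrow> A \<noteq> - A"
proof
  assume A: "A \<in> G" "A = - A"
  have "A = 0"
    using A(2) by (simp add: vec_eq_iff)
  then show False using det_one[OF A(1)] by (simp add: det_2)
qed

text \<open>If \<open>A\<close> and \<open>B\<close> both bring \<open>z\<close> into
  \<open>F\<close>, then \<open>A ** matrix_inv B\<close> fixes a point, so freeness leaves only the
  two signs.\<close>

lemma F_translates:
  assumes z: "z \<in> \<H>"
  obtains B where "B \<noteq> - B" "{A \<in> G. mob A z \<in> F} = {B, - B}"
proof -
  obtain B where B: "B \<in> G" "mob B z \<in> F" using F_meets[OF z] by blast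
  have "A = B \<or> A = - B" if A: "A \<in> G" "mob A z \<in> F" for A
  proof -
    have Bz: "mob B z \<in> \<H>" using B F_sub by blast
    have C: "A ** matrix_inv B \<in> G" using A B by (intro mult_closed inv_closed)
    have dB: "det B = 1" "det (matrix_inv B) = 1" using det_one B det_matrix_inv by auto
    have eq: "mob (A ** matrix_inv B) (mob B z) = mob A z"
      using mob_mult[OF dB(2) Bz, of A] mob_inverse[OF dB(1) z] by simp
    then have "mob (A ** matrix_inv B) (mob B z) = mob B z"
      using F_unique[OF C B(2)] A by simp
    then have "A ** matrix_inv B = mat 1 \<or> A ** matrix_inv B = - mat 1"
      using free[OF C Bz] by simp
    moreover have "A = (A ** matrix_inv B) ** B"
      using det_matrix_inv(2)[OF dB(1)] by (simp flip: matrix_mul_assoc)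
    moreover have "(- mat 1) ** B = - B"
      by (simp add: vec_eq_iff matrix_matrix_mult_def mat_def sum_2 forall_2)
    ultimately show ?thesis by auto
  qed
  then have "{A \<in> G. mob A z \<in> F} = {B, - B}"
    using B uminus_closed by auto
  with uminus_neq[OF B(1)] show ?thesis by (rule that)
qed

lemma bij_betw_inv: "bij_betw matrix_inv G G"
  by (rule bij_betw_byWitness[where f'=matrix_inv])
     (use inv_closed det_one det_matrix_inv(4) in auto)

text \<open>The area measure of the quotient surface, carried by \<open>F\<close>.\<close>

definition hF :: "complex measure" where
  "hF = density hyp (indicator F)"

lemma sets_hF [measurable_cong, simp]: "sets hF = sets borel"
  by (simp add: hF_def)

lemma space_hF [simp]: "space hF = UNIV"
  by (simp add: hF_def)

lemma nn_integral_hF: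
  assumes [measurable]: "f \<in> borel_measurable borel"
  shows "(\<integral>\<^sup>+z. f z \<partial>hF) = (\<integral>\<^sup>+z. indicator F z * f z \<partial>hyp)"
  unfolding hF_def by (subst nn_integral_density) auto

lemma AE_hF: "AE z in hF. z \<in> F"
  unfolding hF_def by (subst AE_density) (auto simp: indicator_def)

lemma AE_hF_H: "AE z in hF. z \<in> \<H>"
  using AE_hF F_sub by (auto elim!: eventually_mono)

lemma sigma_finite_G: "sigma_finite_measure (count_space G)"
  by (rule sigma_finite_measure_count_space_countable[OF countable_G])

lemma nn_integral_count_G_swap:
  assumes "sigma_finite_measure M"
    and f: "\<And>A. A \<in> G \<Longrightarrow> f A \<in> borel_measurable M"
  shows "(\<integral>\<^sup>+A. (\<integral>\<^sup>+z. f A z \<partial>M) \<partial>count_space G) = (\<integral>\<^sup>+z. (\<integral>\<^sup>+A. f A z \<partial>count_space G) \<partial>M)"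
proof -
  interpret M: sigma_finite_measure M by fact
  interpret CG: sigma_finite_measure "count_space G" by (rule sigma_finite_G)
  interpret P: pair_sigma_finite "count_space G" M ..
  show ?thesis
    by (rule P.Fubini'[symmetric], rule measurable_pair_measure_countable1[OF countable_G]) (simp add: f)
qed

text \<open>The factor 2 arises because \<open>A\<close> and \<open>- A\<close> are distinct elements of \<open>G\<close> acting in the same way.\<close>

lemma nn_integral_unfold:
  assumes f [measurable]: "f \<in> borel_measurable borel"
  shows "(\<integral>\<^sup>+A. (\<integral>\<^sup>+z. f (mob A z) \<partial>hF) \<partial>count_space G) = 2 * (\<integral>\<^sup>+z. f z \<partial>hyp)"
proof -
  have "(\<integral>\<^sup>+A. (\<integral>\<^sup>+z. f (mob A z) \<partial>hF) \<partial>count_space G)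
    = (\<integral>\<^sup>+A. (\<integral>\<^sup>+z. indicator F (mob (matrix_inv A) z) * f z \<partial>hyp) \<partial>count_space G)"
  proof (intro nn_integral_cong)
    fix A assume "A \<in> space (count_space G)"
    then have d: "det A = 1" "det (matrix_inv A) = 1" using det_one det_matrix_inv by auto
    have "(\<integral>\<^sup>+z. f (mob A z) \<partial>hF) = (\<integral>\<^sup>+z. indicator F z * f (mob A z) \<partial>hyp)"
      by (rule nn_integral_hF) measurable
    \<comment> \<open>Invariance of the area moves the translation from \<open>f\<close> to the
      indicator of \<open>F\<close>; summing over \<open>A\<close> then counts, for each
      \<open>z\<close>, the matrices that bring \<open>z\<close> into \<open>F\<close>.\<close>
    also have "\<dots> = (\<integral>\<^sup>+z. indicator F (mob (matrix_inv A) z) * f (mob A (mob (matrix_inv A) z)) \<partial>hyp)"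
      by (rule nn_integral_hyp_mob[OF d(2), symmetric]) measurable
    also have "\<dots> = (\<integral>\<^sup>+z. indicator F (mob (matrix_inv A) z) * f z \<partial>hyp)"
      using AE_hyp_H by (intro nn_integral_cong_AE) (auto elim!: eventually_mono simp: mob_inverse[OF d(1)])
    finally show "(\<integral>\<^sup>+z. f (mob A z) \<partial>hF) = (\<integral>\<^sup>+z. indicator F (mob (matrix_inv A) z) * f z \<partial>hyp)" .
  qed
  also have "\<dots> = (\<integral>\<^sup>+A. (\<integral>\<^sup>+z. indicator F (mob A z) * f z \<partial>hyp) \<partial>count_space G)"
    by (rule nn_integral_bij_count_space[OF bij_betw_inv])
  also have "\<dots> = (\<integral>\<^sup>+z. (\<integral>\<^sup>+A. indicator F (mob A z) * f z \<partial>count_space G) \<partial>hyp)"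
    by (rule nn_integral_count_G_swap[OF sigma_finite_hyp]) measurable
  also have "\<dots> = (\<integral>\<^sup>+z. 2 * f z \<partial>hyp)"
  proof (rule nn_integral_cong_AE, use AE_hyp_H in eventually_elim)
    fix z assume "z \<in> \<H>"
    from F_translates[OF this] obtain B where B: "B \<noteq> - B" "{A \<in> G. mob A z \<in> F} = {B, - B}" .
    have "(\<integral>\<^sup>+A. indicator F (mob A z) * f z \<partial>count_space G)
        = (\<integral>\<^sup>+A. indicator {A \<in> G. mob A z \<in> F} A * f z \<partial>count_space G)"
      by (intro nn_integral_cong) (auto simp: indicator_def)
    also have "\<dots> = (\<integral>\<^sup>+A. indicator {A \<in> G. mob A z \<in> F} A \<partial>count_space G) * f z"
      by (rule nn_integral_multc) simp
    also have "(\<integral>\<^sup>+A. indicator {A \<in> G. mob A z \<in> F} A \<partial>count_space G)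
        = emeasure (count_space G) {A \<in> G. mob A z \<in> F}"
      by (rule nn_integral_indicator) simp
    also have "\<dots> = of_nat (card {A \<in> G. mob A z \<in> F})"
    proof (rule emeasure_count_space_finite)
      show "finite {A \<in> G. mob A z \<in> F}" unfolding B(2) by simp
    qed blast
    also have "card {A \<in> G. mob A z \<in> F} = 2" unfolding B(2) using B(1) by simp
    finally show "(\<integral>\<^sup>+A. indicator F (mob A z) * f z \<partial>count_space G) = 2 * f z" by simp
  qed
  also have "\<dots> = 2 * (\<integral>\<^sup>+z. f z \<partial>hyp)"
    by (rule nn_integral_cmult) simp
  finally show ?thesis .
qed

text \<open>Every orbit meets \<open>K\<close>, so for each \<open>z\<close> at least one pair of
  matrices of opposite sign contributes to the sum of the translates of \<open>f\<close> restricted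
  to \<open>K\<close>. Unfolding that sum gives the integral over \<open>K\<close>.\<close>

lemma nn_integral_hF_le_K:
  assumes f [measurable]: "f \<in> borel_measurable borel"
    and inv: "\<And>A z. A \<in> G \<Longrightarrow> z \<in> \<H> \<Longrightarrow> f (mob A z) = f z"
  shows "(\<integral>\<^sup>+z. f z \<partial>hF) \<le> (\<integral>\<^sup>+z\<in>K. f z \<partial>hyp)"
proof -
  have [measurable]: "K \<in> sets borel" using K_compact by (simp add: borel_compact)
  have s: "sigma_finite_measure hF"
    unfolding hF_def by (subst sigma_finite_measure.sigma_finite_iff_density_finite[OF sigma_finite_hyp])
      (auto simp: indicator_def)
  have "2 * (\<integral>\<^sup>+z. f z \<partial>hF) = (\<integral>\<^sup>+z. 2 * f z \<partial>hF)"
    by (rule nn_integral_cmult[symmetric]) simp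
  also have "\<dots> \<le> (\<integral>\<^sup>+z. (\<integral>\<^sup>+A. f (mob A z) * indicator K (mob A z) \<partial>count_space G) \<partial>hF)"
  proof (rule nn_integral_mono_AE, use AE_hF_H in eventually_elim)
    fix z assume z: "z \<in> \<H>"
    obtain B where B: "B \<in> G" "mob B z \<in> K" using K_meets[OF z] by blast
    have "emeasure (count_space G) {B, - B} = 2"
      using B uminus_closed uminus_neq[OF B(1)] by (subst emeasure_count_space_finite) auto
    then have "2 * f z = (\<integral>\<^sup>+A. f z * indicator {B, - B} A \<partial>count_space G)"
      using B uminus_closed by (subst nn_integral_cmult_indicator) (auto simp: mult.commute)
    also have "\<dots> \<le> (\<integral>\<^sup>+A. f (mob A z) * indicator K (mob A z) \<partial>count_space G)"
      by (intro nn_integral_mono) (use B z in \<open>auto simp: indicator_def inv\<close>)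
    finally show "2 * f z \<le> (\<integral>\<^sup>+A. f (mob A z) * indicator K (mob A z) \<partial>count_space G)" .
  qed
  also have "\<dots> = (\<integral>\<^sup>+A. (\<integral>\<^sup>+z. f (mob A z) * indicator K (mob A z) \<partial>hF) \<partial>count_space G)"
    by (rule nn_integral_count_G_swap[OF s, symmetric]) measurable
  also have "\<dots> = 2 * (\<integral>\<^sup>+z\<in>K. f z \<partial>hyp)"
    by (rule nn_integral_unfold) measurable
  finally show ?thesis
    by (simp add: ennreal_mult_le_mult_iff)
qed

lemma emeasure_hyp_K: "emeasure hyp K < \<infinity>"
proof -
  have Km [measurable]: "K \<in> sets borel" using K_compact by (simp add: borel_compact)
  have "continuous_on K (\<lambda>z. 1 / (Im z)\<^sup>2)"
    using K_sub by (intro continuous_intros) force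
  then have "compact ((\<lambda>z. 1 / (Im z)\<^sup>2) ` K)" using K_compact by (rule compact_continuous_image)
  then obtain c where c: "\<And>z. z \<in> K \<Longrightarrow> 1 / (Im z)\<^sup>2 \<le> c"
    by (meson bounded_has_Sup(1) compact_imp_bounded imageI bdd_above_def bounded_imp_bdd_above)
  have "emeasure hyp K = (\<integral>\<^sup>+z. indicator K z \<partial>hyp)" by simp
  also have "\<dots> = (\<integral>\<^sup>+z\<in>\<H>. indicator K z * ennreal (1 / (Im z)\<^sup>2) \<partial>lborel)"
    by (rule nn_integral_hyp) simp
  also have "\<dots> \<le> (\<integral>\<^sup>+z. ennreal c * indicator K z \<partial>lborel)"
    by (intro nn_integral_mono) (auto simp: indicator_def intro!: ennreal_leI c)
  also have "\<dots> = ennreal c * emeasure lborel K"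
    by (simp add: nn_integral_cmult)
  also have "\<dots> < \<infinity>"
    using emeasure_compact_finite[OF K_compact] by (simp add: ennreal_mult_less_top)
  finally show ?thesis .
qed

lemma finite_measure_hF: "finite_measure hF"
proof (rule finite_measureI)
  have [measurable]: "K \<in> sets borel" using K_compact by (simp add: borel_compact)
  have "(\<integral>\<^sup>+z. 1 \<partial>hF) \<le> (\<integral>\<^sup>+z\<in>K. 1 \<partial>hyp)"
    by (rule nn_integral_hF_le_K) auto
  then have "emeasure hF UNIV \<le> emeasure hyp K" by simp
  then show "emeasure hF (space hF) \<noteq> \<infinity>" using emeasure_hyp_K by auto
qed

sublocale hF: finite_measure hF
  by (rule finite_measure_hF)

text \<open>Were the quotient of area zero, unfolding would make the area of \<H> zero too, although
  an averaging kernel has total mass 1.\<close>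

lemma measure_hF_pos: "measure hF UNIV > 0"
proof (rule ccontr)
  assume "\<not> ?thesis"
  then have "emeasure hF UNIV = 0"
    by (simp add: hF.emeasure_eq_measure not_less measure_le_0_iff)
  then have "(\<integral>\<^sup>+z. 1 \<partial>hF) = 0" by simp
  then have "2 * (\<integral>\<^sup>+z. 1 \<partial>hyp) = 0"
    using nn_integral_unfold[of "\<lambda>_. 1"] by simp
  then have "(\<integral>\<^sup>+z. 1 \<partial>hyp) = 0" by simp
  moreover have "(\<integral>\<^sup>+\<eta>. 1 \<partial>unit_disc_measure) \<le> (\<integral>\<^sup>+w. 1 * ennreal (avg_kernel (1/2) \<i> w) \<partial>hyp)"
    by (subst nn_integral_avg_kernel[symmetric]) auto
  moreover have "(\<integral>\<^sup>+w. 1 * ennreal (avg_kernel (1/2) \<i> w) \<partial>hyp) = 0"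
  proof -
    have "AE w in hyp. False"
      using \<open>(\<integral>\<^sup>+z. 1 \<partial>hyp) = 0\<close> by (subst (asm) nn_integral_0_iff_AE) auto
    then show ?thesis by (subst nn_integral_0_iff_AE) (auto elim: eventually_mono)
  qed
  ultimately show False using udisc.emeasure_space_1 by simp
qed

text \<open>The mass transport principle. Unfolding the integral over \<H> gives a sum over
  \<open>G\<close> of integrals over two copies of \<open>F\<close>; invariance moves the
  translation by \<open>A\<close> from one argument to the other as its inverse, and the sum is
  reindexed.\<close>

lemma nn_integral_symmetrize:
  fixes b :: "complex \<Rightarrow> complex \<Rightarrow> ennreal"
  assumes b [measurable]: "case_prod b \<in> borel_measurable (borel \<Otimes>\<^sub>M borel)"
    and inv: "\<And>A z w. A \<in> G \<Longrightarrow> z \<in> \<H> \<Longrightarrow> w \<in> \<H> \<Longrightarrow> b (mob A z) (mob A w) = b z w"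
  shows "(\<integral>\<^sup>+z. (\<integral>\<^sup>+w. b z w \<partial>hyp) \<partial>hF) = (\<integral>\<^sup>+z. (\<integral>\<^sup>+w. b w z \<partial>hyp) \<partial>hF)"
proof -
  interpret FF: pair_sigma_finite hF hF ..
  have b' [measurable]: "case_prod (\<lambda>z w. b w z) \<in> borel_measurable (borel \<Otimes>\<^sub>M borel)"
    using measurable_compose[OF measurable_pair_swap' b] by (simp add: split_beta)
  have b1 [measurable]: "b z \<in> borel_measurable borel" for z
    using measurable_compose[OF measurable_Pair1' b, of z] by simp
  have unf: "2 * (\<integral>\<^sup>+z. (\<integral>\<^sup>+w. c z w \<partial>hyp) \<partial>hF)
      = (\<integral>\<^sup>+A. (\<integral>\<^sup>+z. (\<integral>\<^sup>+w. c z (mob A w) \<partial>hF) \<partial>hF) \<partial>count_space G)"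
    if c: "case_prod c \<in> borel_measurable (borel \<Otimes>\<^sub>M borel)" for c :: "complex \<Rightarrow> complex \<Rightarrow> ennreal"
  proof -
    note c [measurable]
    have c1: "c z \<in> borel_measurable borel" for z
      using measurable_compose[OF measurable_Pair1' c, of z] by simp
    have "2 * (\<integral>\<^sup>+z. (\<integral>\<^sup>+w. c z w \<partial>hyp) \<partial>hF) = (\<integral>\<^sup>+z. 2 * (\<integral>\<^sup>+w. c z w \<partial>hyp) \<partial>hF)"
      by (rule nn_integral_cmult[symmetric]) measurable
    also have "\<dots> = (\<integral>\<^sup>+z. (\<integral>\<^sup>+A. (\<integral>\<^sup>+w. c z (mob A w) \<partial>hF) \<partial>count_space G) \<partial>hF)"
      by (simp add: nn_integral_unfold[OF c1])
    also have "\<dots> = (\<integral>\<^sup>+A. (\<integral>\<^sup>+z. (\<integral>\<^sup>+w. c z (mob A w) \<partial>hF) \<partial>hF) \<partial>count_space G)"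
      by (rule nn_integral_count_G_swap[symmetric]) (unfold_locales, measurable)
    finally show ?thesis .
  qed
  have "2 * (\<integral>\<^sup>+z. (\<integral>\<^sup>+w. b z w \<partial>hyp) \<partial>hF)
      = (\<integral>\<^sup>+A. (\<integral>\<^sup>+z. (\<integral>\<^sup>+w. b z (mob A w) \<partial>hF) \<partial>hF) \<partial>count_space G)"
    by (rule unf) fact
  also have "\<dots> = (\<integral>\<^sup>+A. (\<integral>\<^sup>+z. (\<integral>\<^sup>+w. b (mob (matrix_inv A) z) w \<partial>hF) \<partial>hF) \<partial>count_space G)"
  proof (rule nn_integral_cong)
    fix A assume "A \<in> space (count_space G)"
    then have A: "A \<in> G" "matrix_inv A \<in> G" "det A = 1" "det (matrix_inv A) = 1"
      using det_one det_matrix_inv inv_closed by auto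
    show "(\<integral>\<^sup>+z. (\<integral>\<^sup>+w. b z (mob A w) \<partial>hF) \<partial>hF) = (\<integral>\<^sup>+z. (\<integral>\<^sup>+w. b (mob (matrix_inv A) z) w \<partial>hF) \<partial>hF)"
    proof (rule nn_integral_cong_AE, use AE_hF_H in eventually_elim)
      fix z assume z: "z \<in> \<H>"
      have "b z (mob A w) = b (mob (matrix_inv A) z) w" if "w \<in> \<H>" for w
        using inv[OF A(1) mob_in_H[OF A(4) z] that] mob_inverse[OF A(3) z] by simp
      then show "(\<integral>\<^sup>+w. b z (mob A w) \<partial>hF) = (\<integral>\<^sup>+w. b (mob (matrix_inv A) z) w \<partial>hF)"
        using AE_hF_H by (intro nn_integral_cong_AE) (auto elim!: eventually_mono)
    qed
  qed
  also have "\<dots> = (\<integral>\<^sup>+A. (\<integral>\<^sup>+z. (\<integral>\<^sup>+w. b (mob A z) w \<partial>hF) \<partial>hF) \<partial>count_space G)"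
    by (rule nn_integral_bij_count_space[OF bij_betw_inv])
  also have "\<dots> = (\<integral>\<^sup>+A. (\<integral>\<^sup>+w. (\<integral>\<^sup>+z. b (mob A z) w \<partial>hF) \<partial>hF) \<partial>count_space G)"
    by (intro nn_integral_cong FF.Fubini'[symmetric]) measurable
  also have "\<dots> = 2 * (\<integral>\<^sup>+z. (\<integral>\<^sup>+w. b w z \<partial>hyp) \<partial>hF)"
    by (rule unf[symmetric]) fact
  finally show ?thesis by (simp add: ennreal_mult_cancel_left)
qed

end

section \<open>Averages over hyperbolic discs\<close>

lemma set_integrable_bounded_continuous:
  fixes f :: "complex \<Rightarrow> 'b::{banach, second_countable_topology}"
  assumes "finite_measure M" and [simp]: "sets M = sets borel"
    and S: "S \<in> sets borel" "continuous_on S f" and B: "\<And>x. x \<in> S \<Longrightarrow> norm (f x) \<le> B"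
  shows "set_integrable M S f"
  unfolding set_integrable_def
proof (rule finite_measure.integrable_const_bound[OF assms(1), where B="max 0 B"])
  show "AE x in M. norm (indicator S x *\<^sub>R f x) \<le> max 0 B"
    using B by (intro AE_I2) (auto simp: indicator_def intro: le_max_iff_disj[THEN iffD2])
  show "(\<lambda>x. indicator S x *\<^sub>R f x) \<in> borel_measurable M"
    using borel_measurable_continuous_on_indicator[OF S]
    by (simp add: measurable_cong_sets[OF assms(2) refl])
qed

lemma norm_set_integral_bound:
  fixes f :: "'a \<Rightarrow> 'b::{banach, second_countable_topology}"
  assumes M: "finite_measure M" and B: "\<And>x. x \<in> S \<Longrightarrow> norm (f x) \<le> B" "B \<ge> 0"
  shows "norm (LINT x:S|M. f x) \<le> B * measure M (space M)"
proof (cases "set_integrable M S f")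
  case True
  have "norm (LINT x:S|M. f x) \<le> (\<integral>x. norm (indicator S x *\<^sub>R f x) \<partial>M)"
    unfolding set_lebesgue_integral_def by (rule integral_norm_bound)
  also have "\<dots> \<le> (\<integral>x. B \<partial>M)"
    using True unfolding set_integrable_def
    by (intro integral_mono integrable_norm finite_measure.integrable_const[OF M])
       (auto simp: indicator_def B)
  finally show ?thesis by (simp add: mult.commute)
next
  case False
  \<comment> \<open>A function that is not integrable has integral 0, so the bound holds for it as
    well.\<close>
  then show ?thesis
    unfolding set_lebesgue_integral_def set_integrable_def using B
    by (simp add: not_integrable_integral_eq)
qed

text \<open>Integrals are restricted to the unit disc, and later to \<open>\<H>\<close>, because the functions of interest are
  arbitrary, possibly not even measurable, elsewhere.\<close>

abbreviation disc_int :: "(complex \<Rightarrow> 'b::{banach, second_countable_topology}) \<Rightarrow> 'b" where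
  "disc_int g \<equiv> (LINT \<eta>:ball 0 1|unit_disc_measure. g \<eta>)"

lemma norm_disc_int_le:
  assumes "\<And>\<eta>. cmod \<eta> < 1 \<Longrightarrow> norm (g \<eta>) \<le> B" "B \<ge> 0"
  shows "norm (disc_int g) \<le> B"
  using norm_set_integral_bound[of unit_disc_measure "ball 0 1" g B] assms udisc.prob_space
  by (simp add: udisc.finite_measure_axioms)

lemma disc_int_cong:
  assumes "\<And>\<eta>. cmod \<eta> < 1 \<Longrightarrow> g \<eta> = g' \<eta>"
  shows "disc_int g = disc_int g'"
  by (rule set_lebesgue_integral_cong) (use assms in auto)

lemma set_integrable_disc:
  fixes g :: "complex \<Rightarrow> 'b::{banach, second_countable_topology}"
  assumes g: "continuous_on (cball 0 1) g"
  shows "set_integrable unit_disc_measure (ball 0 1) g"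
proof -
  have "compact (g ` cball 0 1)" by (rule compact_continuous_image[OF g]) simp
  then obtain B where B: "\<And>x. x \<in> cball 0 1 \<Longrightarrow> norm (g x) \<le> B"
    by (meson bounded_iff compact_imp_bounded imageI)
  show ?thesis
    by (rule set_integrable_bounded_continuous[where B=B, OF udisc.finite_measure_axioms])
      (use g B in \<open>auto intro: continuous_on_subset\<close>)
qed

lemma disc_int_add:
  "continuous_on (cball 0 1) f \<Longrightarrow> continuous_on (cball 0 1) g \<Longrightarrow>
    disc_int (\<lambda>\<eta>. f \<eta> + g \<eta>) = disc_int f + disc_int g"
  by (intro set_integral_add set_integrable_disc)

lemma disc_int_diff:
  "continuous_on (cball 0 1) f \<Longrightarrow> continuous_on (cball 0 1) g \<Longrightarrow>
    disc_int (\<lambda>\<eta>. f \<eta> - g \<eta>) = disc_int f - disc_int g"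
  by (intro set_integral_diff set_integrable_disc)

lemma disc_int_eq_integral:
  "disc_int g = (\<integral>\<eta>. (if cmod \<eta> < 1 then g \<eta> else 0) \<partial>unit_disc_measure)"
  unfolding set_lebesgue_integral_def by (intro Bochner_Integration.integral_cong) (auto simp: indicator_def)

lemma disc_int_const [simp]: "disc_int (\<lambda>\<eta>. c) = c"
proof -
  have "disc_int (\<lambda>\<eta>. c) = (\<integral>\<eta>. c \<partial>unit_disc_measure)"
    unfolding disc_int_eq_integral
    by (rule integral_cong_AE[OF _ _ eventually_mono[OF AE_unit_disc]]) auto
  then show ?thesis using udisc.prob_space by simp
qed

lemma disc_int_nonneg:
  fixes g :: "complex \<Rightarrow> real"
  assumes "\<And>\<eta>. cmod \<eta> < 1 \<Longrightarrow> g \<eta> \<ge> 0"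
  shows "disc_int g \<ge> 0"
  unfolding disc_int_eq_integral by (rule integral_nonneg_AE) (use assms in auto)

lemma disc_int_rotate:
  assumes e: "cmod e = 1" and g: "continuous_on (cball 0 1) g"
  shows "disc_int (\<lambda>\<eta>. g (e * \<eta>)) = disc_int g"
proof -
  let ?g = "\<lambda>\<eta>. if \<eta> \<in> ball 0 1 then g \<eta> else 0"
  have m: "?g \<in> borel_measurable borel"
    using g by (intro borel_measurable_continuous_on_if) (auto intro: continuous_on_subset)
  have "disc_int (\<lambda>\<eta>. g (e * \<eta>)) = (\<integral>\<eta>. ?g (e * \<eta>) \<partial>unit_disc_measure)"
    unfolding disc_int_eq_integral using e by (simp add: norm_mult)
  also have "\<dots> = (\<integral>\<eta>. ?g \<eta> \<partial>unit_disc_measure)"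
    by (rule integral_unit_disc_rotate[OF e m])
  finally show ?thesis unfolding disc_int_eq_integral by simp
qed

lemma disc_int_holomorphic:
  "g holomorphic_on ball 0 R \<Longrightarrow> R > 1 \<Longrightarrow> disc_int g = g 0"
  unfolding disc_int_eq_integral by (rule integral_unit_disc_holomorphic)

lemma ennreal_disc_int:
  fixes g :: "complex \<Rightarrow> real"
  assumes "continuous_on (cball 0 1) g" "\<And>\<eta>. cmod \<eta> < 1 \<Longrightarrow> g \<eta> \<ge> 0"
  shows "ennreal (disc_int g) = (\<integral>\<^sup>+\<eta>. ennreal (if cmod \<eta> < 1 then g \<eta> else 0) \<partial>unit_disc_measure)"
proof -
  have "integrable unit_disc_measure (\<lambda>\<eta>. indicator (ball 0 1) \<eta> *\<^sub>R g \<eta>)"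
    using set_integrable_disc[OF assms(1)] by (simp add: set_integrable_def)
  also have "(\<lambda>\<eta>. indicator (ball 0 1) \<eta> *\<^sub>R g \<eta>) = (\<lambda>\<eta>. if cmod \<eta> < 1 then g \<eta> else 0)"
    by (auto simp: indicator_def)
  finally show ?thesis unfolding disc_int_eq_integral
    by (intro nn_integral_eq_integral[symmetric]) (use assms in auto)
qed

text \<open>Compactness of the closed disc makes continuity in the parameter uniform in the
  integration variable.\<close>

lemma continuous_on_disc_int:
  fixes g :: "complex \<times> complex \<Rightarrow> 'b::{banach, second_countable_topology}"
  assumes g: "continuous_on (S \<times> cball 0 1) g"
  shows "continuous_on S (\<lambda>z. disc_int (\<lambda>\<eta>. g (z, \<eta>)))"
  unfolding continuous_on_iff
proof (intro ballI allI impI)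
  have gz: "continuous_on (cball 0 1) (\<lambda>\<eta>. g (z, \<eta>))" if "z \<in> S" for z
    by (rule continuous_on_compose2[OF g]) (use that in \<open>auto intro!: continuous_intros\<close>)
  fix z e assume z: "z \<in> S" and e: "(e::real) > 0"
  obtain X0 where X0: "z \<in> X0" "open X0"
    "\<forall>x\<in>X0 \<inter> S. \<forall>t\<in>cball 0 1. dist (g (x, t)) (g (z, t)) \<le> e / 2"
    by (rule continuous_on_prod_compactE[OF g _ z, of "e / 2"]) (use e in auto)
  obtain d where d: "d > 0" "ball z d \<subseteq> X0" using X0 open_contains_ball by blast
  show "\<exists>d>0. \<forall>x'\<in>S. dist x' z < d \<longrightarrow> dist (disc_int (\<lambda>\<eta>. g (x', \<eta>))) (disc_int (\<lambda>\<eta>. g (z, \<eta>))) < e"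
  proof (intro exI conjI ballI impI)
    fix x assume x: "x \<in> S" "dist x z < d"
    then have xX: "x \<in> X0 \<inter> S" using d by (auto simp: dist_commute)
    have "norm (disc_int (\<lambda>\<eta>. g (x, \<eta>) - g (z, \<eta>))) \<le> e / 2"
      by (rule norm_disc_int_le) (use X0(3) xX e in \<open>auto simp: dist_norm\<close>)
    also have "disc_int (\<lambda>\<eta>. g (x, \<eta>) - g (z, \<eta>)) = disc_int (\<lambda>\<eta>. g (x, \<eta>)) - disc_int (\<lambda>\<eta>. g (z, \<eta>))"
      by (rule disc_int_diff) (use x z gz in auto)
    finally show "dist (disc_int (\<lambda>\<eta>. g (x, \<eta>))) (disc_int (\<lambda>\<eta>. g (z, \<eta>))) < e"
      using e by (simp add: dist_norm)
  qed fact
qed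

section \<open>Disc averages\<close>

abbreviation chart :: "real \<Rightarrow> complex \<Rightarrow> complex \<Rightarrow> complex" where
  "chart s z \<eta> \<equiv> disc_to_H z (of_real s * \<eta>)"

lemma chart_in_H:
  assumes "z \<in> \<H>" "0 \<le> s" "s < 1" "cmod \<eta> \<le> 1"
  shows "chart s z \<eta> \<in> \<H>"
proof (rule disc_to_H_in_H[OF assms(1)])
  have "cmod (of_real s * \<eta>) \<le> s * 1"
    using assms by (simp add: norm_mult mult_left_le)
  then show "cmod (of_real s * \<eta>) < 1" using assms by simp
qed


lemma continuous_on_chart:
  assumes s: "0 \<le> s" "s < 1"
  shows "continuous_on (UNIV \<times> cball 0 1) (\<lambda>x. chart s (fst x) (snd x))"
proof -
  have "of_real s * \<eta> \<noteq> 1" if "cmod \<eta> \<le> 1" for \<eta> :: complex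
  proof
    assume "of_real s * \<eta> = 1"
    then have "s * cmod \<eta> = 1" using s by (metis norm_mult norm_of_real norm_one abs_of_nonneg)
    moreover have "s * cmod \<eta> \<le> s * 1" using that s by (intro mult_left_mono) auto
    ultimately show False using s by simp
  qed
  then show ?thesis
    unfolding disc_to_H_def by (intro continuous_intros) auto
qed

lemma continuous_on_compose_chart_joint:
  assumes s: "0 \<le> s" "s < 1" and f: "continuous_on \<H> f"
  shows "continuous_on (\<H> \<times> cball 0 1) (\<lambda>x. f (chart s (fst x) (snd x)))"
  by (rule continuous_on_compose2[OF f continuous_on_subset[OF continuous_on_chart[OF s]]])
     (use chart_in_H s in auto)

lemma continuous_on_compose_chart:
  assumes s: "0 \<le> s" "s < 1" and f: "continuous_on \<H> f" and z: "z \<in> \<H>"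
  shows "continuous_on (cball 0 1) (\<lambda>\<eta>. f (chart s z \<eta>))"
proof -
  have "continuous_on (cball 0 1) (\<lambda>\<eta>. (\<lambda>x. f (chart s (fst x) (snd x))) (z, \<eta>))"
    by (rule continuous_on_compose2[OF continuous_on_compose_chart_joint[OF s f]])
       (use z in \<open>auto intro!: continuous_intros\<close>)
  then show ?thesis by simp
qed

text \<open>The weight is Euclidean area in the chart rather than hyperbolic area. Both depend only
  on the distance to \<open>z\<close>, and this choice reduces the mean value property of
  holomorphic functions to the one on a Euclidean disc.\<close>

definition disc_avg :: "real \<Rightarrow> (complex \<Rightarrow> 'b::{banach, second_countable_topology}) \<Rightarrow> complex \<Rightarrow> 'b" where
  "disc_avg s f z = disc_int (\<lambda>\<eta>. f (chart s z \<eta>))"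

lemma continuous_on_disc_avg:
  assumes "0 \<le> s" "s < 1" "continuous_on \<H> f"
  shows "continuous_on \<H> (disc_avg s f)"
  using continuous_on_disc_int[OF continuous_on_compose_chart_joint[OF assms]]
  by (simp add: disc_avg_def[abs_def])

lemma disc_avg_cong:
  assumes "0 \<le> s" "s < 1" "z \<in> \<H>" "\<And>w. w \<in> \<H> \<Longrightarrow> f w = g w"
  shows "disc_avg s f z = disc_avg s g z"
  unfolding disc_avg_def by (intro disc_int_cong assms chart_in_H) auto

lemma disc_avg_diff:
  assumes "0 \<le> s" "s < 1" "z \<in> \<H>" "continuous_on \<H> f" "continuous_on \<H> g"
  shows "disc_avg s (\<lambda>w. f w - g w) z = disc_avg s f z - disc_avg s g z"
  unfolding disc_avg_def by (intro disc_int_diff continuous_on_compose_chart assms)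

lemma disc_avg_add:
  assumes "0 \<le> s" "s < 1" "z \<in> \<H>" "continuous_on \<H> f" "continuous_on \<H> g"
  shows "disc_avg s (\<lambda>w. f w + g w) z = disc_avg s f z + disc_avg s g z"
  unfolding disc_avg_def by (intro disc_int_add continuous_on_compose_chart assms)

lemma disc_avg_const [simp]: "disc_avg s (\<lambda>w. c) z = c"
  unfolding disc_avg_def by simp

lemma norm_disc_avg_le:
  assumes "0 \<le> s" "s < 1" "z \<in> \<H>" "\<And>w. w \<in> \<H> \<Longrightarrow> norm (f w) \<le> B" "B \<ge> 0"
  shows "norm (disc_avg s f z) \<le> B"
  unfolding disc_avg_def by (intro norm_disc_int_le assms chart_in_H) auto

text \<open>In the rescaled chart the boundary of \<H> lies at radius \<open>1 / s\<close>, which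
  leaves the room beyond the unit circle that \<open>disc_int_holomorphic\<close> demands.\<close>

lemma disc_avg_holomorphic:
  assumes s: "0 < s" "s < 1" and z: "z \<in> \<H>" and W: "W holomorphic_on \<H>"
  shows "disc_avg s W z = W z"
proof -
  have "(\<lambda>\<eta>. W (chart s z \<eta>)) holomorphic_on ball 0 (1 / s)"
  proof -
    have sub: "(\<lambda>\<eta>. of_real s * \<eta>) ` ball 0 (1 / s) \<subseteq> ball (0::complex) 1"
      using s by (auto simp: norm_mult field_simps)
    have "(disc_to_H z \<circ> (\<lambda>\<eta>. of_real s * \<eta>)) holomorphic_on ball 0 (1 / s)"
      by (rule holomorphic_on_compose_gen[OF _ disc_to_H_holomorphic sub]) (intro holomorphic_intros)
    moreover have "(disc_to_H z \<circ> (\<lambda>\<eta>. of_real s * \<eta>)) ` ball 0 (1 / s) \<subseteq> \<H>"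
      using sub disc_to_H_image[OF z] by fastforce
    ultimately have "(W \<circ> (disc_to_H z \<circ> (\<lambda>\<eta>. of_real s * \<eta>))) holomorphic_on ball 0 (1 / s)"
      by (intro holomorphic_on_compose_gen[OF _ W])
    then show ?thesis by (simp add: o_def)
  qed
  then have "disc_int (\<lambda>\<eta>. W (chart s z \<eta>)) = W (chart s z 0)"
    by (rule disc_int_holomorphic) (use s in auto)
  then show ?thesis by (simp add: disc_avg_def)
qed

lemma chart_mob:
  assumes "det A = 1" "z \<in> \<H>" "0 \<le> s" "s < 1" "cmod \<eta> \<le> 1"
  shows "chart s (mob A z) (cnj (aut_factor A z) / aut_factor A z * \<eta>) = mob A (chart s z \<eta>)"
proof -
  have "cmod (of_real s * \<eta>) \<le> s * 1"
    using assms by (simp add: norm_mult mult_left_le)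
  then have "cmod (of_real s * \<eta>) < 1" using assms by simp
  from disc_to_H_mob[OF assms(1,2) this] show ?thesis by (simp add: mult_ac)
qed

lemma norm_aut_factor_ratio:
  assumes "det A = 1" "z \<in> \<H>"
  shows "cmod (cnj (aut_factor A z) / aut_factor A z) = 1"
  using aut_factor_nonzero[OF assms(1), of z] assms by (simp add: norm_divide)

text \<open>\<open>mob A\<close> takes the chart at \<open>z\<close> to the chart at
  \<open>mob A z\<close> up to a rotation, which the average does not see.\<close>

lemma disc_int_chart_mob:
  fixes b :: "complex \<Rightarrow> 'b::{banach, second_countable_topology}"
  assumes A: "det A = 1" and z: "z \<in> \<H>" and s: "0 \<le> s" "s < 1" and b: "continuous_on \<H> b"
  shows "disc_int (\<lambda>\<eta>. b (chart s (mob A z) \<eta>)) = disc_int (\<lambda>\<eta>. b (mob A (chart s z \<eta>)))"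
proof -
  let ?e = "cnj (aut_factor A z) / aut_factor A z"
  have "disc_int (\<lambda>\<eta>. b (chart s (mob A z) \<eta>)) = disc_int (\<lambda>\<eta>. b (chart s (mob A z) (?e * \<eta>)))"
    by (rule disc_int_rotate[symmetric, OF norm_aut_factor_ratio[OF A z]])
       (intro continuous_on_compose_chart s b mob_in_H A z)
  also have "\<dots> = disc_int (\<lambda>\<eta>. b (mob A (chart s z \<eta>)))"
    using chart_mob[OF A z s] by (intro disc_int_cong) simp
  finally show ?thesis .
qed

lemma disc_avg_mob:
  assumes "det A = 1" "z \<in> \<H>" "0 \<le> s" "s < 1" "continuous_on \<H> f"
  shows "disc_avg s f (mob A z) = disc_avg s (\<lambda>w. f (mob A w)) z"
  unfolding disc_avg_def by (rule disc_int_chart_mob[OF assms])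

text \<open>The kernel form is kept to nonnegative functions, for which integrals and group sums may
  be exchanged freely; signed functions are later split into two nonnegative ones.\<close>

lemma ennreal_disc_int_kernel:
  fixes f :: "complex \<Rightarrow> real"
  assumes z: "z \<in> \<H>" and s: "0 < s" "s < 1" and f: "continuous_on \<H> f" "\<And>w. w \<in> \<H> \<Longrightarrow> f w \<ge> 0"
  shows "ennreal (disc_int (\<lambda>\<eta>. f (chart s z \<eta>)))
       = (\<integral>\<^sup>+w. ennreal (if w \<in> \<H> then f w else 0) * ennreal (avg_kernel s z w) \<partial>hyp)"
proof -
  let ?f = "\<lambda>w. if w \<in> \<H> then f w else 0"
  have m: "?f \<in> borel_measurable borel"
    using f by (intro borel_measurable_continuous_on_if) auto
  have "ennreal (disc_int (\<lambda>\<eta>. f (chart s z \<eta>)))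
      = (\<integral>\<^sup>+\<eta>. ennreal (if cmod \<eta> < 1 then f (chart s z \<eta>) else 0) \<partial>unit_disc_measure)"
    by (rule ennreal_disc_int) (use chart_in_H z s f in \<open>auto intro!: continuous_on_compose_chart\<close>)
  also have "\<dots> = (\<integral>\<^sup>+\<eta>. ennreal (?f (chart s z \<eta>)) \<partial>unit_disc_measure)"
    using AE_unit_disc
    by (intro nn_integral_cong_AE) (use chart_in_H[OF z, of s] s in \<open>auto elim!: eventually_mono\<close>)
  also have "\<dots> = (\<integral>\<^sup>+w. ennreal (?f w) * ennreal (avg_kernel s z w) \<partial>hyp)"
    by (rule nn_integral_avg_kernel[OF z s, of "\<lambda>w. ennreal (?f w)"]) (use m in measurable)
  finally show ?thesis .
qed

text \<open>The half-turn about the midpoint of \<open>z\<close> and \<open>w\<close>. A traceless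
  matrix with rows \<open>(a, b)\<close> and \<open>(c, - a)\<close> exchanges the two points as
  soon as \<open>a * (z + w) + b = c * z * w\<close>; for \<open>c = Im z + Im w\<close> the
  imaginary part of this equation gives \<open>a\<close> and the real part gives \<open>b\<close>.
  \<open>D\<close> is the determinant before normalisation.\<close>

lemma swap_isometry:
  assumes z: "z \<in> \<H>" and w: "w \<in> \<H>"
  obtains B where "det B = 1" "mob B z = w" "mob B w = z"
proof -
  define a where "a = Im (z * w)"
  define c where "c = Im z + Im w"
  define b where "b = c * Re (z * w) - a * (Re z + Re w)"
  define D where "D = - a * a - b * c"
  have "D = Im z * Im w * ((Re z - Re w)\<^sup>2 + (Im z + Im w)\<^sup>2)"
    by (simp add: D_def a_def b_def c_def power2_eq_square algebra_simps)
  also have "\<dots> > 0" using z w by (intro mult_pos_pos add_nonneg_pos) auto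
  finally have D: "D > 0" .
  define k where "k = 1 / sqrt D"
  have k: "k > 0" "k * k * D = 1" using D by (auto simp: k_def)
  define B :: "real^2^2" where "B = vector [vector [k * a, k * b], vector [k * c, - (k * a)]]"
  have "det B = k * k * D" by (simp add: B_def det_2 D_def algebra_simps)
  then have det: "det B = 1" using k by simp
  have eq: "of_real a * (z + w) + of_real b = of_real c * z * w"
    by (simp add: complex_eq_iff a_def b_def c_def algebra_simps)
  have mobB: "mob B x = y" if x: "x \<in> \<H>" and xy: "of_real a * x + of_real b = y * (of_real c * x - of_real a)" for x y
  proof -
    have "Im (of_real c * x - of_real a) \<noteq> 0" using x z w by (simp add: c_def)
    then have nz: "of_real c * x - of_real a \<noteq> 0" by (metis zero_complex.sel(2))
    have "mob B x = (of_real k * (of_real a * x + of_real b)) / (of_real k * (of_real c * x - of_real a))"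
      by (simp add: mob_eq aut_factor_def B_def algebra_simps)
    then show ?thesis using k nz by (simp add: xy)
  qed
  show ?thesis
  proof (rule that[OF det])
    show "mob B z = w" 
    proof (rule mobB[OF z])
      have "of_real a * z + of_real b - w * (of_real c * z - of_real a)
          = (of_real a * (z + w) + of_real b) - of_real c * z * w"
        by (simp add: algebra_simps)
      then show "of_real a * z + of_real b = w * (of_real c * z - of_real a)"
        using eq by simp
    qed
    show "mob B w = z" 
    proof (rule mobB[OF w])
      have "of_real a * w + of_real b - z * (of_real c * w - of_real a)
          = (of_real a * (z + w) + of_real b) - of_real c * z * w"
        by (simp add: algebra_simps)
      then show "of_real a * w + of_real b = z * (of_real c * w - of_real a)"
        using eq by simp
    qed
  qed
qed

lemma avg_kernel_mob:
  assumes "det A = 1" "z \<in> \<H>" "w \<in> \<H>"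
  shows "avg_kernel s (mob A z) (mob A w) = avg_kernel s z w"
  using assms by (simp add: avg_kernel_def norm_H_to_disc_mob)

lemma avg_kernel_convolution_commute:
  assumes z: "z \<in> \<H>" and w: "w \<in> \<H>"
  shows "(\<integral>\<^sup>+x. ennreal (avg_kernel r z x) * ennreal (avg_kernel s x w) \<partial>hyp)
       = (\<integral>\<^sup>+x. ennreal (avg_kernel s z x) * ennreal (avg_kernel r x w) \<partial>hyp)"
proof -
  obtain B where B: "det B = 1" "mob B z = w" "mob B w = z" by (rule swap_isometry[OF z w])
  have "(\<integral>\<^sup>+x. ennreal (avg_kernel r z x) * ennreal (avg_kernel s x w) \<partial>hyp)
      = (\<integral>\<^sup>+x. ennreal (avg_kernel r z (mob B x)) * ennreal (avg_kernel s (mob B x) w) \<partial>hyp)"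
    by (rule nn_integral_hyp_mob[OF B(1), symmetric]) measurable
  also have "\<dots> = (\<integral>\<^sup>+x. ennreal (avg_kernel s z x) * ennreal (avg_kernel r x w) \<partial>hyp)"
  proof (rule nn_integral_cong_AE, use AE_hyp_H in eventually_elim)
    fix x assume x: "x \<in> \<H>"
    have "avg_kernel r z (mob B x) = avg_kernel r x w"
      using avg_kernel_mob[OF B(1) w x, of r] B by (simp add: avg_kernel_commute)
    moreover have "avg_kernel s (mob B x) w = avg_kernel s z x"
      using avg_kernel_mob[OF B(1) x z, of s] B by (simp add: avg_kernel_commute)
    ultimately show "ennreal (avg_kernel r z (mob B x)) * ennreal (avg_kernel s (mob B x) w)
        = ennreal (avg_kernel s z x) * ennreal (avg_kernel r x w)"
      by (simp add: mult.commute)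
  qed
  finally show ?thesis .
qed

lemma disc_avg_nonneg:
  fixes f :: "complex \<Rightarrow> real"
  assumes "0 \<le> s" "s < 1" "z \<in> \<H>" "\<And>w. w \<in> \<H> \<Longrightarrow> f w \<ge> 0"
  shows "disc_avg s f z \<ge> 0"
  unfolding disc_avg_def by (intro disc_int_nonneg assms chart_in_H) auto

lemma disc_avg_disc_avg_nonneg:
  fixes f :: "complex \<Rightarrow> real"
  assumes z: "z \<in> \<H>" and r: "0 < r" "r < 1" and s: "0 < s" "s < 1"
    and f: "continuous_on \<H> f" "\<And>w. w \<in> \<H> \<Longrightarrow> f w \<ge> 0"
  shows "ennreal (disc_avg r (disc_avg s f) z) = (\<integral>\<^sup>+w. ennreal (if w \<in> \<H> then f w else 0)
     * (\<integral>\<^sup>+x. ennreal (avg_kernel r z x) * ennreal (avg_kernel s x w) \<partial>hyp) \<partial>hyp)"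
proof -
  let ?f = "\<lambda>w. if w \<in> \<H> then f w else 0"
  have m [measurable]: "?f \<in> borel_measurable borel"
    using f by (intro borel_measurable_continuous_on_if) auto
  interpret P: pair_sigma_finite hyp hyp ..
  have "ennreal (disc_avg r (disc_avg s f) z)
     = (\<integral>\<^sup>+x. ennreal (if x \<in> \<H> then disc_avg s f x else 0) * ennreal (avg_kernel r z x) \<partial>hyp)"
    unfolding disc_avg_def[of r]
    by (rule ennreal_disc_int_kernel) (use z r s f in \<open>auto intro!: continuous_on_disc_avg disc_avg_nonneg\<close>)
  also have "\<dots> = (\<integral>\<^sup>+x. (\<integral>\<^sup>+w. ennreal (?f w) * ennreal (avg_kernel s x w) * ennreal (avg_kernel r z x) \<partial>hyp) \<partial>hyp)"
  proof (rule nn_integral_cong_AE, use AE_hyp_H in eventually_elim)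
    fix x assume x: "x \<in> \<H>"
    have "ennreal (disc_avg s f x) = (\<integral>\<^sup>+w. ennreal (?f w) * ennreal (avg_kernel s x w) \<partial>hyp)"
      unfolding disc_avg_def[of s] by (rule ennreal_disc_int_kernel[OF x s f])
    moreover have "(\<integral>\<^sup>+w. ennreal (?f w) * ennreal (avg_kernel s x w) * ennreal (avg_kernel r z x) \<partial>hyp)
       = (\<integral>\<^sup>+w. ennreal (?f w) * ennreal (avg_kernel s x w) \<partial>hyp) * ennreal (avg_kernel r z x)"
      by (rule nn_integral_multc) measurable
    ultimately show "ennreal (if x \<in> \<H> then disc_avg s f x else 0) * ennreal (avg_kernel r z x)
       = (\<integral>\<^sup>+w. ennreal (?f w) * ennreal (avg_kernel s x w) * ennreal (avg_kernel r z x) \<partial>hyp)"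
      using x by (simp only: if_P)
  qed
  also have "\<dots> = (\<integral>\<^sup>+w. (\<integral>\<^sup>+x. ennreal (?f w) * ennreal (avg_kernel s x w) * ennreal (avg_kernel r z x) \<partial>hyp) \<partial>hyp)"
    by (rule P.Fubini'[symmetric]) measurable
  also have "\<dots> = (\<integral>\<^sup>+w. ennreal (?f w) * (\<integral>\<^sup>+x. ennreal (avg_kernel r z x) * ennreal (avg_kernel s x w) \<partial>hyp) \<partial>hyp)"
    by (intro nn_integral_cong) (subst nn_integral_cmult[symmetric], auto simp: mult_ac)
  finally show ?thesis .
qed

lemma disc_avg_commute_nonneg:
  fixes f :: "complex \<Rightarrow> real"
  assumes z: "z \<in> \<H>" and r: "0 < r" "r < 1" and s: "0 < s" "s < 1"
    and f: "continuous_on \<H> f" "\<And>w. w \<in> \<H> \<Longrightarrow> f w \<ge> 0"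
  shows "disc_avg r (disc_avg s f) z = disc_avg s (disc_avg r f) z"
proof -
  have "ennreal (disc_avg r (disc_avg s f) z) = ennreal (disc_avg s (disc_avg r f) z)"
  proof -
    let ?f = "\<lambda>w. ennreal (if w \<in> \<H> then f w else 0)"
    have e: "ennreal (disc_avg r (disc_avg s f) z) = (\<integral>\<^sup>+w. ?f w
        * (\<integral>\<^sup>+x. ennreal (avg_kernel r z x) * ennreal (avg_kernel s x w) \<partial>hyp) \<partial>hyp)"
      if "0 < r" "r < 1" "0 < s" "s < 1" for r s
      by (rule disc_avg_disc_avg_nonneg) (fact z f that)+
    have "(\<integral>\<^sup>+w. ?f w * (\<integral>\<^sup>+x. ennreal (avg_kernel r z x) * ennreal (avg_kernel s x w) \<partial>hyp) \<partial>hyp)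
      = (\<integral>\<^sup>+w. ?f w * (\<integral>\<^sup>+x. ennreal (avg_kernel s z x) * ennreal (avg_kernel r x w) \<partial>hyp) \<partial>hyp)"
      by (rule nn_integral_cong) (simp add: avg_kernel_convolution_commute[OF z])
    then show ?thesis using e r s by simp
  qed
  moreover have "disc_avg r (disc_avg s f) z \<ge> 0" "disc_avg s (disc_avg r f) z \<ge> 0"
    using z r s f by (auto intro!: disc_avg_nonneg)
  ultimately show ?thesis by simp
qed

lemma disc_avg_commute:
  fixes f :: "complex \<Rightarrow> real"
  assumes z: "z \<in> \<H>" and r: "0 < r" "r < 1" and s: "0 < s" "s < 1" and f: "continuous_on \<H> f"
  shows "disc_avg r (disc_avg s f) z = disc_avg s (disc_avg r f) z"
proof -
  \<comment> \<open>A difference of two functions that are both nonnegative and continuous.\<close>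
  let ?p = "\<lambda>w. \<bar>f w\<bar> + f w" and ?n = "\<lambda>w. \<bar>f w\<bar>"
  have c: "continuous_on \<H> ?p" "continuous_on \<H> ?n" using f by (auto intro!: continuous_intros)
  have split: "disc_avg r (disc_avg s f) z = disc_avg r (disc_avg s ?p) z - disc_avg r (disc_avg s ?n) z"
    if r: "0 < r" "r < 1" and s: "0 < s" "s < 1" for r s
  proof -
    have "disc_avg r (disc_avg s f) z = disc_avg r (\<lambda>w. disc_avg s ?p w - disc_avg s ?n w) z"
    proof (rule disc_avg_cong)
      fix w assume "w \<in> \<H>"
      then have "disc_avg s (\<lambda>w. ?p w - ?n w) w = disc_avg s ?p w - disc_avg s ?n w"
        using s c by (intro disc_avg_diff) auto
      then show "disc_avg s f w = disc_avg s ?p w - disc_avg s ?n w" by simp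
    qed (use r z in auto)
    also have "\<dots> = disc_avg r (disc_avg s ?p) z - disc_avg r (disc_avg s ?n) z"
      using r s z c by (intro disc_avg_diff continuous_on_disc_avg) auto
    finally show ?thesis .
  qed
  show ?thesis
    unfolding split[OF r s] split[OF s r]
    using disc_avg_commute_nonneg[OF z r s c(1)] disc_avg_commute_nonneg[OF z r s c(2)] by simp
qed

section \<open>Equivariant functions fixed by all disc averages\<close>

context surface_group begin

abbreviation hF_int :: "(complex \<Rightarrow> 'b::{banach, second_countable_topology}) \<Rightarrow> 'b" where
  "hF_int f \<equiv> (LINT z:\<H>|hF. f z)"

lemma set_integrable_hF:
  fixes f :: "complex \<Rightarrow> 'b::{banach, second_countable_topology}"
  assumes "continuous_on \<H> f" "\<And>z. z \<in> \<H> \<Longrightarrow> norm (f z) \<le> B"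
  shows "set_integrable hF \<H> f"
  by (rule set_integrable_bounded_continuous[where B=B, OF finite_measure_hF]) (use assms in auto)

lemma hF_int_const: "hF_int (\<lambda>z. c) = measure hF UNIV *\<^sub>R c"
proof -
  have "hF_int (\<lambda>z. c) = (\<integral>z. c \<partial>hF)"
    unfolding set_lebesgue_integral_def
    by (rule integral_cong_AE[OF _ _ eventually_mono[OF AE_hF_H]]) auto
  then show ?thesis by simp
qed

lemma ennreal_hF_int:
  fixes f :: "complex \<Rightarrow> real"
  assumes "set_integrable hF \<H> f" "\<And>z. z \<in> \<H> \<Longrightarrow> f z \<ge> 0"
  shows "ennreal (hF_int f) = (\<integral>\<^sup>+z. ennreal (if z \<in> \<H> then f z else 0) \<partial>hF)"
proof -
  have e: "(\<lambda>z. indicator \<H> z *\<^sub>R f z) = (\<lambda>z. if z \<in> \<H> then f z else 0)"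
    by (auto simp: indicator_def)
  have "integrable hF (\<lambda>z. if z \<in> \<H> then f z else 0)"
    using assms(1) unfolding set_integrable_def e .
  then show ?thesis unfolding set_lebesgue_integral_def e
    by (intro nn_integral_eq_integral[symmetric]) (use assms in auto)
qed

text \<open>Moving \<open>z\<close> into \<open>K\<close> by a group element only rotates \<eta>, so
  every value of the norm is already attained over \<open>K\<close> times the closed disc.\<close>

lemma bounded_diagonal_invariant:
  fixes b :: "complex \<Rightarrow> complex \<Rightarrow> 'b::real_normed_vector"
  assumes cont: "continuous_on (\<H> \<times> \<H>) (\<lambda>x. b (fst x) (snd x))"
    and inv: "\<And>A z w. A \<in> G \<Longrightarrow> z \<in> \<H> \<Longrightarrow> w \<in> \<H> \<Longrightarrow> norm (b (mob A z) (mob A w)) = norm (b z w)"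
    and s: "0 \<le> s" "s < 1"
  obtains C where "C \<ge> 0" "\<And>z \<eta>. z \<in> \<H> \<Longrightarrow> cmod \<eta> \<le> 1 \<Longrightarrow> norm (b z (chart s z \<eta>)) \<le> C"
proof -
  have "continuous_on (K \<times> cball 0 1) (\<lambda>x. (\<lambda>x. b (fst x) (snd x)) (fst x, chart s (fst x) (snd x)))"
  proof (rule continuous_on_compose2[OF cont])
    show "continuous_on (K \<times> cball 0 1) (\<lambda>x. (fst x, chart s (fst x) (snd x)))"
      by (intro continuous_on_Pair continuous_on_fst continuous_on_id
          continuous_on_subset[OF continuous_on_chart[OF s]]) auto
    show "(\<lambda>x. (fst x, chart s (fst x) (snd x))) ` (K \<times> cball 0 1) \<subseteq> \<H> \<times> \<H>"
      using K_sub chart_in_H s by auto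
  qed
  moreover have "compact (K \<times> cball (0::complex) 1)" by (intro compact_Times K_compact) simp
  ultimately have "bounded ((\<lambda>x. b (fst x) (chart s (fst x) (snd x))) ` (K \<times> cball 0 1))"
    using compact_continuous_image compact_imp_bounded by fastforce
  then obtain C where C: "C > 0" "\<And>x. x \<in> K \<times> cball 0 1 \<Longrightarrow> norm (b (fst x) (chart s (fst x) (snd x))) \<le> C"
    unfolding bounded_pos by blast
  show ?thesis
  proof (rule that[of C])
    fix z \<eta> assume z: "z \<in> \<H>" and \<eta>: "cmod \<eta> \<le> 1"
    obtain A where A: "A \<in> G" "mob A z \<in> K" using K_meets[OF z] by blast
    have d: "det A = 1" using A det_one by simp
    let ?e = "cnj (aut_factor A z) / aut_factor A z"
    have "norm (b z (chart s z \<eta>)) = norm (b (mob A z) (mob A (chart s z \<eta>)))"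
      by (rule inv[symmetric]) (use A z chart_in_H[OF z s \<eta>] in auto)
    also have "\<dots> = norm (b (mob A z) (chart s (mob A z) (?e * \<eta>)))"
      using chart_mob[OF d z s \<eta>] by simp
    also have "\<dots> \<le> C"
    proof -
      have "cmod (?e * \<eta>) \<le> 1" unfolding norm_mult norm_aut_factor_ratio[OF d z] using \<eta> by simp
      then have "(mob A z, ?e * \<eta>) \<in> K \<times> cball 0 1" using A(2) by (simp only: mem_Times_iff fst_conv snd_conv mem_cball_0)
      from C(2)[OF this] show ?thesis by (simp only: fst_conv snd_conv)
    qed
    finally show "norm (b z (chart s z \<eta>)) \<le> C" .
  qed (use C in simp)
qed

lemma bounded_invariant:
  fixes v :: "complex \<Rightarrow> 'b::real_normed_vector"
  assumes cont: "continuous_on \<H> v"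
    and inv: "\<And>A z. A \<in> G \<Longrightarrow> z \<in> \<H> \<Longrightarrow> norm (v (mob A z)) = norm (v z)"
  obtains C where "C \<ge> 0" "\<And>z. z \<in> \<H> \<Longrightarrow> norm (v z) \<le> C"
proof (rule bounded_diagonal_invariant[of "\<lambda>z w. v z" 0])
  show "continuous_on (\<H> \<times> \<H>) (\<lambda>x. v (fst x))"
    by (rule continuous_on_compose2[OF cont]) (auto intro!: continuous_intros)
  fix C assume "C \<ge> 0" "\<And>z \<eta>. z \<in> \<H> \<Longrightarrow> cmod \<eta> \<le> 1 \<Longrightarrow> norm (v z) \<le> C"
  then show ?thesis using that[of C] by (metis norm_zero zero_le_one)
qed (use inv in auto)

lemma continuous_on_disc_int_diagonal:
  fixes b :: "complex \<Rightarrow> complex \<Rightarrow> 'b::{banach, second_countable_topology}"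
  assumes cont: "continuous_on (\<H> \<times> \<H>) (\<lambda>x. b (fst x) (snd x))" and s: "0 \<le> s" "s < 1"
  shows "continuous_on \<H> (\<lambda>z. disc_int (\<lambda>\<eta>. b z (chart s z \<eta>)))"
proof -
  have "continuous_on (\<H> \<times> cball 0 1) (\<lambda>x. (\<lambda>x. b (fst x) (snd x)) (fst x, chart s (fst x) (snd x)))"
  proof (rule continuous_on_compose2[OF cont])
    show "continuous_on (\<H> \<times> cball 0 1) (\<lambda>x. (fst x, chart s (fst x) (snd x)))"
      by (intro continuous_on_Pair continuous_on_fst continuous_on_id
          continuous_on_subset[OF continuous_on_chart[OF s]]) auto
    show "(\<lambda>x. (fst x, chart s (fst x) (snd x))) ` (\<H> \<times> cball 0 1) \<subseteq> \<H> \<times> \<H>"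
      using chart_in_H s by auto
  qed
  from continuous_on_disc_int[OF this] show ?thesis by simp
qed

lemma continuous_on_section:
  assumes cont: "continuous_on (\<H> \<times> \<H>) (\<lambda>x. b (fst x) (snd x))" and z: "z \<in> \<H>"
  shows "continuous_on \<H> (b z)"
proof -
  have "continuous_on \<H> (\<lambda>w. (\<lambda>x. b (fst x) (snd x)) (z, w))"
    by (rule continuous_on_compose2[OF cont]) (use z in \<open>auto intro!: continuous_intros\<close>)
  then show ?thesis by simp
qed

text \<open>Brings the integral over pairs of points into the form to which
  \<open>nn_integral_symmetrize\<close> applies.\<close>

lemma hF_int_disc_int_nonneg:
  fixes c :: "complex \<Rightarrow> complex \<Rightarrow> real"
  assumes cont: "continuous_on (\<H> \<times> \<H>) (\<lambda>x. c (fst x) (snd x))"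
    and nn: "\<And>z w. z \<in> \<H> \<Longrightarrow> w \<in> \<H> \<Longrightarrow> c z w \<ge> 0"
    and inv: "\<And>A z w. A \<in> G \<Longrightarrow> z \<in> \<H> \<Longrightarrow> w \<in> \<H> \<Longrightarrow> c (mob A z) (mob A w) = c z w"
    and s: "0 < s" "s < 1"
  shows "set_integrable hF \<H> (\<lambda>z. disc_int (\<lambda>\<eta>. c z (chart s z \<eta>)))"
    and "ennreal (hF_int (\<lambda>z. disc_int (\<lambda>\<eta>. c z (chart s z \<eta>))))
      = (\<integral>\<^sup>+z. (\<integral>\<^sup>+w. ennreal (if z \<in> \<H> \<and> w \<in> \<H> then c z w else 0) * ennreal (avg_kernel s z w) \<partial>hyp) \<partial>hF)"
proof -
  have s': "0 \<le> s" using s by simp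
  let ?P = "\<lambda>z. disc_int (\<lambda>\<eta>. c z (chart s z \<eta>))"
  obtain C where C: "C \<ge> 0" "\<And>z \<eta>. z \<in> \<H> \<Longrightarrow> cmod \<eta> \<le> 1 \<Longrightarrow> norm (c z (chart s z \<eta>)) \<le> C"
  proof (rule bounded_diagonal_invariant[OF cont _ s' s(2)])
    show "norm (c (mob A z) (mob A w)) = norm (c z w)" if "A \<in> G" "z \<in> \<H>" "w \<in> \<H>" for A z w
      using inv[OF that] by simp
  qed (rule that)
  show int: "set_integrable hF \<H> ?P"
    by (rule set_integrable_hF[where B=C])
       (use C s in \<open>auto intro!: norm_disc_int_le continuous_on_disc_int_diagonal cont simp del: real_norm_def\<close>)
  have "ennreal (hF_int ?P) = (\<integral>\<^sup>+z. ennreal (if z \<in> \<H> then ?P z else 0) \<partial>hF)"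
    by (rule ennreal_hF_int[OF int]) (use nn chart_in_H s in \<open>auto intro!: disc_int_nonneg\<close>)
  also have "\<dots> = (\<integral>\<^sup>+z. (\<integral>\<^sup>+w. ennreal (if z \<in> \<H> \<and> w \<in> \<H> then c z w else 0) * ennreal (avg_kernel s z w) \<partial>hyp) \<partial>hF)"
  proof (rule nn_integral_cong_AE, use AE_hF_H in eventually_elim)
    fix z assume z: "z \<in> \<H>"
    have "ennreal (?P z) = (\<integral>\<^sup>+w. ennreal (if w \<in> \<H> then c z w else 0) * ennreal (avg_kernel s z w) \<partial>hyp)"
      by (rule ennreal_disc_int_kernel[OF z s continuous_on_section[OF cont z]]) (use nn z in auto)
    then show "ennreal (if z \<in> \<H> then ?P z else 0)
        = (\<integral>\<^sup>+w. ennreal (if z \<in> \<H> \<and> w \<in> \<H> then c z w else 0) * ennreal (avg_kernel s z w) \<partial>hyp)"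
      using z by simp
  qed
  finally show "ennreal (hF_int ?P) = (\<integral>\<^sup>+z. (\<integral>\<^sup>+w. ennreal (if z \<in> \<H> \<and> w \<in> \<H> then c z w else 0) * ennreal (avg_kernel s z w) \<partial>hyp) \<partial>hF)" .
qed

text \<open>Exchanging the two points turns the positive part of \<open>b\<close> into its negative
  part, so the two parts have equal integrals.\<close>

lemma hF_int_antisymmetric:
  fixes b :: "complex \<Rightarrow> complex \<Rightarrow> real"
  assumes cont: "continuous_on (\<H> \<times> \<H>) (\<lambda>x. b (fst x) (snd x))"
    and inv: "\<And>A z w. A \<in> G \<Longrightarrow> z \<in> \<H> \<Longrightarrow> w \<in> \<H> \<Longrightarrow> b (mob A z) (mob A w) = b z w"
    and anti: "\<And>z w. z \<in> \<H> \<Longrightarrow> w \<in> \<H> \<Longrightarrow> b w z = - b z w"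
    and s: "0 < s" "s < 1"
  shows "hF_int (\<lambda>z. disc_int (\<lambda>\<eta>. b z (chart s z \<eta>))) = 0"
proof -
  define p where "p = (\<lambda>z w. max (b z w) 0)"
  define n where "n = (\<lambda>z w. max (- b z w) 0)"
  have pc: "continuous_on (\<H> \<times> \<H>) (\<lambda>x. p (fst x) (snd x))"
    and nc: "continuous_on (\<H> \<times> \<H>) (\<lambda>x. n (fst x) (snd x))"
    unfolding p_def n_def using cont by (auto intro!: continuous_intros)
  have pinv: "p (mob A z) (mob A w) = p z w" "n (mob A z) (mob A w) = n z w"
    if "A \<in> G" "z \<in> \<H>" "w \<in> \<H>" for A z w
    using inv[OF that] by (auto simp: p_def n_def)
  have nn: "p z w \<ge> 0" "n z w \<ge> 0" for z w by (auto simp: p_def n_def)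
  let ?p0 = "\<lambda>z w. if z \<in> \<H> \<and> w \<in> \<H> then p z w else 0"
  have p0m: "case_prod ?p0 \<in> borel_measurable (borel \<Otimes>\<^sub>M borel)"
  proof -
    have "(\<lambda>x. if x \<in> \<H> \<times> \<H> then p (fst x) (snd x) else 0) \<in> borel_measurable borel"
      by (intro borel_measurable_continuous_on_if pc borel_open open_Times) auto
    then show ?thesis unfolding borel_prod by (simp add: case_prod_unfold mem_Times_iff)
  qed
  have "ennreal (hF_int (\<lambda>z. disc_int (\<lambda>\<eta>. p z (chart s z \<eta>))))
      = (\<integral>\<^sup>+z. (\<integral>\<^sup>+w. ennreal (?p0 z w) * ennreal (avg_kernel s z w) \<partial>hyp) \<partial>hF)"
    by (rule hF_int_disc_int_nonneg(2)) (use pc nn pinv s in auto)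
  also have "\<dots> = (\<integral>\<^sup>+z. (\<integral>\<^sup>+w. ennreal (?p0 w z) * ennreal (avg_kernel s w z) \<partial>hyp) \<partial>hF)"
  proof (rule nn_integral_symmetrize)
    have "(\<lambda>x. ennreal (case_prod ?p0 x) * ennreal (avg_kernel s (fst x) (snd x))) \<in> borel_measurable (borel \<Otimes>\<^sub>M borel)"
      using p0m by measurable
    then show "(\<lambda>(z, w). ennreal (?p0 z w) * ennreal (avg_kernel s z w)) \<in> borel_measurable (borel \<Otimes>\<^sub>M borel)"
      by (simp add: case_prod_unfold)
    fix A z w assume a: "A \<in> G" "z \<in> \<H>" "w \<in> \<H>"
    then have "mob A z \<in> \<H>" "mob A w \<in> \<H>" using mob_in_H det_one by blast+
    then show "ennreal (?p0 (mob A z) (mob A w)) * ennreal (avg_kernel s (mob A z) (mob A w))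
        = ennreal (?p0 z w) * ennreal (avg_kernel s z w)"
      using a pinv(1)[OF a] avg_kernel_mob[OF det_one[OF a(1)] a(2,3)] by simp
  qed
  also have "\<dots> = (\<integral>\<^sup>+z. (\<integral>\<^sup>+w. ennreal (if z \<in> \<H> \<and> w \<in> \<H> then n z w else 0) * ennreal (avg_kernel s z w) \<partial>hyp) \<partial>hF)"
  proof (intro nn_integral_cong)
    fix z w
    have "?p0 w z = (if z \<in> \<H> \<and> w \<in> \<H> then n z w else 0)"
      using anti[of z w] by (auto simp: p_def n_def)
    then show "ennreal (?p0 w z) * ennreal (avg_kernel s w z)
        = ennreal (if z \<in> \<H> \<and> w \<in> \<H> then n z w else 0) * ennreal (avg_kernel s z w)"
      by (simp only: avg_kernel_commute[of s w z])
  qed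
  also have "\<dots> = ennreal (hF_int (\<lambda>z. disc_int (\<lambda>\<eta>. n z (chart s z \<eta>))))"
    by (rule hF_int_disc_int_nonneg(2)[symmetric]) (use nc nn pinv s in auto)
  finally have eq: "ennreal (hF_int (\<lambda>z. disc_int (\<lambda>\<eta>. p z (chart s z \<eta>))))
      = ennreal (hF_int (\<lambda>z. disc_int (\<lambda>\<eta>. n z (chart s z \<eta>))))" .
  have "hF_int (\<lambda>z. disc_int (\<lambda>\<eta>. q z (chart s z \<eta>))) \<ge> 0" if "\<And>z w. q z w \<ge> 0" for q :: "complex \<Rightarrow> complex \<Rightarrow> real"
    unfolding set_lebesgue_integral_def[of hF]
    by (rule integral_nonneg_AE) (auto simp: indicator_def intro!: disc_int_nonneg that)
  then have eq': "hF_int (\<lambda>z. disc_int (\<lambda>\<eta>. p z (chart s z \<eta>)))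
      = hF_int (\<lambda>z. disc_int (\<lambda>\<eta>. n z (chart s z \<eta>)))"
    using eq nn by simp
  have "hF_int (\<lambda>z. disc_int (\<lambda>\<eta>. b z (chart s z \<eta>)))
      = hF_int (\<lambda>z. disc_int (\<lambda>\<eta>. p z (chart s z \<eta>)) - disc_int (\<lambda>\<eta>. n z (chart s z \<eta>)))"
  proof (rule set_lebesgue_integral_cong)
    show "\<forall>z. z \<in> \<H> \<longrightarrow> disc_int (\<lambda>\<eta>. b z (chart s z \<eta>)) = disc_int (\<lambda>\<eta>. p z (chart s z \<eta>)) - disc_int (\<lambda>\<eta>. n z (chart s z \<eta>))"
    proof (intro allI impI)
      fix z assume z: "z \<in> \<H>"
      have "disc_int (\<lambda>\<eta>. p z (chart s z \<eta>)) - disc_int (\<lambda>\<eta>. n z (chart s z \<eta>))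
          = disc_int (\<lambda>\<eta>. p z (chart s z \<eta>) - n z (chart s z \<eta>))"
        by (rule disc_int_diff[symmetric])
           (use s z in \<open>auto intro!: continuous_on_compose_chart continuous_on_section[OF pc z] continuous_on_section[OF nc z]\<close>)
      also have "(\<lambda>\<eta>. p z (chart s z \<eta>) - n z (chart s z \<eta>)) = (\<lambda>\<eta>. b z (chart s z \<eta>))"
        by (auto simp: p_def n_def)
      finally show "disc_int (\<lambda>\<eta>. b z (chart s z \<eta>)) = disc_int (\<lambda>\<eta>. p z (chart s z \<eta>)) - disc_int (\<lambda>\<eta>. n z (chart s z \<eta>))" ..
    qed
  qed simp
  also have "\<dots> = hF_int (\<lambda>z. disc_int (\<lambda>\<eta>. p z (chart s z \<eta>))) - hF_int (\<lambda>z. disc_int (\<lambda>\<eta>. n z (chart s z \<eta>)))"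
    by (rule set_integral_diff(2))
       (auto intro!: hF_int_disc_int_nonneg(1) pc nc nn pinv s)
  finally show ?thesis using eq' by simp
qed

text \<open>The increment \<open>u w - u z\<close> is antisymmetric, and it is invariant under the
  diagonal action although \<open>u\<close> itself is not, because the period cancels. The lemma
  provides functions of mean zero for the contraction.\<close>

lemma disc_avg_mean_change:
  fixes u :: "complex \<Rightarrow> real"
  assumes cont: "continuous_on \<H> u"
    and inv: "\<And>A z. A \<in> G \<Longrightarrow> z \<in> \<H> \<Longrightarrow> u (mob A z) = u z + \<rho> A"
    and s: "0 < s" "s < 1"
  shows "hF_int (\<lambda>z. disc_avg s u z - u z) = 0"
proof -
  have "hF_int (\<lambda>z. disc_int (\<lambda>\<eta>. (\<lambda>z w. u w - u z) z (chart s z \<eta>))) = 0"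
  proof (rule hF_int_antisymmetric)
    have "continuous_on (\<H> \<times> \<H>) (\<lambda>x. u (fst x))" "continuous_on (\<H> \<times> \<H>) (\<lambda>x. u (snd x))"
      by (rule continuous_on_compose2[OF cont]; auto intro!: continuous_intros)+
    then show "continuous_on (\<H> \<times> \<H>) (\<lambda>x. u (snd x) - u (fst x))"
      by (intro continuous_intros)
  qed (use inv s in auto)
  also have "hF_int (\<lambda>z. disc_int (\<lambda>\<eta>. (\<lambda>z w. u w - u z) z (chart s z \<eta>))) = hF_int (\<lambda>z. disc_avg s u z - u z)"
  proof (rule set_lebesgue_integral_cong)
    show "\<forall>z. z \<in> \<H> \<longrightarrow> disc_int (\<lambda>\<eta>. u (chart s z \<eta>) - u z) = disc_avg s u z - u z"
    proof (intro allI impI)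
      fix z assume z: "z \<in> \<H>"
      have "disc_int (\<lambda>\<eta>. u (chart s z \<eta>) - u z) = disc_int (\<lambda>\<eta>. u (chart s z \<eta>)) - disc_int (\<lambda>\<eta>. u z)"
        by (rule disc_int_diff) (use s z cont in \<open>auto intro!: continuous_on_compose_chart\<close>)
      then show "disc_int (\<lambda>\<eta>. u (chart s z \<eta>) - u z) = disc_avg s u z - u z"
        by (simp add: disc_avg_def)
    qed
  qed simp
  finally show ?thesis .
qed

lemma disc_avg_equivariant:
  fixes u :: "complex \<Rightarrow> real"
  assumes cont: "continuous_on \<H> u"
    and inv: "\<And>A z. A \<in> G \<Longrightarrow> z \<in> \<H> \<Longrightarrow> u (mob A z) = u z + \<rho> A"
    and s: "0 < s" "s < 1" and A: "A \<in> G" and z: "z \<in> \<H>"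
  shows "disc_avg s u (mob A z) = disc_avg s u z + \<rho> A"
proof -
  have s': "0 \<le> s" using s by simp
  have "disc_avg s u (mob A z) = disc_avg s (\<lambda>w. u (mob A w)) z"
    by (rule disc_avg_mob) (use det_one A z s cont in auto)
  also have "\<dots> = disc_avg s (\<lambda>w. u w + \<rho> A) z"
    by (rule disc_avg_cong) (use s z inv A in auto)
  also have "\<dots> = disc_avg s u z + disc_avg s (\<lambda>w. \<rho> A) z"
    by (rule disc_avg_add) (use s z cont in auto)
  finally show ?thesis by simp
qed

text \<open>A Doeblin condition. For a large radius the kernel is at least \<open>c\<close> on pairs
  of points of \<open>K\<close>, so the average of the nonnegative function \<open>f + m\<close> at
  a point of \<open>K\<close> is at least \<open>c\<close> times its integral over the quotient,
  which is \<open>m\<close> times the area since \<open>f\<close> has mean zero.\<close>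

lemma disc_avg_contraction:
  "\<exists>r \<theta>. 0 < r \<and> r < 1 \<and> 0 \<le> \<theta> \<and> \<theta> < 1 \<and>
    (\<forall>f m. continuous_on \<H> f \<longrightarrow> (\<forall>A\<in>G. \<forall>z\<in>\<H>. f (mob A z) = f z) \<longrightarrow> hF_int f = (0::real)
      \<longrightarrow> (\<forall>z\<in>\<H>. \<bar>f z\<bar> \<le> m) \<longrightarrow> (\<forall>z\<in>\<H>. \<bar>disc_avg r f z\<bar> \<le> \<theta> * m))"
proof -
  have Kne: "K \<noteq> {}" using K_meets[of \<i>] by auto
  have cont: "continuous_on (K \<times> K) (\<lambda>x. cmod (H_to_disc (fst x) (snd x)))"
  proof -
    have "snd x \<noteq> cnj (fst x)" if "x \<in> K \<times> K" for x
    proof -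
      have "Im (fst x) > 0" "Im (snd x) > 0" using that K_sub by auto
      then show ?thesis by (auto simp: complex_eq_iff)
    qed
    then show ?thesis unfolding H_to_disc_def by (intro continuous_intros) auto
  qed
  have "compact (K \<times> K)" "K \<times> K \<noteq> {}" using Kne by (auto intro: compact_Times K_compact)
  from continuous_attains_sup[OF this cont] obtain x0 where x0: "x0 \<in> K \<times> K"
    "\<And>x. x \<in> K \<times> K \<Longrightarrow> cmod (H_to_disc (fst x) (snd x)) \<le> cmod (H_to_disc (fst x0) (snd x0))"
    by blast
  define q where "q = cmod (H_to_disc (fst x0) (snd x0))"
  have q: "0 \<le> q" "q < 1"
    using x0(1) K_sub norm_H_to_disc_less_1[of "fst x0" "snd x0"] by (auto simp: q_def mem_Times_iff)
  have Kq: "cmod (H_to_disc z w) \<le> q" if "z \<in> K" "w \<in> K" for z w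
    using x0(2)[of "(z, w)"] that by (simp add: q_def)
  \<comment> \<open>Strictly between \<open>q\<close> and 1, so that any two points of
    \<open>K\<close> lie within the support of the kernel.\<close>
  define r where "r = (1 + q) / 2"
  have r: "0 < r" "r < 1" "q < r" "0 \<le> r" using q by (auto simp: r_def)
  \<comment> \<open>The value of the kernel at modulus \<open>q\<close>, the largest between points
    of \<open>K\<close>; within its support the kernel decreases with the modulus.\<close>
  define c where "c = (1 - q\<^sup>2)\<^sup>2 / (4 * disc_area * r\<^sup>2)"
  have q2: "q\<^sup>2 < 1" using q by (simp add: power_less_one_iff)
  have c: "c > 0" unfolding c_def using q2 r disc_area_pos by (intro divide_pos_pos) auto
  have ker: "avg_kernel r z w \<ge> c" if "z \<in> K" "w \<in> K" for z w
  proof -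
    let ?t = "cmod (H_to_disc z w)"
    have "?t\<^sup>2 \<le> q\<^sup>2" using Kq[OF that] by (intro power_mono) auto
    then have "(1 - q\<^sup>2)\<^sup>2 \<le> (1 - ?t\<^sup>2)\<^sup>2" using q2 by (intro power_mono) auto
    then show ?thesis
      using Kq[OF that] r disc_area_pos unfolding avg_kernel_def c_def
      by (auto intro!: divide_right_mono)
  qed
  let ?\<mu> = "measure hF UNIV"
  \<comment> \<open>The maximum with 0 provides a nonnegative ratio, whose powers serve as
    bounds.\<close>
  define \<theta> where "\<theta> = max 0 (1 - c * ?\<mu>)"
  have low: "disc_avg r f z \<ge> - (\<theta> * m)"
    if f: "continuous_on \<H> f" and inv: "\<And>A z. A \<in> G \<Longrightarrow> z \<in> \<H> \<Longrightarrow> f (mob A z) = f z"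
      and f0: "hF_int f = 0" and m: "\<And>z. z \<in> \<H> \<Longrightarrow> \<bar>f z\<bar> \<le> m" and z: "z \<in> \<H>" for f :: "complex \<Rightarrow> real" and m z
  proof -
    have m0: "m \<ge> 0" using m[OF z] by simp
    obtain A where A: "A \<in> G" "mob A z \<in> K" using K_meets[OF z] by blast
    define y where "y = mob A z"
    have y: "y \<in> K" "y \<in> \<H>" using A K_sub by (auto simp: y_def)
    let ?g = "\<lambda>w. f w + m" and ?gH = "\<lambda>w. if w \<in> \<H> then f w + m else 0"
    have g1: "continuous_on \<H> ?g" using f by (intro continuous_intros)
    have g2: "?g w \<ge> 0" if "w \<in> \<H>" for w using m[OF that] by linarith
    note g = g1 g2
    have g0m [measurable]: "?gH \<in> borel_measurable borel"
      using g(1) by (intro borel_measurable_continuous_on_if) auto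
    have [measurable]: "K \<in> sets borel" using K_compact by (simp add: borel_compact)
    have int: "set_integrable hF \<H> f" "set_integrable hF \<H> (\<lambda>z. m)"
      by (rule set_integrable_hF[where B=m]; use f m m0 in auto)+
    have le: "(\<integral>\<^sup>+w. ennreal (?gH w) \<partial>hF) \<le> (\<integral>\<^sup>+w\<in>K. ennreal (?gH w) \<partial>hyp)"
    proof (rule nn_integral_hF_le_K)
      fix A z assume "A \<in> G" "z \<in> \<H>"
      then show "ennreal (?gH (mob A z)) = ennreal (?gH z)"
        using inv mob_in_H[OF det_one] by simp
    qed measurable
    have "hF_int ?g = m * ?\<mu>"
      using set_integral_add(2)[OF int] f0 by (simp add: hF_int_const mult.commute)
    then have "ennreal (c * (m * ?\<mu>)) = ennreal c * ennreal (hF_int ?g)"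
      using c m0 by (simp add: ennreal_mult)
    also have "ennreal (hF_int ?g) = (\<integral>\<^sup>+w. ennreal (?gH w) \<partial>hF)"
      by (rule ennreal_hF_int) (use set_integral_add(1)[OF int] g in auto)
    also have "ennreal c * (\<integral>\<^sup>+w. ennreal (?gH w) \<partial>hF) \<le> ennreal c * (\<integral>\<^sup>+w\<in>K. ennreal (?gH w) \<partial>hyp)"
      by (rule mult_left_mono[OF le]) simp
    also have "\<dots> = (\<integral>\<^sup>+w. ennreal c * (ennreal (?gH w) * indicator K w) \<partial>hyp)"
      by (rule nn_integral_cmult[symmetric]) measurable
    also have "\<dots> \<le> (\<integral>\<^sup>+w. ennreal (?gH w) * ennreal (avg_kernel r y w) \<partial>hyp)"
    proof (rule nn_integral_mono)
      fix w
      show "ennreal c * (ennreal (?gH w) * indicator K w) \<le> ennreal (?gH w) * ennreal (avg_kernel r y w)"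
      proof (cases "w \<in> K")
        case True
        then have "ennreal (?gH w) * ennreal c \<le> ennreal (?gH w) * ennreal (avg_kernel r y w)"
          by (intro mult_left_mono ennreal_leI ker y) auto
        then show ?thesis using True by (simp add: mult_ac)
      qed simp
    qed
    also have "\<dots> = ennreal (disc_int (\<lambda>\<eta>. ?g (chart r y \<eta>)))"
      by (rule ennreal_disc_int_kernel[symmetric]) (use y r g in auto)
    finally have "ennreal (c * (m * ?\<mu>)) \<le> ennreal (disc_avg r ?g y)"
      by (simp add: disc_avg_def)
    moreover have "disc_avg r ?g y \<ge> 0"
      by (rule disc_avg_nonneg) (use r y g in auto)
    ultimately have "c * (m * ?\<mu>) \<le> disc_avg r ?g y" by simp
    also have "disc_avg r ?g y = disc_avg r f y + disc_avg r (\<lambda>w. m) y"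
      by (rule disc_avg_add) (use r y f in auto)
    finally have "disc_avg r f y \<ge> - ((1 - c * ?\<mu>) * m)" by (simp add: algebra_simps)
    moreover have "(1 - c * ?\<mu>) * m \<le> \<theta> * m"
      using m0 by (intro mult_right_mono) (auto simp: \<theta>_def)
    moreover have "disc_avg r f y = disc_avg r f z"
      using disc_avg_equivariant[OF f, of "\<lambda>_. 0" r A z] inv r A z by (simp add: y_def)
    ultimately show ?thesis by simp
  qed
  show ?thesis
  proof (rule exI[of _ r], rule exI[of _ \<theta>], intro conjI allI impI ballI)
    show "\<theta> < 1" using c measure_hF_pos by (simp add: \<theta>_def)
    fix f :: "complex \<Rightarrow> real" and m z
    assume f: "continuous_on \<H> f" and inv: "\<forall>A\<in>G. \<forall>z\<in>\<H>. f (mob A z) = f z"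
      and f0: "hF_int f = 0" and m: "\<forall>z\<in>\<H>. \<bar>f z\<bar> \<le> m" and z: "z \<in> \<H>"
    have 1: "disc_avg r f z \<ge> - (\<theta> * m)"
      by (rule low[OF f _ f0 _ z]) (use inv m in auto)
    \<comment> \<open>The upper bound is the lower bound for \<open>- f\<close>.\<close>
    have "disc_avg r (\<lambda>w. - f w) z \<ge> - (\<theta> * m)"
    proof (rule low)
      show "hF_int (\<lambda>w. - f w) = 0" using f0 by (simp add: set_lebesgue_integral_def)
    qed (use f inv m z in \<open>auto intro: continuous_intros\<close>)
    moreover have "disc_avg r (\<lambda>w. 0 - f w) z = disc_avg r (\<lambda>w. 0) z - disc_avg r f z"
      by (rule disc_avg_diff) (use r z f in auto)
    ultimately show "\<bar>disc_avg r f z\<bar> \<le> \<theta> * m" using 1 by (simp add: abs_le_iff)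
  qed (use r in \<open>auto simp: \<theta>_def\<close>)
qed

text \<open>The contraction does not apply to the iterates \<open>U n\<close>, which are only
  equivariant. It applies to their increments \<open>d n\<close>, which are invariant and of mean
  zero and hence decay geometrically, so the iterates converge uniformly.\<close>

lemma disc_avg_fixed_point:
  fixes u :: "complex \<Rightarrow> real"
  assumes cont: "continuous_on \<H> u"
    and inv: "\<And>A z. A \<in> G \<Longrightarrow> z \<in> \<H> \<Longrightarrow> u (mob A z) = u z + \<rho> A"
  obtains h where "continuous_on \<H> h" "\<And>A z. A \<in> G \<Longrightarrow> z \<in> \<H> \<Longrightarrow> h (mob A z) = h z + \<rho> A"
    "\<And>s z. 0 < s \<Longrightarrow> s < 1 \<Longrightarrow> z \<in> \<H> \<Longrightarrow> disc_avg s h z = h z"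
proof -
  from disc_avg_contraction obtain r \<theta> where r: "0 < r" "r < 1" and \<theta>: "0 \<le> \<theta>" "\<theta> < 1"
    and C: "\<forall>f m. continuous_on \<H> f \<longrightarrow> (\<forall>A\<in>G. \<forall>z\<in>\<H>. f (mob A z) = f z) \<longrightarrow> hF_int f = (0::real)
      \<longrightarrow> (\<forall>z\<in>\<H>. \<bar>f z\<bar> \<le> m) \<longrightarrow> (\<forall>z\<in>\<H>. \<bar>disc_avg r f z\<bar> \<le> \<theta> * m)"
    by blast
  have contr: "\<bar>disc_avg r f z\<bar> \<le> \<theta> * m"
    if "continuous_on \<H> f" "\<And>A z. A \<in> G \<Longrightarrow> z \<in> \<H> \<Longrightarrow> f (mob A z) = f z" "hF_int f = 0"
      "\<And>z. z \<in> \<H> \<Longrightarrow> \<bar>f z\<bar> \<le> m" "z \<in> \<H>" for f m z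
    using C[rule_format, of f m z] that by blast
  have r0: "0 \<le> r" using r by simp
  define U where "U = (\<lambda>n. (disc_avg r ^^ n) u)"
  have U0: "U 0 = u" and US: "U (Suc n) = disc_avg r (U n)" for n by (auto simp: U_def)
  have Uc: "continuous_on \<H> (U n)" for n
    by (induction n) (auto simp: U0 US intro!: continuous_on_disc_avg cont r r0)
  have Uinv: "U n (mob A z) = U n z + \<rho> A" if "A \<in> G" "z \<in> \<H>" for n A z
    using that
  proof (induction n arbitrary: A z)
    case 0
    then show ?case by (simp add: U0 inv)
  next
    case (Suc n)
    show ?case unfolding US
      by (rule disc_avg_equivariant[OF Uc]) (use Suc r in auto)
  qed
  define d where "d = (\<lambda>n z. U (Suc n) z - U n z)"
  have dc: "continuous_on \<H> (d n)" for n
    unfolding d_def by (intro continuous_intros Uc)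
  have dinv: "d n (mob A z) = d n z" if "A \<in> G" "z \<in> \<H>" for n A z
    unfolding d_def Uinv[OF that] by simp
  have d0: "hF_int (d n) = 0" for n
    unfolding d_def US by (rule disc_avg_mean_change[OF Uc Uinv r])
  obtain m where m: "m \<ge> 0" "\<And>z. z \<in> \<H> \<Longrightarrow> norm (d 0 z) \<le> m"
    by (rule bounded_invariant[OF dc, of 0]) (use dinv in auto)
  have dn: "\<bar>d n z\<bar> \<le> \<theta> ^ n * m" if "z \<in> \<H>" for n z
    using that
  proof (induction n arbitrary: z)
    case 0
    then show ?case using m by simp
  next
    case (Suc n)
    have "d (Suc n) z = disc_avg r (d n) z"
      unfolding d_def US by (rule disc_avg_diff[symmetric]) (use Uc r Suc.prems in \<open>auto simp flip: US\<close>)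
    also have "\<bar>\<dots>\<bar> \<le> \<theta> * (\<theta> ^ n * m)"
      by (rule contr[OF dc dinv d0 Suc.IH Suc.prems])
    finally show ?case by (simp add: mult.assoc)
  qed
  define h where "h = (\<lambda>z. u z + suminf (\<lambda>i. d i z))"
  have summ: "summable (\<lambda>n. \<theta> ^ n * m)"
    using \<theta> by (intro summable_mult2 summable_geometric) simp
  have "uniform_limit \<H> (\<lambda>n z. \<Sum>i<n. d i z) (\<lambda>z. suminf (\<lambda>i. d i z)) sequentially"
    by (rule Weierstrass_m_test[OF _ summ]) (use dn in simp)
  then have "uniform_limit \<H> (\<lambda>n z. u z + (\<Sum>i<n. d i z)) (\<lambda>z. u z + suminf (\<lambda>i. d i z)) sequentially"
    by (intro uniform_limit_intros)
  moreover have "u z + (\<Sum>i<n. d i z) = U n z" for n z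
    by (induction n) (auto simp: U0 d_def)
  ultimately have lim: "uniform_limit \<H> U h sequentially"
    by (simp add: h_def)
  have hc: "continuous_on \<H> h"
    by (rule uniform_limit_theorem[OF _ lim]) (auto intro: Uc always_eventually)
  have limz: "(\<lambda>n. U n z) \<longlonglongrightarrow> h z" if "z \<in> \<H>" for z
    using tendsto_uniform_limitI[OF lim that] .
  have hinv: "h (mob A z) = h z + \<rho> A" if A: "A \<in> G" "z \<in> \<H>" for A z
  proof (rule LIMSEQ_unique)
    show "(\<lambda>n. U n (mob A z)) \<longlonglongrightarrow> h (mob A z)"
      using A by (intro limz mob_in_H det_one)
    show "(\<lambda>n. U n (mob A z)) \<longlonglongrightarrow> h z + \<rho> A"
      unfolding Uinv[OF A] by (intro tendsto_intros limz A)
  qed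
  have hr: "disc_avg r h z = h z" if z: "z \<in> \<H>" for z
  proof (rule LIMSEQ_unique)
    show "(\<lambda>n. U (Suc n) z) \<longlonglongrightarrow> h z" using limz[OF z] by (rule LIMSEQ_Suc)
    show "(\<lambda>n. U (Suc n) z) \<longlonglongrightarrow> disc_avg r h z"
    proof (rule metric_LIMSEQ_I)
      fix e :: real assume e: "e > 0"
      then obtain N where N: "\<And>n w. n \<ge> N \<Longrightarrow> w \<in> \<H> \<Longrightarrow> dist (U n w) (h w) < e / 2"
        using uniform_limitD[OF lim, of "e / 2"] by (auto simp: eventually_sequentially)
      show "\<exists>N. \<forall>n\<ge>N. dist (U (Suc n) z) (disc_avg r h z) < e"
      proof (intro exI allI impI)
        fix n assume n: "n \<ge> N"
        have "norm (disc_avg r (\<lambda>w. U n w - h w) z) \<le> e / 2"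
          by (rule norm_disc_avg_le) (use r z e N[OF n] in \<open>auto simp: dist_norm intro: less_imp_le\<close>)
        also have "disc_avg r (\<lambda>w. U n w - h w) z = U (Suc n) z - disc_avg r h z"
          unfolding US by (rule disc_avg_diff) (use r z Uc hc in auto)
        finally show "dist (U (Suc n) z) (disc_avg r h z) < e" using e by (simp add: dist_norm)
      qed
    qed
  qed
  have hs: "disc_avg s h z = h z" if s: "0 < s" "s < 1" and z: "z \<in> \<H>" for s z
  proof -
    have s0: "0 \<le> s" using s by simp
    \<comment> \<open>The defect of \<open>h\<close> at radius \<open>s\<close>. It is invariant and
      of mean zero, and commutation makes it a fixed point of the average of radius
      \<open>r\<close>; the contraction, applied repeatedly, leaves only 0.\<close>
    define f where "f = (\<lambda>z. disc_avg s h z - h z)"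
    have hsc: "continuous_on \<H> (disc_avg s h)" by (rule continuous_on_disc_avg[OF s0 s(2) hc])
    have fc: "continuous_on \<H> f" unfolding f_def by (intro continuous_intros hsc hc)
    have finv: "f (mob A z) = f z" if "A \<in> G" "z \<in> \<H>" for A z
      using disc_avg_equivariant[OF hc hinv s that] hinv[OF that] by (simp add: f_def)
    have f0: "hF_int f = 0" unfolding f_def by (rule disc_avg_mean_change[OF hc hinv s])
    have ffix: "disc_avg r f z = f z" if z: "z \<in> \<H>" for z
    proof -
      have "disc_avg r f z = disc_avg r (disc_avg s h) z - disc_avg r h z"
        unfolding f_def by (rule disc_avg_diff) (use r z hsc hc in auto)
      also have "disc_avg r (disc_avg s h) z = disc_avg s (disc_avg r h) z"
        by (rule disc_avg_commute[OF z r s hc])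
      also have "\<dots> = disc_avg s h z"
        by (rule disc_avg_cong[OF s0 s(2) z]) (rule hr)
      finally show ?thesis using hr[OF z] by (simp add: f_def)
    qed
    obtain M where M: "M \<ge> 0" "\<And>z. z \<in> \<H> \<Longrightarrow> norm (f z) \<le> M"
      by (rule bounded_invariant[OF fc]) (use finv in auto)
    have fn: "\<bar>f z\<bar> \<le> \<theta> ^ n * M" if "z \<in> \<H>" for n z
      using that
    proof (induction n arbitrary: z)
      case 0
      then show ?case using M by simp
    next
      case (Suc n)
      have "\<bar>disc_avg r f z\<bar> \<le> \<theta> * (\<theta> ^ n * M)"
        by (rule contr[OF fc finv f0 Suc.IH Suc.prems])
      then show ?case using ffix[OF Suc.prems] by (simp add: mult.assoc)
    qed
    have "(\<lambda>n. \<theta> ^ n * M) \<longlonglongrightarrow> 0 * M"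
      using \<theta> by (intro tendsto_mult LIMSEQ_power_zero tendsto_const) simp
    then have "\<bar>f z\<bar> \<le> 0 * M"
      by (rule LIMSEQ_le_const) (use fn[OF z] in auto)
    then show ?thesis by (simp add: f_def)
  qed
  show ?thesis by (rule that[OF hc hinv hs])
qed

end

section \<open>Functions with the mean value property\<close>

text \<open>Sums \<open>P(z) + cnj (Q(z))\<close> with polynomials \<open>P\<close>, \<open>Q\<close> form an algebra of functions on the
  circle \<open>\<bar>z\<bar> = R\<close>, because \<open>z * cnj z\<close> is constant there.\<close>

definition harmonic_poly_on :: "complex set \<Rightarrow> (complex \<Rightarrow> complex) \<Rightarrow> bool" where
  "harmonic_poly_on S v \<longleftrightarrow> (\<exists>p q. \<forall>z\<in>S. v z = poly p z + cnj (poly q z))"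

lemma harmonic_poly_onI: "(\<And>z. z \<in> S \<Longrightarrow> v z = poly p z + cnj (poly q z)) \<Longrightarrow> harmonic_poly_on S v"
  unfolding harmonic_poly_on_def by blast

lemma harmonic_poly_on_add:
  assumes "harmonic_poly_on S v" "harmonic_poly_on S w"
  shows "harmonic_poly_on S (\<lambda>z. v z + w z)"
proof -
  obtain p q p' q' where "\<forall>z\<in>S. v z = poly p z + cnj (poly q z)" "\<forall>z\<in>S. w z = poly p' z + cnj (poly q' z)"
    using assms unfolding harmonic_poly_on_def by blast
  then show ?thesis by (intro harmonic_poly_onI[of _ _ "p + p'" "q + q'"]) simp
qed

lemma harmonic_poly_on_cmult:
  assumes "harmonic_poly_on S v"
  shows "harmonic_poly_on S (\<lambda>z. c * v z)"
proof -
  obtain p q where "\<forall>z\<in>S. v z = poly p z + cnj (poly q z)"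
    using assms unfolding harmonic_poly_on_def by blast
  then show ?thesis
    by (intro harmonic_poly_onI[of _ _ "Polynomial.smult c p" "Polynomial.smult (cnj c) q"]) (simp add: algebra_simps)
qed

lemma harmonic_poly_on_cnj:
  assumes "harmonic_poly_on S v"
  shows "harmonic_poly_on S (\<lambda>z. cnj (v z))"
proof -
  obtain p q where "\<forall>z\<in>S. v z = poly p z + cnj (poly q z)"
    using assms unfolding harmonic_poly_on_def by blast
  then show ?thesis by (intro harmonic_poly_onI[of _ _ q p]) simp
qed

lemma harmonic_poly_on_const: "harmonic_poly_on S (\<lambda>z. c)"
  by (rule harmonic_poly_onI[of _ _ "[:c:]" 0]) simp

text \<open>On the circle \<open>z * cnj z = R\<^sup>2\<close> lowers the degree of the
  antiholomorphic part; only its constant term acquires a factor \<open>z\<close>, and it moves to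
  the holomorphic part.\<close>

lemma harmonic_poly_on_times_z:
  assumes "harmonic_poly_on (sphere 0 R) v"
  shows "harmonic_poly_on (sphere 0 R) (\<lambda>z. z * v z)"
proof -
  obtain p q where v: "\<forall>z\<in>sphere 0 R. v z = poly p z + cnj (poly q z)"
    using assms unfolding harmonic_poly_on_def by blast
  obtain a q1 where q: "q = pCons a q1" by (cases q)
  show ?thesis
  proof (rule harmonic_poly_onI[of _ _ "pCons 0 (p + [:cnj a:])" "Polynomial.smult (of_real (R\<^sup>2)) q1"])
    fix z :: complex assume z: "z \<in> sphere 0 R"
    have zz: "z * cnj z = of_real (R\<^sup>2)"
      using z by (simp flip: complex_norm_square)
    have "z * v z = z * poly p z + z * cnj a + (z * cnj z) * cnj (poly q1 z)"
      using v z by (simp add: q algebra_simps)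
    then show "z * v z = poly (pCons 0 (p + [:cnj a:])) z + cnj (poly (Polynomial.smult (of_real (R\<^sup>2)) q1) z)"
      unfolding zz by (simp add: algebra_simps)
  qed
qed

lemma harmonic_poly_on_times_poly:
  assumes v: "harmonic_poly_on (sphere 0 R) v"
  shows "harmonic_poly_on (sphere 0 R) (\<lambda>z. poly p z * v z)"
proof (induction p)
  case 0
  then show ?case using harmonic_poly_on_const[of _ 0] by simp
next
  case (pCons a p)
  have "harmonic_poly_on (sphere 0 R) (\<lambda>z. a * v z + z * (poly p z * v z))"
    by (intro harmonic_poly_on_add harmonic_poly_on_cmult v harmonic_poly_on_times_z pCons)
  then show ?case by (simp add: algebra_simps)
qed

lemma harmonic_poly_on_mult:
  assumes v: "harmonic_poly_on (sphere 0 R) v" and w: "harmonic_poly_on (sphere 0 R) w"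
  shows "harmonic_poly_on (sphere 0 R) (\<lambda>z. v z * w z)"
proof -
  obtain p q where v: "\<forall>z\<in>sphere 0 R. v z = poly p z + cnj (poly q z)"
    using v unfolding harmonic_poly_on_def by blast
  have "harmonic_poly_on (sphere 0 R) (\<lambda>z. poly p z * w z + cnj (poly q z * cnj (w z)))"
    by (intro harmonic_poly_on_add harmonic_poly_on_times_poly harmonic_poly_on_cnj w)
  then obtain p' q' where "\<forall>z\<in>sphere 0 R. poly p z * w z + cnj (poly q z * cnj (w z)) = poly p' z + cnj (poly q' z)"
    unfolding harmonic_poly_on_def by blast
  then show ?thesis using v
    by (intro harmonic_poly_onI[of _ _ p' q']) (simp add: algebra_simps)
qed

lemma harmonic_poly_on_real_polynomial:
  assumes "real_polynomial_function f"
  shows "harmonic_poly_on (sphere 0 R) (\<lambda>z. of_real (f z))"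
  using assms
proof induction
  case (linear f)
  have z: "f z = Re z * f 1 + Im z * f \<i>" for z
  proof -
    have "f (Re z *\<^sub>R 1 + Im z *\<^sub>R \<i>) = Re z * f 1 + Im z * f \<i>"
      using linear by (simp add: linear_simps)
    moreover have "Re z *\<^sub>R 1 + Im z *\<^sub>R \<i> = z" by (simp add: complex_eq_iff)
    ultimately show ?thesis by simp
  qed
  \<comment> \<open>Chosen so that \<open>2 * Re (c * z)\<close> is
    \<open>Re z * f 1 + Im z * f \<i>\<close>.\<close>
  define c where "c = (of_real (f 1) - \<i> * of_real (f \<i>)) / 2"
  show ?case
  proof (rule harmonic_poly_onI[of _ _ "[:0, c:]" "[:0, c:]"])
    fix y :: complex
    show "of_real (f y) = poly [:0, c:] y + cnj (poly [:0, c:] y)"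
      unfolding z[of y] by (simp add: c_def complex_eq_iff diff_divide_distrib)
  qed
next
  case (const c)
  then show ?case by (rule harmonic_poly_on_const)
next
  case (add f g)
  then show ?case using harmonic_poly_on_add by simp
next
  case (mult f g)
  then show ?case using harmonic_poly_on_mult by simp
qed

text \<open>Solves the Dirichlet problem up to \<open>e\<close>. Real polynomials are dense by Stone
  and Weierstrass, on the circle each has the form \<open>P + cnj Q\<close>, and conjugating
  \<open>Q\<close> does not change its real part.\<close>

lemma circle_approximation:
  fixes k :: "complex \<Rightarrow> real"
  assumes k: "continuous_on (sphere 0 R) k" and e: "e > 0"
  obtains p where "\<And>z. z \<in> sphere 0 R \<Longrightarrow> \<bar>k z - Re (poly p z)\<bar> < e"
proof -
  obtain f where f: "real_polynomial_function f" "\<And>z. z \<in> sphere 0 R \<Longrightarrow> \<bar>k z - f z\<bar> < e"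
    using Stone_Weierstrass_real_polynomial_function[OF _ k e] compact_sphere by blast
  obtain p q where pq: "\<forall>z\<in>sphere 0 R. of_real (f z) = poly p z + cnj (poly q z)"
    using harmonic_poly_on_real_polynomial[OF f(1)] unfolding harmonic_poly_on_def by blast
  show ?thesis
  proof (rule that[of "p + q"])
    fix z :: complex assume z: "z \<in> sphere 0 R"
    have "f z = Re (of_real (f z))" by simp
    also have "\<dots> = Re (poly (p + q) z)" using pq z by simp
    finally show "\<bar>k z - Re (poly (p + q) z)\<bar> < e" using f(2)[OF z] by simp
  qed
qed

text \<open>The points of the disc where \<open>g\<close> does not vanish form an open set of
  measure zero, and such a set is empty.\<close>

lemma disc_int_zero_imp:
  fixes g :: "complex \<Rightarrow> real"
  assumes g: "continuous_on (cball 0 1) g" and nn: "\<And>\<eta>. cmod \<eta> < 1 \<Longrightarrow> g \<eta> \<ge> 0"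
    and 0: "disc_int g = 0" and \<eta>: "cmod \<eta> < 1"
  shows "g \<eta> = 0"
proof (rule ccontr)
  assume ne: "g \<eta> \<noteq> 0"
  have gb: "continuous_on (ball 0 1) g" using g by (rule continuous_on_subset) auto
  let ?S = "ball 0 1 \<inter> g -` (- {0})"
  have op: "open ?S" by (rule continuous_open_preimage[OF gb]) auto
  have "(\<integral>\<^sup>+\<eta>. ennreal (if cmod \<eta> < 1 then g \<eta> else 0) \<partial>unit_disc_measure) = 0"
    using ennreal_disc_int[OF g nn] 0 by simp
  moreover have m: "(\<lambda>\<eta>. if \<eta> \<in> ball 0 1 then g \<eta> else 0) \<in> borel_measurable borel"
    using gb by (intro borel_measurable_continuous_on_if) auto
  ultimately have "AE \<eta> in unit_disc_measure. \<eta> \<notin> ?S"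
    using nn by (subst (asm) nn_integral_0_iff_AE) (auto elim!: eventually_mono simp: order_antisym split: if_splits)
  then have "AE \<eta> in lborel. \<eta> \<in> ball 0 1 \<longrightarrow> \<eta> \<notin> ?S"
    unfolding unit_disc_measure_def using disc_area_pos
    by (subst (asm) AE_uniform_measure) (auto simp: emeasure_disc)
  then have "AE \<eta> in lborel. \<eta> \<notin> ?S" by (auto elim!: eventually_mono)
  then have "?S \<in> null_sets lborel"
    using op by (subst AE_iff_null_sets) auto
  then have "negligible ?S"
    by (simp add: negligible_iff_null_sets null_sets_completionI)
  then have "?S = {}" using open_not_negligible[OF op] by blast
  then show False using \<eta> ne by auto
qed

text \<open>If the maximum over the closed disc exceeded \<open>M\<close>, it would be attained only
  inside. There the mean value property over a small disc forces \<open>v\<close> to be maximal on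
  that whole disc.\<close>

lemma disc_avg_maximum_principle:
  fixes v :: "complex \<Rightarrow> real"
  assumes cont: "continuous_on \<H> v"
    and mv: "\<And>s z. 0 < s \<Longrightarrow> s < 1 \<Longrightarrow> z \<in> \<H> \<Longrightarrow> disc_avg s v z = v z"
    and z0: "z0 \<in> \<H>" and R: "0 < R" "R < 1"
    and bd: "\<And>\<zeta>. cmod \<zeta> = R \<Longrightarrow> v (disc_to_H z0 \<zeta>) \<le> M"
    and \<zeta>: "cmod \<zeta> \<le> R"
  shows "v (disc_to_H z0 \<zeta>) \<le> M"
proof -
  define D where "D = disc_to_H z0 ` cball 0 R"
  have chol: "continuous_on (cball 0 R) (disc_to_H z0)"
    using disc_to_H_holomorphic R by (intro holomorphic_on_imp_continuous_on) (auto intro: holomorphic_on_subset[OF disc_to_H_holomorphic])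
  have DH: "D \<subseteq> \<H>" using disc_to_H_in_H[OF z0] R by (auto simp: D_def)
  have Dc: "compact D" unfolding D_def by (rule compact_continuous_image[OF chol]) simp
  have Dne: "D \<noteq> {}" using R by (auto simp: D_def)
  have vD: "continuous_on D v" using cont DH by (rule continuous_on_subset)
  obtain w1 where w1: "w1 \<in> D" "\<forall>w\<in>D. v w \<le> v w1"
    using continuous_attains_sup[OF Dc Dne vD] by blast
  define E where "E = D \<inter> v -` {v w1}"
  have "closed E" unfolding E_def using Dc vD
    by (intro continuous_closed_preimage) (auto intro: compact_imp_closed)
  then have Ec: "compact E"
    using Dc by (metis E_def Int_absorb1 Int_lower1 compact_Int_closed)
  have "w1 \<in> E" using w1 by (simp add: E_def)
  \<comment> \<open>Among the maximum points, one farthest to the right: the small disc about it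
    consists of maximum points but reaches farther right. This takes the place of a connectedness
    argument.\<close>
  then obtain w where w: "w \<in> E" "\<forall>x\<in>E. Re x \<le> Re w"
    using continuous_attains_sup[OF Ec _ continuous_on_Re[OF continuous_on_id]] by blast
  have wH: "w \<in> \<H>" and wD: "w \<in> D" and vw: "v w = v w1" using w DH by (auto simp: E_def)
  have "v w \<le> M"
  proof (rule ccontr)
    assume "\<not> v w \<le> M"
    obtain \<zeta>w where zw: "w = disc_to_H z0 \<zeta>w" "cmod \<zeta>w \<le> R" using wD by (auto simp: D_def)
    have "cmod \<zeta>w \<noteq> R" using bd[of \<zeta>w] \<open>\<not> v w \<le> M\<close> zw by auto
    then have zwR: "cmod \<zeta>w < R" using zw by simp
    have opB: "open (disc_to_H z0 ` ball 0 R)"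
      by (rule open_mapping_thm3)
         (use R in \<open>auto intro: holomorphic_on_subset[OF disc_to_H_holomorphic] inj_on_subset[OF inj_on_disc_to_H[OF z0]]\<close>)
    have "w \<in> disc_to_H z0 ` ball 0 R" using zw zwR by auto
    moreover have "isCont (disc_to_H w) 0"
      by (rule DERIV_isCont[OF disc_to_H_has_field_derivative]) simp
    ultimately have "\<forall>\<^sub>F \<zeta> in at 0. disc_to_H w \<zeta> \<in> disc_to_H z0 ` ball 0 R"
      using opB by (intro topological_tendstoD[where l=w]) (auto simp: isCont_def)
    then obtain d where d: "d > 0" "\<And>\<zeta>. \<zeta> \<noteq> 0 \<Longrightarrow> cmod \<zeta> < d \<Longrightarrow> disc_to_H w \<zeta> \<in> disc_to_H z0 ` ball 0 R"
      by (auto simp: eventually_at)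
    define s where "s = min (d / 2) (1 / 2)"
    have s: "0 < s" "s < 1" "s < d" "0 \<le> s" using d by (auto simp: s_def)
    have inD: "chart s w \<eta> \<in> D" if "cmod \<eta> < 1" for \<eta>
    proof (cases "\<eta> = 0")
      case True
      then show ?thesis using wD by simp
    next
      case False
      have "cmod (of_real s * \<eta>) \<le> s * 1" using that s by (simp add: norm_mult mult_left_le)
      then have "chart s w \<eta> \<in> disc_to_H z0 ` ball 0 R" using s False by (intro d) auto
      then show ?thesis by (auto simp: D_def)
    qed
    have cv: "continuous_on (cball 0 1) (\<lambda>\<eta>. v (chart s w \<eta>))"
      by (rule continuous_on_compose_chart[OF s(4,2) cont wH])
    have "disc_int (\<lambda>\<eta>. v w - v (chart s w \<eta>)) = v w - disc_avg s v w"
      using disc_int_diff[OF _ cv, of "\<lambda>_. v w"] by (simp add: disc_avg_def)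
    also have "\<dots> = 0" using mv[OF s(1,2) wH] by simp
    finally have 0: "disc_int (\<lambda>\<eta>. v w - v (chart s w \<eta>)) = 0" .
    \<comment> \<open>The derivative of the chart at 0 is \<open>2 * \<i> * Im w\<close>, so the
      direction \<open>- \<i>\<close> points to the right.\<close>
    define \<eta> where "\<eta> = - (\<i> / 2)"
    have \<eta>1: "cmod \<eta> < 1" by (simp add: \<eta>_def norm_divide)
    have "v w - v (chart s w \<eta>) = 0"
      by (rule disc_int_zero_imp[OF _ _ 0 \<eta>1])
         (use cv w1 inD vw in \<open>auto intro!: continuous_intros\<close>)
    then have "chart s w \<eta> \<in> E" using inD[OF \<eta>1] vw by (auto simp: E_def)
    then have le: "Re (chart s w \<eta>) \<le> Re w" using w by blast
    define t where "t = s / 2"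
    have t: "t > 0" using s by (simp add: t_def)
    have ce: "chart s w \<eta> = (w + \<i> * of_real t * cnj w) / (1 + \<i> * of_real t)"
      by (simp add: disc_to_H_def \<eta>_def t_def algebra_simps)
    have nz: "1 + \<i> * of_real t \<noteq> 0" by (simp add: complex_eq_iff)
    have "chart s w \<eta> - w = of_real (2 * Im w * t) / (1 + \<i> * of_real t)"
    proof -
      have "chart s w \<eta> - w = (w + \<i> * of_real t * cnj w - w * (1 + \<i> * of_real t)) / (1 + \<i> * of_real t)"
        unfolding ce using nz by (simp add: diff_divide_distrib)
      also have "w + \<i> * of_real t * cnj w - w * (1 + \<i> * of_real t) = of_real (2 * Im w * t)"
        by (simp add: complex_eq_iff algebra_simps)
      finally show ?thesis .
    qed
    then have "Re (chart s w \<eta> - w) = 2 * Im w * t / (1 + t\<^sup>2)"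
      by (simp add: Re_divide power2_eq_square)
    moreover have "2 * Im w * t / (1 + t\<^sup>2) > 0"
      using t wH by (intro divide_pos_pos add_pos_nonneg) auto
    ultimately show False using le by simp
  qed
  then show ?thesis using w1 vw \<zeta> by (force simp: D_def)
qed

text \<open>Cauchy's inequality for \<open>exp (f / M)\<close>, whose modulus only involves \<open>Re f\<close>.\<close>

lemma deriv_bound_of_Re_bound:
  assumes f: "f holomorphic_on ball z r" and r: "r > 0" and M: "M > 0"
    and bd: "\<And>w. w \<in> ball z r \<Longrightarrow> \<bar>Re (f w)\<bar> \<le> M"
  shows "cmod (deriv f z) \<le> M * exp 2 / (r / 2)"
proof -
  define g where "g = (\<lambda>w. exp (f w / of_real M))"
  have gh: "g holomorphic_on ball z r" unfolding g_def using f M by (intro holomorphic_intros) auto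
  have gb: "cmod (g w) \<le> exp 1" if "w \<in> ball z r" for w
    using bd[OF that] M by (simp add: g_def abs_le_iff divide_le_eq)
  have "cmod ((deriv ^^ 1) g z) \<le> fact 1 * exp 1 / (r / 2) ^ 1"
  proof (rule Cauchy_inequality)
    show "g holomorphic_on ball z (r / 2)" using gh r by (rule_tac holomorphic_on_subset) auto
    show "continuous_on (cball z (r / 2)) g"
      using gh r by (intro holomorphic_on_imp_continuous_on) (auto intro: holomorphic_on_subset)
    show "norm (g x) \<le> exp 1" if "norm (z - x) = r / 2" for x
      by (rule gb) (use that r in \<open>auto simp: dist_norm\<close>)
  qed (use r in simp)
  then have gd: "cmod (deriv g z) \<le> exp 1 / (r / 2)" by simp
  have zb: "z \<in> ball z r" using r by simp
  have "(f has_field_derivative deriv f z) (at z)"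
    using f zb holomorphic_derivI open_ball by blast
  then have "(g has_field_derivative exp (f z / of_real M) * (deriv f z / of_real M)) (at z)"
    unfolding g_def using M by (auto intro!: derivative_eq_intros)
  then have "deriv g z = exp (f z / of_real M) * (deriv f z / of_real M)"
    by (rule DERIV_imp_deriv)
  then have "cmod (deriv g z) = exp (Re (f z) / M) * (cmod (deriv f z) / M)"
    using M by (simp add: norm_mult norm_divide)
  moreover have "exp (Re (f z) / M) \<ge> exp (- 1)"
    using bd[OF zb] M by (simp add: abs_le_iff le_divide_eq)
  then have "exp (- 1) * (cmod (deriv f z) / M) \<le> exp (Re (f z) / M) * (cmod (deriv f z) / M)"
    using M by (intro mult_right_mono) auto
  ultimately have "exp (- 1) * (cmod (deriv f z) / M) \<le> exp 1 / (r / 2)" using gd by linarith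
  then have "exp 1 * (exp (- 1) * (cmod (deriv f z) / M)) \<le> exp 1 * (exp 1 / (r / 2))"
    by (intro mult_left_mono) auto
  then have "cmod (deriv f z) / M \<le> exp 2 / (r / 2)"
    by (simp flip: mult.assoc exp_add)
  then show ?thesis using M by (simp add: divide_le_eq mult_ac)
qed

text \<open>Small real parts of differences give small derivatives on the disc of half the radius,
  so the functions themselves are uniformly Cauchy once their additive constants are
  controlled.\<close>

lemma Re_uniform_limit_holomorphic:
  fixes p :: "nat \<Rightarrow> complex \<Rightarrow> complex"
  assumes p: "\<And>n. p n holomorphic_on ball 0 R" and R: "R > 0"
    and lim: "uniform_limit (ball 0 R) (\<lambda>n z. Re (p n z)) k sequentially"
  obtains Q where "Q holomorphic_on ball 0 (R / 2)" "\<And>z. z \<in> ball 0 (R / 2) \<Longrightarrow> k z = Re (Q z)"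
proof -
  \<comment> \<open>Real parts determine a holomorphic function only up to an imaginary constant; it
    is fixed by making the value at 0 real.\<close>
  define q where "q n z = p n z - \<i> * of_real (Im (p n 0))" for n z
  have qh: "q n holomorphic_on ball 0 R" for n
    unfolding q_def by (intro holomorphic_intros p)
  have Req: "Re (q n z) = Re (p n z)" for n z by (simp add: q_def)
  \<comment> \<open>In units of \<open>M\<close>, the summand 1 bounds \<open>D 0\<close>, and the
    other one is a derivative bound times a distance below \<open>R\<close>. The number
    \<open>R / 4\<close> is half the radius \<open>R / 2\<close> of a disc about a point of the
    smaller disc.\<close>
  define C where "C = 1 + R * (exp 2 / (R / 4))"
  have C: "C > 0" unfolding C_def using R by (intro add_pos_nonneg) auto
  have "uniformly_Cauchy_on (ball 0 (R / 2)) q"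
  proof (rule uniformly_Cauchy_onI)
    fix e :: real assume e: "e > 0"
    define M where "M = e / (2 * C)"
    have M: "M > 0" using e C by (simp add: M_def)
    have "\<forall>\<^sub>F n in sequentially. \<forall>x\<in>ball 0 R. dist (Re (p n x)) (k x) < M / 2"
      using uniform_limitD[OF lim, of "M / 2"] M by simp
    then obtain N where N: "\<And>n x. n \<ge> N \<Longrightarrow> x \<in> ball 0 R \<Longrightarrow> dist (Re (p n x)) (k x) < M / 2"
      unfolding eventually_sequentially by blast
    show "\<exists>N. \<forall>x\<in>ball 0 (R / 2). \<forall>m\<ge>N. \<forall>n\<ge>N. dist (q m x) (q n x) < e"
    proof (intro exI ballI allI impI)
      fix x m n assume x: "x \<in> ball (0::complex) (R / 2)" and m: "m \<ge> N" and n: "n \<ge> N"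
      define D where "D = (\<lambda>z. q m z - q n z)"
      have Dh: "D holomorphic_on ball 0 R" unfolding D_def by (intro holomorphic_intros qh)
      have DR: "\<bar>Re (D z)\<bar> \<le> M" if "z \<in> ball 0 R" for z
      proof -
        have "dist (Re (p m z)) (Re (p n z)) \<le> M / 2 + M / 2"
          using N[OF m that] N[OF n that] dist_triangle2[of "Re (p m z)" "Re (p n z)" "k z"] by linarith
        then show ?thesis by (simp add: D_def Req dist_real_def)
      qed
      have Dd: "cmod (deriv D z) \<le> M * exp 2 / (R / 4)" if z: "z \<in> ball 0 (R / 2)" for z
      proof -
        have sub: "ball z (R / 2) \<subseteq> ball 0 R"
        proof
          fix y assume "y \<in> ball z (R / 2)"
          then show "y \<in> ball 0 R" using z dist_triangle[of 0 y z] by simp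
        qed
        have "cmod (deriv D z) \<le> M * exp 2 / ((R / 2) / 2)"
          by (rule deriv_bound_of_Re_bound[OF holomorphic_on_subset[OF Dh sub]])
             (use R M DR sub in auto)
        then show ?thesis by simp
      qed
      have "cmod (D x - D 0) \<le> M * exp 2 / (R / 4) * cmod (x - 0)"
      proof (rule field_differentiable_bound[OF convex_ball])
        fix z :: complex assume z: "z \<in> ball 0 (R / 2)"
        then have "z \<in> ball 0 R" using R by simp
        then show "(D has_field_derivative deriv D z) (at z within ball 0 (R / 2))"
          using holomorphic_derivI[OF Dh open_ball] by blast
      qed (use Dd x R in auto)
      also have "\<dots> \<le> M * exp 2 / (R / 4) * R"
        using x R M by (intro mult_left_mono) auto
      finally have 1: "cmod (D x - D 0) \<le> M * (R * (exp 2 / (R / 4)))"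
        using R by (simp add: mult_ac split: if_splits)
      have "D 0 = of_real (Re (D 0))" by (simp add: D_def q_def complex_eq_iff)
      then have "cmod (D 0) = \<bar>Re (D 0)\<bar>" by (metis norm_of_real)
      then have 2: "cmod (D 0) \<le> M" using DR[of 0] R by simp
      have "cmod (D x) \<le> cmod (D x - D 0) + cmod (D 0)" using norm_triangle_sub[of "D x" "D 0"] by simp
      also have "\<dots> \<le> M * C" using 1 2 by (simp add: C_def algebra_simps)
      also have "\<dots> = e / 2" using C by (simp add: M_def)
      also have "\<dots> < e" using e by simp
      finally show "dist (q m x) (q n x) < e" by (simp add: D_def dist_norm)
    qed
  qed
  then have "uniformly_convergent_on (ball 0 (R / 2)) q" by (rule Cauchy_uniformly_convergent)
  then obtain Q where Q: "uniform_limit (ball 0 (R / 2)) q Q sequentially"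
    unfolding uniformly_convergent_on_def by blast
  show ?thesis
  proof (rule that[of Q])
    show "Q holomorphic_on ball 0 (R / 2)"
    proof (rule holomorphic_uniform_sequence[OF open_ball])
      show "q n holomorphic_on ball 0 (R / 2)" for n
        by (rule holomorphic_on_subset[OF qh]) (use R in auto)
      fix x assume "x \<in> ball (0::complex) (R / 2)"
      then obtain d where "d > 0" "cball x d \<subseteq> ball 0 (R / 2)"
        using open_contains_cball[of "ball (0::complex) (R / 2)"] open_ball by blast
      then show "\<exists>d>0. cball x d \<subseteq> ball 0 (R / 2) \<and> uniform_limit (cball x d) q Q sequentially"
        using uniform_limit_on_subset[OF Q] by blast
    qed
    fix z assume z: "z \<in> ball (0::complex) (R / 2)"
    then have z': "z \<in> ball 0 R" using R by simp
    show "k z = Re (Q z)"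
    proof (rule LIMSEQ_unique)
      show "(\<lambda>n. Re (p n z)) \<longlonglongrightarrow> k z" by (rule tendsto_uniform_limitI[OF lim z'])
      show "(\<lambda>n. Re (p n z)) \<longlonglongrightarrow> Re (Q z)"
        unfolding Req[symmetric] by (intro tendsto_Re tendsto_uniform_limitI[OF Q z])
    qed
  qed
qed

lemma disc_avg_Re:
  assumes "0 \<le> s" "s < 1" "z \<in> \<H>" "continuous_on \<H> W"
  shows "disc_avg s (\<lambda>w. Re (W w)) z = Re (disc_avg s W z)"
proof -
  have "set_integrable unit_disc_measure (ball 0 1) (\<lambda>\<eta>. W (chart s z \<eta>))"
    by (intro set_integrable_disc continuous_on_compose_chart assms)
  then show ?thesis
    unfolding disc_avg_def set_lebesgue_integral_def set_integrable_def
    by (subst integral_Re[symmetric]) auto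
qed

text \<open>In the chart at \<open>z0\<close>, \<open>h\<close> is approximated on a circle by real
  parts of polynomials. The maximum principle for both signs of the error carries the approximation
  to the interior, and a limit of real parts of holomorphic functions is again of this kind.\<close>

lemma mean_value_locally_Re_holomorphic:
  fixes h :: "complex \<Rightarrow> real"
  assumes cont: "continuous_on \<H> h"
    and mv: "\<And>s z. 0 < s \<Longrightarrow> s < 1 \<Longrightarrow> z \<in> \<H> \<Longrightarrow> disc_avg s h z = h z"
    and z0: "z0 \<in> \<H>"
  obtains N Q where "open N" "z0 \<in> N" "N \<subseteq> \<H>" "Q holomorphic_on N" "\<And>z. z \<in> N \<Longrightarrow> h z = Re (Q z)"
proof -
  define R :: real where "R = 1 / 2"
  have R: "0 < R" "R < 1" by (auto simp: R_def)
  define k where "k = (\<lambda>\<zeta>. h (disc_to_H z0 \<zeta>))"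
  have kc: "continuous_on (cball 0 R) k"
    unfolding k_def
  proof (rule continuous_on_compose2[OF cont])
    show "continuous_on (cball 0 R) (disc_to_H z0)"
      using R by (intro holomorphic_on_imp_continuous_on) (auto intro: holomorphic_on_subset[OF disc_to_H_holomorphic])
  qed (use disc_to_H_in_H[OF z0] R in auto)
  have "\<exists>P. \<forall>\<zeta>\<in>cball 0 R. \<bar>k \<zeta> - Re (poly P \<zeta>)\<bar> \<le> e" if e: "e > 0" for e
  proof -
    have "continuous_on (sphere 0 R) k" using kc by (rule continuous_on_subset) auto
    then obtain P where P: "\<And>z. z \<in> sphere 0 R \<Longrightarrow> \<bar>k z - Re (poly P z)\<bar> < e"
      using circle_approximation e by blast
    \<comment> \<open>A polynomial in the chart coordinate is holomorphic on all of \<H>, so its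
      real part, and with it the error, has the mean value property for every centre and
      radius.\<close>
    define W where "W = (\<lambda>w. poly P (H_to_disc z0 w))"
    have "(poly P \<circ> H_to_disc z0) holomorphic_on \<H>"
      by (rule holomorphic_on_compose[OF H_to_disc_holomorphic[OF z0]]) (intro holomorphic_intros)
    then have Wh: "W holomorphic_on \<H>" by (simp add: W_def o_def)
    have Wc: "continuous_on \<H> W" by (rule holomorphic_on_imp_continuous_on[OF Wh])
    have Wm: "disc_avg s (\<lambda>w. Re (W w)) z = Re (W z)" if "0 < s" "s < 1" "z \<in> \<H>" for s z
      using disc_avg_Re[of s z W] disc_avg_holomorphic[of s z W] that Wc Wh by simp
    have WP: "W (disc_to_H z0 \<zeta>) = poly P \<zeta>" if "cmod \<zeta> \<le> R" for \<zeta>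
    proof -
      have "\<zeta> \<noteq> 1" using that R by auto
      then show ?thesis using disc_to_H_to_disc[of z0 \<zeta>] z0 by (simp add: W_def)
    qed
    have 1: "h (disc_to_H z0 \<zeta>) - Re (W (disc_to_H z0 \<zeta>)) \<le> e" if "cmod \<zeta> \<le> R" for \<zeta>
    proof (rule disc_avg_maximum_principle[OF _ _ z0 R _ that])
      show "continuous_on \<H> (\<lambda>w. h w - Re (W w))" by (intro continuous_intros cont Wc)
      show "disc_avg s (\<lambda>w. h w - Re (W w)) z = h z - Re (W z)" if "0 < s" "s < 1" "z \<in> \<H>" for s z
      proof -
        have "disc_avg s (\<lambda>w. h w - Re (W w)) z = disc_avg s h z - disc_avg s (\<lambda>w. Re (W w)) z"
          by (rule disc_avg_diff) (use that cont Wc in \<open>auto intro!: continuous_intros\<close>)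
        then show ?thesis using mv Wm that by simp
      qed
      show "h (disc_to_H z0 \<zeta>) - Re (W (disc_to_H z0 \<zeta>)) \<le> e" if "cmod \<zeta> = R" for \<zeta>
        using P[of \<zeta>] WP[of \<zeta>] that by (simp add: k_def abs_less_iff)
    qed
    have 2: "Re (W (disc_to_H z0 \<zeta>)) - h (disc_to_H z0 \<zeta>) \<le> e" if "cmod \<zeta> \<le> R" for \<zeta>
    proof (rule disc_avg_maximum_principle[OF _ _ z0 R _ that])
      show "continuous_on \<H> (\<lambda>w. Re (W w) - h w)" by (intro continuous_intros cont Wc)
      show "disc_avg s (\<lambda>w. Re (W w) - h w) z = Re (W z) - h z" if "0 < s" "s < 1" "z \<in> \<H>" for s z
      proof -
        have "disc_avg s (\<lambda>w. Re (W w) - h w) z = disc_avg s (\<lambda>w. Re (W w)) z - disc_avg s h z"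
          by (rule disc_avg_diff) (use that cont Wc in \<open>auto intro!: continuous_intros\<close>)
        then show ?thesis using mv Wm that by simp
      qed
      show "Re (W (disc_to_H z0 \<zeta>)) - h (disc_to_H z0 \<zeta>) \<le> e" if "cmod \<zeta> = R" for \<zeta>
        using P[of \<zeta>] WP[of \<zeta>] that by (simp add: k_def abs_less_iff)
    qed
    show ?thesis
      using 1 2 WP by (intro exI[of _ P]) (auto simp: k_def abs_le_iff)
  qed
  then have "\<forall>n. \<exists>P. \<forall>\<zeta>\<in>cball 0 R. \<bar>k \<zeta> - Re (poly P \<zeta>)\<bar> \<le> inverse (real (Suc n))"
    by simp
  then obtain P where P: "\<And>n \<zeta>. \<zeta> \<in> cball 0 R \<Longrightarrow> \<bar>k \<zeta> - Re (poly (P n) \<zeta>)\<bar> \<le> inverse (real (Suc n))"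
    by metis
  have "uniform_limit (ball 0 R) (\<lambda>n z. Re (poly (P n) z)) k sequentially"
  proof (rule uniform_limitI)
    fix e :: real assume "e > 0"
    then obtain N where N: "inverse (real (Suc N)) < e" using reals_Archimedean by blast
    have "dist (Re (poly (P n) z)) (k z) < e" if "n \<ge> N" "z \<in> ball 0 R" for n z
    proof -
      have "\<bar>k z - Re (poly (P n) z)\<bar> \<le> inverse (real (Suc n))" using P that by simp
      also have "\<dots> \<le> inverse (real (Suc N))" using that by (intro le_imp_inverse_le) auto
      finally show ?thesis using N by (simp add: dist_real_def abs_minus_commute)
    qed
    then show "\<forall>\<^sub>F n in sequentially. \<forall>z\<in>ball 0 R. dist (Re (poly (P n) z)) (k z) < e"
      unfolding eventually_sequentially by blast
  qed
  then obtain Q where Q: "Q holomorphic_on ball 0 (R / 2)" "\<And>z. z \<in> ball 0 (R / 2) \<Longrightarrow> k z = Re (Q z)"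
    by (rule Re_uniform_limit_holomorphic[rotated 2]) (use R in \<open>auto intro!: holomorphic_intros\<close>)
  define N where "N = \<H> \<inter> H_to_disc z0 -` ball 0 (R / 2)"
  show ?thesis
  proof (rule that[of N "Q \<circ> H_to_disc z0"])
    show "open N" unfolding N_def
      by (intro continuous_open_preimage holomorphic_on_imp_continuous_on H_to_disc_holomorphic z0) auto
    show "z0 \<in> N" using z0 R by (simp add: N_def H_to_disc_def)
    show "N \<subseteq> \<H>" by (auto simp: N_def)
    show "(Q \<circ> H_to_disc z0) holomorphic_on N"
      by (rule holomorphic_on_compose_gen[OF holomorphic_on_subset[OF H_to_disc_holomorphic[OF z0]] Q(1)])
         (auto simp: N_def)
    fix z assume z: "z \<in> N"
    then have "disc_to_H z0 (H_to_disc z0 z) = z"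
      using z0 by (intro H_to_disc_to_H) (auto simp: N_def)
    then show "h z = Re ((Q \<circ> H_to_disc z0) z)"
      using Q(2)[of "H_to_disc z0 z"] z by (simp add: k_def N_def)
  qed
qed

text \<open>The local functions \<open>Q\<close> match only up to imaginary constants, but their
  derivatives are determined by \<open>h\<close>. These are glued, and the result has a primitive
  because \<H> is convex.\<close>

lemma mean_value_Re_holomorphic:
  fixes h :: "complex \<Rightarrow> real"
  assumes cont: "continuous_on \<H> h"
    and mv: "\<And>s z. 0 < s \<Longrightarrow> s < 1 \<Longrightarrow> z \<in> \<H> \<Longrightarrow> disc_avg s h z = h z"
  obtains W where "W holomorphic_on \<H>" "\<And>z. z \<in> \<H> \<Longrightarrow> h z = Re (W z)"
proof -
  \<comment> \<open>If \<open>h = Re Q\<close>, the Cauchy-Riemann equations give the derivative of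
    \<open>Q\<close> as the x-derivative of \<open>h\<close> minus \<i> times its
    y-derivative.\<close>
  define \<omega> where "\<omega> = (\<lambda>z. Complex (frechet_derivative h (at z) 1) (- frechet_derivative h (at z) \<i>))"
  have der: "(h has_derivative (\<lambda>v. Re (deriv Q z * v))) (at z)"
    if N: "open N" "z \<in> N" "Q holomorphic_on N" "\<And>z. z \<in> N \<Longrightarrow> h z = Re (Q z)" for N Q z
  proof -
    have "(Q has_derivative (\<lambda>v. deriv Q z * v)) (at z)"
      using holomorphic_derivI[OF N(3,1,2)] by (simp add: has_field_derivative_def)
    then have "((\<lambda>z. Re (Q z)) has_derivative (\<lambda>v. Re (deriv Q z * v))) (at z)"
      by (rule bounded_linear.has_derivative[OF bounded_linear_Re])
    then show ?thesis
      by (rule has_derivative_transform_within_open[OF _ N(1,2)]) (simp add: N(4))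
  qed
  have \<omega>Q: "\<omega> z = deriv Q z"
    if N: "open N" "z \<in> N" "Q holomorphic_on N" "\<And>z. z \<in> N \<Longrightarrow> h z = Re (Q z)" for N Q z
  proof -
    have "frechet_derivative h (at z) = (\<lambda>v. Re (deriv Q z * v))"
      using frechet_derivative_at[OF der[OF N]] by simp
    then show ?thesis by (simp add: \<omega>_def complex_eq_iff)
  qed
  have loc: "\<exists>N Q. open N \<and> z \<in> N \<and> Q holomorphic_on N \<and> (\<forall>z\<in>N. h z = Re (Q z))" if "z \<in> \<H>" for z
  proof (rule mean_value_locally_Re_holomorphic[OF cont _ that])
    show "disc_avg s h z = h z" if "0 < s" "s < 1" "z \<in> \<H>" for s z by (rule mv) fact+
  qed blast
  have \<omega>h: "\<omega> holomorphic_on \<H>"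
  proof (rule holomorphic_onI)
    fix z assume "z \<in> \<H>"
    then obtain N Q where N: "open N" "z \<in> N" "Q holomorphic_on N" "\<And>z. z \<in> N \<Longrightarrow> h z = Re (Q z)"
      using loc[of z] by blast
    have "deriv Q holomorphic_on N" by (rule holomorphic_deriv[OF N(3,1)])
    then have "\<omega> holomorphic_on N"
      by (rule holomorphic_transform) (use \<omega>Q[OF N(1) _ N(3,4)] in simp)
    then have "\<omega> field_differentiable at z"
      by (rule holomorphic_on_imp_differentiable_at[OF _ N(1,2)])
    then show "\<omega> field_differentiable at z within \<H>"
      by (rule field_differentiable_at_within)
  qed
  obtain W where W: "\<And>z. z \<in> \<H> \<Longrightarrow> (W has_field_derivative \<omega> z) (at z within \<H>)"
    using holomorphic_convex_primitive'[OF convex_H open_H \<omega>h] by blast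
  have "\<exists>c. \<forall>z\<in>\<H>. h z - Re (W z) = c"
  proof (rule has_derivative_zero_constant[OF convex_H])
    fix z assume z: "z \<in> \<H>"
    obtain N Q where N: "open N" "z \<in> N" "Q holomorphic_on N" "\<And>z. z \<in> N \<Longrightarrow> h z = Re (Q z)"
      using loc[OF z] by blast
    have "((\<lambda>z. Re (W z)) has_derivative (\<lambda>v. Re (\<omega> z * v))) (at z within \<H>)"
      using W[OF z] unfolding has_field_derivative_def
      by (rule bounded_linear.has_derivative[OF bounded_linear_Re])
    then have "((\<lambda>z. h z - Re (W z)) has_derivative (\<lambda>v. Re (deriv Q z * v) - Re (\<omega> z * v))) (at z within \<H>)"
      by (intro has_derivative_diff has_derivative_at_withinI[OF der[OF N]])
    then show "((\<lambda>z. h z - Re (W z)) has_derivative (\<lambda>v. 0)) (at z within \<H>)"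
      by (simp add: \<omega>Q[OF N])
  qed
  then obtain c where c: "\<And>z. z \<in> \<H> \<Longrightarrow> h z - Re (W z) = c" by blast
  show ?thesis
  proof (rule that[of "\<lambda>z. W z + of_real c"])
    show "(\<lambda>z. W z + of_real c) holomorphic_on \<H>"
      using W by (intro holomorphic_intros) (auto simp: holomorphic_on_def field_differentiable_def)
    show "h z = Re (W z + of_real c)" if "z \<in> \<H>" for z
      using c[OF that] by simp
  qed
qed

section \<open>The energy pairing\<close>

lemma set_integral_bounded_convergence:
  fixes f :: "nat \<Rightarrow> complex \<Rightarrow> 'b::{banach, second_countable_topology}"
  assumes M: "finite_measure M" "sets M = sets borel" and S: "S \<in> sets borel"
    and f: "\<And>n. continuous_on S (f n)" and g: "continuous_on S g"
    and B: "\<And>n x. x \<in> S \<Longrightarrow> norm (f n x) \<le> B"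
    and lim: "\<And>x. x \<in> S \<Longrightarrow> (\<lambda>n. f n x) \<longlonglongrightarrow> g x"
  shows "(\<lambda>n. LINT x:S|M. f n x) \<longlonglongrightarrow> (LINT x:S|M. g x)"
  unfolding set_lebesgue_integral_def
proof (rule integral_dominated_convergence[where w="\<lambda>_. max 0 B"])
  have m: "k \<in> borel_measurable M" if "k \<in> borel_measurable borel" for k :: "complex \<Rightarrow> 'b"
    using that by (simp add: measurable_cong_sets[OF M(2) refl])
  show "(\<lambda>x. indicator S x *\<^sub>R g x) \<in> borel_measurable M"
    "\<And>n. (\<lambda>x. indicator S x *\<^sub>R f n x) \<in> borel_measurable M"
    by (intro m borel_measurable_continuous_on_indicator S f g)+
  show "integrable M (\<lambda>_. max 0 B)" by (rule finite_measure.integrable_const[OF M(1)])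
  show "AE x in M. (\<lambda>n. indicator S x *\<^sub>R f n x) \<longlonglongrightarrow> indicator S x *\<^sub>R g x"
    by (rule AE_I2) (auto simp: indicator_def lim)
  show "AE x in M. norm (indicator S x *\<^sub>R f n x) \<le> max 0 B" for n
    using B[of _ n] by (intro AE_I2) (auto simp: indicator_def le_max_iff_disj)
qed

lemma has_derivative_directional_limit:
  fixes f :: "'a::real_normed_vector \<Rightarrow> 'b::real_normed_vector"
  assumes "(f has_derivative D) (at x)"
  shows "((\<lambda>s. (1 / s) *\<^sub>R (f (x + s *\<^sub>R v) - f x)) \<longlongrightarrow> D v) (at (0::real))"
proof -
  have lin: "linear D" using assms has_derivative_linear by blast
  have "((\<lambda>s. x + s *\<^sub>R v) has_derivative (\<lambda>s. s *\<^sub>R v)) (at (0::real))"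
    by (auto intro!: derivative_eq_intros)
  moreover have "(f has_derivative D) (at (x + 0 *\<^sub>R v))" using assms by simp
  ultimately have "((\<lambda>s. f (x + s *\<^sub>R v)) has_derivative (\<lambda>s. D (s *\<^sub>R v))) (at (0::real))"
    by (rule has_derivative_compose)
  then have "((\<lambda>s. norm (f (x + s *\<^sub>R v) - f x - s *\<^sub>R D v) / norm s) \<longlongrightarrow> 0) (at (0::real))"
    by (simp add: has_derivative_at linear_scale[OF lin])
  moreover have "\<forall>\<^sub>F s in at (0::real). norm (f (x + s *\<^sub>R v) - f x - s *\<^sub>R D v) / norm s
      = norm ((1 / s) *\<^sub>R (f (x + s *\<^sub>R v) - f x) - D v)"
    unfolding eventually_at
  proof (intro exI conjI ballI impI)
    fix s :: real assume "s \<noteq> 0 \<and> dist s 0 < 1"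
    then have "(1 / s) *\<^sub>R (f (x + s *\<^sub>R v) - f x) - D v = (1 / s) *\<^sub>R (f (x + s *\<^sub>R v) - f x - s *\<^sub>R D v)"
      by (simp add: scaleR_diff_right)
    then show "norm (f (x + s *\<^sub>R v) - f x - s *\<^sub>R D v) / norm s = norm ((1 / s) *\<^sub>R (f (x + s *\<^sub>R v) - f x) - D v)"
      by simp
  qed simp
  ultimately have "((\<lambda>s. norm ((1 / s) *\<^sub>R (f (x + s *\<^sub>R v) - f x) - D v)) \<longlongrightarrow> 0) (at (0::real))"
    by (rule Lim_transform_eventually)
  then show ?thesis
    by (subst Lim_null) (rule tendsto_norm_zero_cancel)
qed

lemma has_derivative_disc_to_H_0:
  assumes u: "(u has_derivative D) (at z)"
  shows "((\<lambda>\<zeta>. u (disc_to_H z \<zeta>)) has_derivative (\<lambda>v. D (2 * \<i> * of_real (Im z) * v))) (at 0)"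
proof -
  have "(disc_to_H z has_field_derivative (z - cnj z) / (1 - 0)\<^sup>2) (at 0)"
    by (rule disc_to_H_has_field_derivative) simp
  moreover have "(z - cnj z) / (1 - 0)\<^sup>2 = 2 * \<i> * of_real (Im z)" by (simp add: complex_eq_iff)
  ultimately have "(disc_to_H z has_derivative (\<lambda>v. 2 * \<i> * of_real (Im z) * v)) (at 0)"
    by (simp add: has_field_derivative_def)
  moreover have "(u has_derivative D) (at (disc_to_H z 0))" using u by simp
  ultimately show ?thesis by (rule has_derivative_compose)
qed

text \<open>Writing the real part as half the sum of a number and its conjugate leaves a multiple of
  \<open>\<eta>\<^sup>2\<close>, which has mean zero, and a multiple of \<open>|\<eta>|^2\<close>.
  With \<open>a\<close> the gradient of \<open>u\<close> this retains exactly the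
  \<open>d(cnj z)\<close>-part of its differential, whose coefficient is
  \<open>a / 2\<close>.\<close>

lemma disc_int_energy_density:
  "disc_int (\<lambda>\<eta>. of_real (Re (cnj a * (2 * \<i> * of_real y * \<eta>))) * (b * (2 * \<i> * of_real y * \<eta>)))
    = of_real (2 * disc_int (\<lambda>\<eta>. (cmod \<eta>)\<^sup>2)) * (of_real (y\<^sup>2) * a * b)"
proof -
  have e: "of_real (Re (cnj a * (2 * \<i> * of_real y * \<eta>))) * (b * (2 * \<i> * of_real y * \<eta>))
      = (2 * of_real (y\<^sup>2) * a * b) * of_real ((cmod \<eta>)\<^sup>2) - (2 * of_real (y\<^sup>2) * cnj a * b) * \<eta>\<^sup>2" for \<eta>
  proof -
    have r: "of_real (Re w) = (w + cnj w) / 2" for w by (simp add: complex_eq_iff)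
    have "of_real ((cmod \<eta>)\<^sup>2) = \<eta> * cnj \<eta>" by (rule complex_norm_square)
    then show ?thesis unfolding r by (simp add: field_simps power2_eq_square)
  qed
  have z: "disc_int (\<lambda>\<eta>. (2 * of_real (y\<^sup>2) * cnj a * b) * \<eta>\<^sup>2) = 0"
    using disc_int_holomorphic[of "\<lambda>\<eta>. (2 * of_real (y\<^sup>2) * cnj a * b) * \<eta>\<^sup>2" 2]
    by (simp add: holomorphic_intros)
  have "disc_int (\<lambda>\<eta>. of_real (Re (cnj a * (2 * \<i> * of_real y * \<eta>))) * (b * (2 * \<i> * of_real y * \<eta>)))
      = disc_int (\<lambda>\<eta>. (2 * of_real (y\<^sup>2) * a * b) * of_real ((cmod \<eta>)\<^sup>2))
        - disc_int (\<lambda>\<eta>. (2 * of_real (y\<^sup>2) * cnj a * b) * \<eta>\<^sup>2)"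
    unfolding e by (rule disc_int_diff) (auto intro!: continuous_intros)
  also have "disc_int (\<lambda>\<eta>. (2 * of_real (y\<^sup>2) * a * b) * of_real ((cmod \<eta>)\<^sup>2))
      = (2 * of_real (y\<^sup>2) * a * b) * disc_int (\<lambda>\<eta>. complex_of_real ((cmod \<eta>)\<^sup>2))"
    by (rule set_integral_mult_right)
  also have "disc_int (\<lambda>\<eta>. complex_of_real ((cmod \<eta>)\<^sup>2)) = of_real (disc_int (\<lambda>\<eta>. (cmod \<eta>)\<^sup>2))"
    by (rule set_integral_complex_of_real)
  finally show ?thesis unfolding z by (simp add: mult_ac)
qed

lemma disc_second_moment_pos: "disc_int (\<lambda>\<eta>. (cmod \<eta>)\<^sup>2) > 0"
proof -
  have "disc_int (\<lambda>\<eta>. (cmod \<eta>)\<^sup>2) \<noteq> 0"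
  proof
    assume "disc_int (\<lambda>\<eta>. (cmod \<eta>)\<^sup>2) = 0"
    then have "(cmod (1 / 2))\<^sup>2 = 0"
      by (intro disc_int_zero_imp[of "\<lambda>\<eta>. (cmod \<eta>)\<^sup>2"]) (auto intro!: continuous_intros)
    then show False by simp
  qed
  moreover have "disc_int (\<lambda>\<eta>. (cmod \<eta>)\<^sup>2) \<ge> 0" by (rule disc_int_nonneg) simp
  ultimately show ?thesis by simp
qed

lemma compact_bound:
  fixes f :: "'a::topological_space \<Rightarrow> real"
  assumes "compact S" "continuous_on S f"
  obtains C where "C \<ge> 0" "\<And>x. x \<in> S \<Longrightarrow> f x \<le> C"
proof -
  have "bounded (f ` S)" using compact_continuous_image[OF assms(2,1)] by (rule compact_imp_bounded)
  then obtain C where "C > 0" "\<forall>x\<in>f ` S. norm x \<le> C" unfolding bounded_pos by blast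
  then show ?thesis by (intro that[of C]) (auto simp: abs_le_iff)
qed

context surface_group begin

text \<open>The period cancels in the increment, so it may be estimated with \<open>z\<close> moved
  into \<open>K\<close>. There the mean value inequality over the compact set of charts of radius
  \<open>1 / 2\<close> supplies a constant.\<close>

lemma equivariant_Lipschitz:
  fixes u :: "complex \<Rightarrow> 'b::real_normed_vector"
  assumes der: "\<And>z. z \<in> \<H> \<Longrightarrow> (u has_derivative D z) (at z)"
    and D: "\<And>z v. z \<in> \<H> \<Longrightarrow> norm (D z v) \<le> L z * cmod v" and L: "continuous_on \<H> L"
    and inv: "\<And>A z. A \<in> G \<Longrightarrow> z \<in> \<H> \<Longrightarrow> u (mob A z) = u z + \<rho> A"
  obtains C where "C \<ge> 0" "\<And>z s \<eta>. z \<in> \<H> \<Longrightarrow> 0 \<le> s \<Longrightarrow> s \<le> 1 / 2 \<Longrightarrow> cmod \<eta> \<le> 1 \<Longrightarrow>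
    norm (u (chart s z \<eta>) - u z) \<le> C * s"
proof -
  have ne1: "\<zeta> \<noteq> 1" if "\<zeta> \<in> cball 0 (1 / 2)" for \<zeta> :: complex using that by auto
  have dH: "disc_to_H z \<zeta> \<in> \<H>" if "z \<in> \<H>" "\<zeta> \<in> cball 0 (1 / 2)" for z \<zeta>
    by (rule disc_to_H_in_H) (use that in auto)
  have "continuous_on (K \<times> cball 0 (1 / 2)) (\<lambda>x. disc_to_H (fst x) (snd x))"
    unfolding disc_to_H_def by (intro continuous_intros) (use ne1 in auto)
  then have "continuous_on (K \<times> cball 0 (1 / 2)) (\<lambda>x. L (disc_to_H (fst x) (snd x)))"
    by (rule continuous_on_compose2[OF L]) (use dH K_sub in auto)
  then have c: "continuous_on (K \<times> cball 0 (1 / 2))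
      (\<lambda>x. L (disc_to_H (fst x) (snd x)) * cmod ((fst x - cnj (fst x)) / (1 - snd x)\<^sup>2))"
    by (intro continuous_intros) (use ne1 in auto)
  have cp: "compact (K \<times> cball (0::complex) (1 / 2))" by (intro compact_Times K_compact compact_cball)
  obtain C where C: "C \<ge> 0" "\<And>x. x \<in> K \<times> cball 0 (1 / 2) \<Longrightarrow>
      L (disc_to_H (fst x) (snd x)) * cmod ((fst x - cnj (fst x)) / (1 - snd x)\<^sup>2) \<le> C"
    using compact_bound[OF cp c] by blast
  have K: "norm (u (disc_to_H z \<zeta>) - u z) \<le> C * cmod \<zeta>" if z: "z \<in> K" and \<zeta>: "\<zeta> \<in> cball 0 (1 / 2)" for z \<zeta>
  proof -
    have zH: "z \<in> \<H>" using z K_sub by auto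
    have "norm (u (disc_to_H z \<zeta>) - u (disc_to_H z 0)) \<le> C * norm (\<zeta> - 0)"
    proof (rule differentiable_bound[OF convex_cball])
      fix x :: complex assume x: "x \<in> cball 0 (1 / 2)"
      let ?d = "(z - cnj z) / (1 - x)\<^sup>2"
      have "(disc_to_H z has_derivative (*) ?d) (at x within cball 0 (1 / 2))"
        using disc_to_H_has_field_derivative[OF ne1[OF x]] by (simp add: has_field_derivative_def)
      from has_derivative_compose[OF this der[OF dH[OF zH x]]]
      show "((\<lambda>\<zeta>. u (disc_to_H z \<zeta>)) has_derivative (\<lambda>v. D (disc_to_H z x) (?d * v))) (at x within cball 0 (1 / 2))" .
      show "onorm (\<lambda>v. D (disc_to_H z x) (?d * v)) \<le> C"
      proof (rule onorm_bound[OF C(1)])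
        fix v
        have "norm (D (disc_to_H z x) (?d * v)) \<le> L (disc_to_H z x) * cmod (?d * v)"
          by (rule D[OF dH[OF zH x]])
        also have "\<dots> = (L (disc_to_H z x) * cmod ?d) * cmod v" by (simp only: norm_mult mult.assoc)
        also have "\<dots> \<le> C * cmod v" using C(2)[of "(z, x)"] z x by (intro mult_right_mono) auto
        finally show "norm (D (disc_to_H z x) (?d * v)) \<le> C * norm v" .
      qed
    qed (use \<zeta> in auto)
    then show ?thesis by simp
  qed
  show ?thesis
  proof (rule that[OF C(1)])
    fix z s \<eta> assume z: "z \<in> \<H>" and s: "0 \<le> (s::real)" "s \<le> 1 / 2" and \<eta>: "cmod \<eta> \<le> 1"
    have s1: "s < 1" using s by simp
    obtain A where A: "A \<in> G" "mob A z \<in> K" using K_meets[OF z] by blast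
    have d: "det A = 1" using A det_one by simp
    let ?e = "cnj (aut_factor A z) / aut_factor A z"
    have "cmod (?e * \<eta>) = cmod \<eta>" unfolding norm_mult norm_aut_factor_ratio[OF d z] by simp
    then have n: "cmod (of_real s * (?e * \<eta>)) = s * cmod \<eta>" using s by (simp only: norm_mult norm_of_real abs_of_nonneg)
    have n': "s * cmod \<eta> \<le> s * 1" using s \<eta> by (intro mult_left_mono)
    have "u (chart s z \<eta>) - u z = u (mob A (chart s z \<eta>)) - u (mob A z)"
      using inv[OF A(1) z] inv[OF A(1) chart_in_H[OF z s(1) s1 \<eta>]] by simp
    also have "\<dots> = u (disc_to_H (mob A z) (of_real s * (?e * \<eta>))) - u (mob A z)"
      by (simp only: chart_mob[OF d z s(1) s1 \<eta>])
    also have "norm \<dots> \<le> C * cmod (of_real s * (?e * \<eta>))"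
    proof (rule K[OF A(2)])
      show "of_real s * (?e * \<eta>) \<in> cball 0 (1 / 2)"
        unfolding mem_cball_0 n using n' s by linarith
    qed
    also have "\<dots> \<le> C * s" unfolding n using n' C(1) by (intro mult_left_mono) auto
    finally show "norm (u (chart s z \<eta>) - u z) \<le> C * s" .
  qed
qed

text \<open>The difference quotients of \<open>u\<close> and \<open>W\<close> in the chart converge
  to derivatives and are bounded by the Lipschitz constants, so dominated convergence applies first
  over the disc and then over the quotient.\<close>

lemma energy_limit:
  fixes u :: "complex \<Rightarrow> real" and W :: "complex \<Rightarrow> complex"
  assumes du: "\<And>z. z \<in> \<H> \<Longrightarrow> (u has_derivative (\<lambda>v. Re (cnj (a z) * v))) (at z)"
    and a: "continuous_on \<H> a"
    and uinv: "\<And>A z. A \<in> G \<Longrightarrow> z \<in> \<H> \<Longrightarrow> u (mob A z) = u z + \<rho> A"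
    and dW: "\<And>z. z \<in> \<H> \<Longrightarrow> (W has_field_derivative w z) (at z)"
    and w: "continuous_on \<H> w"
    and Winv: "\<And>A z. A \<in> G \<Longrightarrow> z \<in> \<H> \<Longrightarrow> W (mob A z) = W z + \<sigma> A"
  defines "f \<equiv> (\<lambda>z. of_real (2 * disc_int (\<lambda>\<eta>. (cmod \<eta>)\<^sup>2)) * (of_real ((Im z)\<^sup>2) * a z * w z))"
    and "E \<equiv> (\<lambda>s z. disc_int (\<lambda>\<eta>. of_real (u (chart s z \<eta>) - u z) * (W (chart s z \<eta>) - W z)))"
  shows "(\<lambda>n. hF_int (\<lambda>z. (1 / (1 / real (n + 2))\<^sup>2) *\<^sub>R E (1 / real (n + 2)) z)) \<longlonglongrightarrow> hF_int f"
    and "set_integrable hF \<H> f"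
proof -
  \<comment> \<open>The shift by 2 keeps the radii at most \<open>1 / 2\<close>, as the Lipschitz
    bounds require.\<close>
  define s where "s = (\<lambda>n. 1 / real (n + 2))"
  have s: "0 < s n" "s n \<le> 1 / 2" "s n < 1" "0 \<le> s n" for n by (auto simp: s_def field_simps)
  have s0: "filterlim s (at 0) sequentially"
  proof -
    have "s \<longlonglongrightarrow> 0" unfolding s_def
      using LIMSEQ_ignore_initial_segment[OF lim_1_over_n, of 2] by simp
    then show ?thesis using s by (auto simp: filterlim_at less_imp_neq[symmetric])
  qed
  have uc: "continuous_on \<H> u"
    by (rule has_derivative_continuous_on) (rule has_derivative_at_withinI[OF du])
  have Wc: "continuous_on \<H> W"
    by (intro DERIV_continuous_on) (use dW has_field_derivative_at_within in blast)
  have W': "\<And>z. z \<in> \<H> \<Longrightarrow> (W has_derivative (*) (w z)) (at z)"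
    using dW by (simp add: has_field_derivative_def)
  obtain C1 where C1: "C1 \<ge> 0" "\<And>z s \<eta>. z \<in> \<H> \<Longrightarrow> 0 \<le> s \<Longrightarrow> s \<le> 1 / 2 \<Longrightarrow> cmod \<eta> \<le> 1 \<Longrightarrow>
    norm (u (chart s z \<eta>) - u z) \<le> C1 * s"
  proof (rule equivariant_Lipschitz[where L="\<lambda>z. cmod (a z)", OF du _ _ uinv])
    show "norm (Re (cnj (a z) * v)) \<le> cmod (a z) * cmod v" for z v
      using abs_Re_le_cmod[of "cnj (a z) * v"] by (simp add: norm_mult)
    show "continuous_on \<H> (\<lambda>z. cmod (a z))" using a by (rule continuous_on_norm)
  qed (auto intro: that)
  obtain C2 where C2: "C2 \<ge> 0" "\<And>z s \<eta>. z \<in> \<H> \<Longrightarrow> 0 \<le> s \<Longrightarrow> s \<le> 1 / 2 \<Longrightarrow> cmod \<eta> \<le> 1 \<Longrightarrow>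
    norm (W (chart s z \<eta>) - W z) \<le> C2 * s"
  proof (rule equivariant_Lipschitz[where L="\<lambda>z. cmod (w z)", OF W' _ _ Winv])
    show "continuous_on \<H> (\<lambda>z. cmod (w z))" using w by (rule continuous_on_norm)
  qed (auto intro: that simp: norm_mult)
  define g where "g = (\<lambda>n z \<eta>. complex_of_real ((u (chart (s n) z \<eta>) - u z) / s n) * ((W (chart (s n) z \<eta>) - W z) / of_real (s n)))"
  have gE: "(1 / (s n)\<^sup>2) *\<^sub>R E (s n) z = disc_int (g n z)" for n z
  proof -
    have "disc_int (g n z) = disc_int (\<lambda>\<eta>. (1 / (s n)\<^sup>2) *\<^sub>R (of_real (u (chart (s n) z \<eta>) - u z) * (W (chart (s n) z \<eta>) - W z)))"
      by (rule disc_int_cong) (simp add: g_def scaleR_conv_of_real power2_eq_square)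
    then show ?thesis by (simp add: E_def)
  qed
  have gb: "norm (g n z \<eta>) \<le> C1 * C2" if "z \<in> \<H>" "cmod \<eta> \<le> 1" for n z \<eta>
  proof -
    have "cmod (complex_of_real ((u (chart (s n) z \<eta>) - u z) / s n)) \<le> C1"
      unfolding norm_of_real
      using C1(2)[OF that(1) s(4,2) that(2), of n] s(1)[of n] by (simp add: divide_le_eq)
    moreover have "cmod ((W (chart (s n) z \<eta>) - W z) / of_real (s n)) \<le> C2"
      using C2(2)[OF that(1) s(4,2) that(2), of n] s(1)[of n] by (simp add: divide_le_eq norm_divide)
    ultimately show ?thesis unfolding g_def norm_mult by (intro mult_mono) (use C1 in auto)
  qed
  have gc: "continuous_on (\<H> \<times> cball 0 1) (\<lambda>x. g n (fst x) (snd x))" for n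
    unfolding g_def
    by (intro continuous_intros continuous_on_compose_chart_joint s uc Wc continuous_on_compose2[OF uc]
        continuous_on_compose2[OF Wc]) (use s[of n] in auto)
  have gcz: "continuous_on (cball 0 1) (g n z)" if "z \<in> \<H>" for n z
  proof -
    have "continuous_on (cball 0 1) (\<lambda>\<eta>. (\<lambda>x. g n (fst x) (snd x)) (z, \<eta>))"
      by (rule continuous_on_compose2[OF gc]) (use that in \<open>auto intro!: continuous_intros\<close>)
    then show ?thesis by simp
  qed
  define l where "l = (\<lambda>z \<eta>. complex_of_real (Re (cnj (a z) * (2 * \<i> * of_real (Im z) * \<eta>))) * (w z * (2 * \<i> * of_real (Im z) * \<eta>)))"
  have lf: "disc_int (l z) = f z" for z
    unfolding l_def f_def by (rule disc_int_energy_density)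
  have gl: "(\<lambda>n. g n z \<eta>) \<longlonglongrightarrow> l z \<eta>" if z: "z \<in> \<H>" for z \<eta>
  proof -
    have "((\<lambda>t. (1 / t) *\<^sub>R (u (disc_to_H z (0 + t *\<^sub>R \<eta>)) - u (disc_to_H z 0)))
        \<longlongrightarrow> Re (cnj (a z) * (2 * \<i> * of_real (Im z) * \<eta>))) (at 0)"
      by (rule has_derivative_directional_limit[OF has_derivative_disc_to_H_0[OF du[OF z]]])
    from filterlim_compose[OF this s0]
    have 1: "(\<lambda>n. (u (chart (s n) z \<eta>) - u z) / s n) \<longlonglongrightarrow> Re (cnj (a z) * (2 * \<i> * of_real (Im z) * \<eta>))"
      by (simp add: scaleR_conv_of_real)
    have "((\<lambda>t. (1 / t) *\<^sub>R (W (disc_to_H z (0 + t *\<^sub>R \<eta>)) - W (disc_to_H z 0)))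
        \<longlongrightarrow> w z * (2 * \<i> * of_real (Im z) * \<eta>)) (at 0)"
      by (rule has_derivative_directional_limit[OF has_derivative_disc_to_H_0[OF W'[OF z]]])
    from filterlim_compose[OF this s0]
    have 2: "(\<lambda>n. (W (chart (s n) z \<eta>) - W z) / of_real (s n)) \<longlonglongrightarrow> w z * (2 * \<i> * of_real (Im z) * \<eta>)"
      by (simp add: scaleR_conv_of_real)
    show ?thesis unfolding g_def l_def by (intro tendsto_mult tendsto_of_real 1 2)
  qed
  have lim: "(\<lambda>n. disc_int (g n z)) \<longlonglongrightarrow> f z" if z: "z \<in> \<H>" for z
    unfolding lf[symmetric]
  proof (rule set_integral_bounded_convergence[OF udisc.finite_measure_axioms])
    show "continuous_on (ball 0 1) (g n z)" for n
      using gcz[OF z] by (rule continuous_on_subset) auto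
    show "continuous_on (ball 0 1) (l z)" unfolding l_def by (intro continuous_intros)
    show "norm (g n z \<eta>) \<le> C1 * C2" if "\<eta> \<in> ball 0 1" for n \<eta>
      by (rule gb[OF z]) (use that in simp)
  qed (use gl z in auto)
  have gi: "norm (disc_int (g n z)) \<le> C1 * C2" if "z \<in> \<H>" for n z
    by (rule norm_disc_int_le) (use gb that C1 C2 in auto)
  have fc: "continuous_on \<H> f" unfolding f_def by (intro continuous_intros a w)
  have fb: "norm (f z) \<le> C1 * C2" if "z \<in> \<H>" for z
    using tendsto_norm[OF lim[OF that]] by (rule LIMSEQ_le_const2) (use gi that in auto)
  show "set_integrable hF \<H> f" by (rule set_integrable_hF[OF fc fb])
  have "(\<lambda>n. hF_int (\<lambda>z. disc_int (g n z))) \<longlonglongrightarrow> hF_int f"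
  proof (rule set_integral_bounded_convergence[OF finite_measure_hF])
    show "continuous_on \<H> (\<lambda>z. disc_int (g n z))" for n
      using continuous_on_disc_int[OF gc] by simp
  qed (use fc gi lim in auto)
  then show "(\<lambda>n. hF_int (\<lambda>z. (1 / (1 / real (n + 2))\<^sup>2) *\<^sub>R E (1 / real (n + 2)) z)) \<longlonglongrightarrow> hF_int f"
    unfolding gE[symmetric] by (simp add: s_def)
qed

text \<open>The real case applied after \<open>T\<close>, which stands for \<open>Re\<close> and
  \<open>Im\<close>.\<close>

lemma hF_int_antisymmetric_complex:
  fixes b :: "complex \<Rightarrow> complex \<Rightarrow> complex"
  assumes cont: "continuous_on (\<H> \<times> \<H>) (\<lambda>x. b (fst x) (snd x))"
    and inv: "\<And>A z w. A \<in> G \<Longrightarrow> z \<in> \<H> \<Longrightarrow> w \<in> \<H> \<Longrightarrow> b (mob A z) (mob A w) = b z w"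
    and anti: "\<And>z w. z \<in> \<H> \<Longrightarrow> w \<in> \<H> \<Longrightarrow> b w z = - b z w"
    and s: "0 < s" "s < 1"
  shows "hF_int (\<lambda>z. disc_int (\<lambda>\<eta>. b z (chart s z \<eta>))) = 0"
proof -
  have s0: "0 \<le> s" using s by simp
  obtain C where C: "C \<ge> 0" "\<And>z \<eta>. z \<in> \<H> \<Longrightarrow> cmod \<eta> \<le> 1 \<Longrightarrow> norm (b z (chart s z \<eta>)) \<le> C"
  proof (rule bounded_diagonal_invariant[OF cont _ s0 s(2)])
    show "norm (b (mob A z) (mob A w)) = norm (b z w)" if "A \<in> G" "z \<in> \<H>" "w \<in> \<H>" for A z w
      using inv[OF that] by simp
  qed (rule that)
  let ?P = "\<lambda>z. disc_int (\<lambda>\<eta>. b z (chart s z \<eta>))"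
  have int: "set_integrable hF \<H> ?P"
    by (rule set_integrable_hF[where B=C])
       (use C s s0 in \<open>auto intro!: norm_disc_int_le continuous_on_disc_int_diagonal cont\<close>)
  have inner: "set_integrable unit_disc_measure (ball 0 1) (\<lambda>\<eta>. b z (chart s z \<eta>))" if "z \<in> \<H>" for z
    by (intro set_integrable_disc continuous_on_compose_chart[OF s0 s(2)] continuous_on_section[OF cont that] that)
  have comm: "T (set_lebesgue_integral M S k) = (LINT x:S|M. T (k x))"
    if "bounded_linear T" "set_integrable M S k" for T :: "complex \<Rightarrow> real" and M :: "complex measure" and S k
    using integral_bounded_linear[OF that(1), of M "\<lambda>x. indicator S x *\<^sub>R k x"] that(2)
    by (simp add: set_lebesgue_integral_def set_integrable_def linear_simps(5)[OF that(1)])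
  have "T (hF_int ?P) = 0" if T: "bounded_linear T" for T :: "complex \<Rightarrow> real"
  proof -
    have "T (hF_int ?P) = hF_int (\<lambda>z. T (?P z))" by (rule comm[OF T int])
    also have "\<dots> = hF_int (\<lambda>z. disc_int (\<lambda>\<eta>. T (b z (chart s z \<eta>))))"
      by (rule set_lebesgue_integral_cong) (use comm[OF T inner] in auto)
    also have "\<dots> = 0"
    proof (rule hF_int_antisymmetric[OF _ _ _ s])
      show "continuous_on (\<H> \<times> \<H>) (\<lambda>x. T (b (fst x) (snd x)))"
        by (rule bounded_linear.continuous_on[OF T cont])
      show "T (b w z) = - T (b z w)" if "z \<in> \<H>" "w \<in> \<H>" for z w
        using anti[OF that] linear_neg[OF bounded_linear.linear[OF T]] by simp
    qed (use inv in auto)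
    finally show ?thesis .
  qed
  from this[OF bounded_linear_Re] this[OF bounded_linear_Im] show ?thesis
    by (simp add: complex_eq_iff)
qed

text \<open>The energy integrand is symmetric in the two points. Adding
  \<open>2 * v z * (W w - W z)\<close>, whose disc mean is 0 since \<open>W\<close> is holomorphic,
  turns it into the antisymmetric \<open>(v w + v z) * (W w - W z)\<close>. Here \<open>v\<close>
  has to be invariant, as periods would not cancel in the sum \<open>v w + v z\<close>.\<close>

lemma energy_zero:
  fixes v :: "complex \<Rightarrow> real" and W :: "complex \<Rightarrow> complex"
  assumes v: "continuous_on \<H> v" and vinv: "\<And>A z. A \<in> G \<Longrightarrow> z \<in> \<H> \<Longrightarrow> v (mob A z) = v z"
    and W: "W holomorphic_on \<H>" and Winv: "\<And>A z. A \<in> G \<Longrightarrow> z \<in> \<H> \<Longrightarrow> W (mob A z) = W z + \<sigma> A"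
    and s: "0 < s" "s < 1"
  shows "hF_int (\<lambda>z. disc_int (\<lambda>\<eta>. of_real (v (chart s z \<eta>) - v z) * (W (chart s z \<eta>) - W z))) = 0"
proof -
  have s0: "0 \<le> s" using s by simp
  have Wc: "continuous_on \<H> W" using W by (rule holomorphic_on_imp_continuous_on)
  let ?b = "\<lambda>z w. complex_of_real (v w + v z) * (W w - W z)"
  have "hF_int (\<lambda>z. disc_int (\<lambda>\<eta>. of_real (v (chart s z \<eta>) - v z) * (W (chart s z \<eta>) - W z)))
      = hF_int (\<lambda>z. disc_int (\<lambda>\<eta>. ?b z (chart s z \<eta>)))"
  proof (rule set_lebesgue_integral_cong)
    show "\<forall>z. z \<in> \<H> \<longrightarrow> disc_int (\<lambda>\<eta>. of_real (v (chart s z \<eta>) - v z) * (W (chart s z \<eta>) - W z))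
        = disc_int (\<lambda>\<eta>. ?b z (chart s z \<eta>))"
    proof (intro allI impI)
      fix z assume z: "z \<in> \<H>"
      have cW: "continuous_on (cball 0 1) (\<lambda>\<eta>. W (chart s z \<eta>))"
        and cv: "continuous_on (cball 0 1) (\<lambda>\<eta>. v (chart s z \<eta>))"
        by (intro continuous_on_compose_chart s0 s Wc v z)+
      have "disc_int (\<lambda>\<eta>. W (chart s z \<eta>) - W z) = disc_avg s W z - W z"
        using disc_int_diff[OF cW, of "\<lambda>_. W z"] by (simp add: disc_avg_def)
      also have "\<dots> = 0" using disc_avg_holomorphic[OF s z W] by simp
      finally have 0: "disc_int (\<lambda>\<eta>. W (chart s z \<eta>) - W z) = 0" .
      have "disc_int (\<lambda>\<eta>. of_real (v (chart s z \<eta>) - v z) * (W (chart s z \<eta>) - W z))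
          = disc_int (\<lambda>\<eta>. ?b z (chart s z \<eta>) - of_real (2 * v z) * (W (chart s z \<eta>) - W z))"
        by (rule disc_int_cong) (simp add: algebra_simps)
      also have "\<dots> = disc_int (\<lambda>\<eta>. ?b z (chart s z \<eta>)) - disc_int (\<lambda>\<eta>. of_real (2 * v z) * (W (chart s z \<eta>) - W z))"
        by (rule disc_int_diff) (intro continuous_intros cW cv)+
      also have "disc_int (\<lambda>\<eta>. of_real (2 * v z) * (W (chart s z \<eta>) - W z))
          = of_real (2 * v z) * disc_int (\<lambda>\<eta>. W (chart s z \<eta>) - W z)"
        by (rule set_integral_mult_right)
      finally show "disc_int (\<lambda>\<eta>. of_real (v (chart s z \<eta>) - v z) * (W (chart s z \<eta>) - W z))
        = disc_int (\<lambda>\<eta>. ?b z (chart s z \<eta>))" by (simp add: 0)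
    qed
  qed simp
  also have "\<dots> = 0"
  proof (rule hF_int_antisymmetric_complex[OF _ _ _ s])
    show "continuous_on (\<H> \<times> \<H>) (\<lambda>x. ?b (fst x) (snd x))"
      by (intro continuous_intros continuous_on_compose2[OF v] continuous_on_compose2[OF Wc]) auto
  qed (use vinv Winv in \<open>auto simp: algebra_simps\<close>)
  finally show ?thesis .
qed

text \<open>The rescaled energies vanish and converge to the integral times twice the second moment
  of the disc, which is positive.\<close>

lemma exact_orthogonal:
  fixes v :: "complex \<Rightarrow> real" and W :: "complex \<Rightarrow> complex"
  assumes dv: "\<And>z. z \<in> \<H> \<Longrightarrow> (v has_derivative (\<lambda>x. Re (cnj (a z) * x))) (at z)"
    and a: "continuous_on \<H> a"
    and vinv: "\<And>A z. A \<in> G \<Longrightarrow> z \<in> \<H> \<Longrightarrow> v (mob A z) = v z"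
    and dW: "\<And>z. z \<in> \<H> \<Longrightarrow> (W has_field_derivative w z) (at z)"
    and w: "continuous_on \<H> w"
    and Winv: "\<And>A z. A \<in> G \<Longrightarrow> z \<in> \<H> \<Longrightarrow> W (mob A z) = W z + \<sigma> A"
  shows "hF_int (\<lambda>z. of_real ((Im z)\<^sup>2) * a z * w z) = 0"
proof -
  let ?k = "2 * disc_int (\<lambda>\<eta>. (cmod \<eta>)\<^sup>2)"
  have vc: "continuous_on \<H> v"
    by (rule has_derivative_continuous_on) (rule has_derivative_at_withinI[OF dv])
  have W: "W holomorphic_on \<H>"
    using dW by (auto simp: holomorphic_on_open)
  have "hF_int (\<lambda>z. (1 / (1 / real (n + 2))\<^sup>2) *\<^sub>R disc_int (\<lambda>\<eta>. of_real (v (chart (1 / real (n + 2)) z \<eta>) - v z)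
      * (W (chart (1 / real (n + 2)) z \<eta>) - W z))) = 0" for n
    by (subst set_integral_scaleR_right, subst energy_zero[OF vc vinv W Winv]) (auto simp: field_simps)
  then have "(\<lambda>n. 0) \<longlonglongrightarrow> hF_int (\<lambda>z. of_real ?k * (of_real ((Im z)\<^sup>2) * a z * w z))"
    using energy_limit(1)[OF dv a, of "\<lambda>_. 0", OF _ _ dW w Winv] vinv by simp
  then have "hF_int (\<lambda>z. of_real ?k * (of_real ((Im z)\<^sup>2) * a z * w z)) = 0"
    by (simp add: LIMSEQ_const_iff)
  then show ?thesis using disc_second_moment_pos by (simp add: mult.assoc)
qed

section \<open>Invariant differentials and the vanishing of periods\<close>

definition invariant_differential :: "(complex \<Rightarrow> complex) \<Rightarrow> bool" where
  "invariant_differential \<omega> \<longleftrightarrow> \<omega> holomorphic_on \<H> \<and> (\<forall>A\<in>G. \<forall>z\<in>\<H>. \<omega> (mob A z) * deriv (mob A) z = \<omega> z)"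

text \<open>Invariance says that \<open>W\<close> composed with \<open>mob A\<close> has the same
  derivative as \<open>W\<close>; the constant difference is the period.\<close>

lemma invariant_differential_primitive:
  assumes "invariant_differential \<omega>"
  obtains W \<sigma> where "\<And>z. z \<in> \<H> \<Longrightarrow> (W has_field_derivative \<omega> z) (at z)"
    "\<And>A z. A \<in> G \<Longrightarrow> z \<in> \<H> \<Longrightarrow> W (mob A z) = W z + \<sigma> A"
proof -
  have \<omega>: "\<omega> holomorphic_on \<H>" and inv: "\<And>A z. A \<in> G \<Longrightarrow> z \<in> \<H> \<Longrightarrow> \<omega> (mob A z) * deriv (mob A) z = \<omega> z"
    using assms by (auto simp: invariant_differential_def)
  obtain W where W: "\<And>z. z \<in> \<H> \<Longrightarrow> (W has_field_derivative \<omega> z) (at z within \<H>)"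
    using holomorphic_convex_primitive'[OF convex_H open_H \<omega>] by blast
  have W': "(W has_field_derivative \<omega> z) (at z)" if "z \<in> \<H>" for z
    using W[OF that] at_within_open[OF that open_H] by simp
  have "\<exists>c. \<forall>z\<in>\<H>. W (mob A z) - W z = c" if A: "A \<in> G" for A
  proof (rule has_field_derivative_zero_constant[OF convex_H])
    fix z assume z: "z \<in> \<H>"
    have d: "det A = 1" using A by (rule det_one)
    have "((\<lambda>z. W (mob A z)) has_field_derivative \<omega> (mob A z) * deriv (mob A) z) (at z within \<H>)"
      using DERIV_chain2[OF W'[OF mob_in_H[OF d z]] mob_has_field_derivative[OF d z]]
      by (simp add: deriv_mob[OF d z])
    from DERIV_diff[OF this W[OF z]]
    show "((\<lambda>z. W (mob A z) - W z) has_field_derivative 0) (at z within \<H>)"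
      by (simp add: inv[OF A z])
  qed
  then obtain \<sigma> where "\<And>A z. A \<in> G \<Longrightarrow> z \<in> \<H> \<Longrightarrow> W (mob A z) - W z = \<sigma> A" by metis
  then show ?thesis by (intro that[of W \<sigma>] W') (auto simp: diff_eq_eq add.commute)
qed

text \<open>The difference of \<open>W\<close> after and before \<open>mob A\<close> has constant
  real part; testing its derivative \<delta> in the directions 1 and \<i> shows that \<delta>
  vanishes.\<close>

lemma invariant_differential_of_Re_equivariant:
  assumes W: "W holomorphic_on \<H>"
    and inv: "\<And>A z. A \<in> G \<Longrightarrow> z \<in> \<H> \<Longrightarrow> Re (W (mob A z)) = Re (W z) + \<rho> A"
  shows "invariant_differential (deriv W)"
  unfolding invariant_differential_def
proof (intro conjI ballI)
  show "deriv W holomorphic_on \<H>" by (rule holomorphic_deriv[OF W open_H])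
  fix A z assume A: "A \<in> G" and z: "z \<in> \<H>"
  have d: "det A = 1" using A by (rule det_one)
  have W': "(W has_field_derivative deriv W z) (at z)" if "z \<in> \<H>" for z
    using holomorphic_derivI[OF W open_H that] .
  define \<delta> where "\<delta> = deriv W (mob A z) * deriv (mob A) z - deriv W z"
  have "((\<lambda>z. W (mob A z) - W z) has_field_derivative \<delta>) (at z)"
    unfolding \<delta>_def deriv_mob[OF d z]
    by (intro DERIV_diff DERIV_chain2[where f=W and g="mob A"] mob_has_field_derivative d z W' mob_in_H)
  then have "((\<lambda>z. Re (W (mob A z) - W z)) has_derivative (\<lambda>v. Re (\<delta> * v))) (at z)"
    unfolding has_field_derivative_def by (rule bounded_linear.has_derivative[OF bounded_linear_Re])
  moreover have "((\<lambda>z. Re (W (mob A z) - W z)) has_derivative (\<lambda>v. 0)) (at z)"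
    by (rule has_derivative_transform_within_open[OF has_derivative_const[of "\<rho> A"] open_H z])
       (use inv[OF A] in simp)
  ultimately have "(\<lambda>v. Re (\<delta> * v)) = (\<lambda>v. 0)" by (rule has_derivative_unique)
  then have "Re (\<delta> * 1) = 0" "Re (\<delta> * \<i>) = 0" by meson+
  then have "\<delta> = 0" by (simp add: complex_eq_iff)
  then show "deriv W (mob A z) * deriv (mob A) z = deriv W z" by (simp add: \<delta>_def)
qed

text \<open>The hypothesis gives vanishing only almost everywhere on \<open>F\<close>. Since
  \<open>(Im z)\<^sup>2 * (cmod (\<omega> z))\<^sup>2\<close> is invariant, unfolding spreads it
  over \<H>, and continuity on a disc about \<open>z\<close> gives the value at
  \<open>z\<close>.\<close>

lemma invariant_differential_eq_zero:
  assumes \<omega>: "invariant_differential \<omega>"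
    and int: "set_integrable hF \<H> (\<lambda>z. (Im z)\<^sup>2 * (cmod (\<omega> z))\<^sup>2)"
    and 0: "hF_int (\<lambda>z. (Im z)\<^sup>2 * (cmod (\<omega> z))\<^sup>2) = 0" and z: "z \<in> \<H>"
  shows "\<omega> z = 0"
proof (rule ccontr)
  assume nz: "\<omega> z \<noteq> 0"
  have \<omega>h: "\<omega> holomorphic_on \<H>" and inv: "\<And>A z. A \<in> G \<Longrightarrow> z \<in> \<H> \<Longrightarrow> \<omega> (mob A z) * deriv (mob A) z = \<omega> z"
    using \<omega> by (auto simp: invariant_differential_def)
  have c: "continuous_on \<H> \<omega>" using \<omega>h by (rule holomorphic_on_imp_continuous_on)
  define g where "g = (\<lambda>z. if z \<in> \<H> then (Im z)\<^sup>2 * (cmod (\<omega> z))\<^sup>2 else 0)"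
  have gm [measurable]: "g \<in> borel_measurable borel"
    unfolding g_def using c by (intro borel_measurable_continuous_on_if) (auto intro!: continuous_intros)
  have ginv: "g (mob A z) = g z" if A: "A \<in> G" and z: "z \<in> \<H>" for A z
  proof -
    have d: "det A = 1" using A by (rule det_one)
    have nz: "aut_factor A z \<noteq> 0" using aut_factor_nonzero[OF d, of z] z by simp
    have "\<omega> (mob A z) = \<omega> z * (aut_factor A z)\<^sup>2"
      using inv[OF A z] nz by (simp add: deriv_mob[OF d z] field_simps)
    then show ?thesis
      using z mob_in_H[OF d z] nz Im_mob[OF d, of z]
      by (simp add: g_def norm_mult norm_power power_mult_distrib power_divide)
  qed
  have "(\<integral>\<^sup>+z. ennreal (g z) \<partial>hF) = 0"
    using ennreal_hF_int[OF int] 0 by (simp add: g_def)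
  then have "(\<integral>\<^sup>+z. ennreal (g (mob A z)) \<partial>hF) = 0" if "A \<in> G" for A
  proof -
    have "(\<integral>\<^sup>+z. ennreal (g (mob A z)) \<partial>hF) = (\<integral>\<^sup>+z. ennreal (g z) \<partial>hF)"
      using AE_hF_H by (intro nn_integral_cong_AE) (auto elim!: eventually_mono simp: ginv[OF that])
    then show ?thesis using \<open>(\<integral>\<^sup>+z. ennreal (g z) \<partial>hF) = 0\<close> by simp
  qed
  then have "(\<integral>\<^sup>+A. (\<integral>\<^sup>+z. ennreal (g (mob A z)) \<partial>hF) \<partial>count_space G) = (\<integral>\<^sup>+A. 0 \<partial>count_space G)"
    by (intro nn_integral_cong) simp
  then have "2 * (\<integral>\<^sup>+z. ennreal (g z) \<partial>hyp) = 0"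
    using nn_integral_unfold[of "\<lambda>z. ennreal (g z)"] by simp
  then have h0: "(\<integral>\<^sup>+w. ennreal (g w) \<partial>hyp) = 0" by simp
  have "ennreal (disc_int (\<lambda>\<eta>. (\<lambda>z. (Im z)\<^sup>2 * (cmod (\<omega> z))\<^sup>2) (chart (1/2) z \<eta>)))
      = (\<integral>\<^sup>+w. ennreal (g w) * ennreal (avg_kernel (1/2) z w) \<partial>hyp)"
    unfolding g_def
    by (rule ennreal_disc_int_kernel[OF z]) (auto intro!: continuous_intros c)
  also have "\<dots> = 0"
    using h0 by (subst (asm) nn_integral_0_iff_AE, simp, subst nn_integral_0_iff_AE) (auto elim!: eventually_mono)
  finally have "disc_int (\<lambda>\<eta>. (Im (chart (1/2) z \<eta>))\<^sup>2 * (cmod (\<omega> (chart (1/2) z \<eta>)))\<^sup>2) \<le> 0"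
    by (simp add: ennreal_eq_0_iff)
  moreover have "disc_int (\<lambda>\<eta>. (Im (chart (1/2) z \<eta>))\<^sup>2 * (cmod (\<omega> (chart (1/2) z \<eta>)))\<^sup>2) \<ge> 0"
    by (rule disc_int_nonneg) simp
  moreover have "continuous_on (cball 0 1) (\<lambda>\<eta>. (\<lambda>z. (Im z)\<^sup>2 * (cmod (\<omega> z))\<^sup>2) (chart (1/2) z \<eta>))"
    by (rule continuous_on_compose_chart) (use z c in \<open>auto intro!: continuous_intros\<close>)
  ultimately have "(Im (chart (1/2) z 0))\<^sup>2 * (cmod (\<omega> (chart (1/2) z 0)))\<^sup>2 = 0"
    by (intro disc_int_zero_imp[of "\<lambda>\<eta>. (Im (chart (1/2) z \<eta>))\<^sup>2 * (cmod (\<omega> (chart (1/2) z \<eta>)))\<^sup>2"]) auto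
  then show False using z nz by simp
qed

lemma periods_vanish_iff:
  fixes u :: "complex \<Rightarrow> real"
  assumes du: "\<And>z. z \<in> \<H> \<Longrightarrow> (u has_derivative (\<lambda>v. Re (cnj (a z) * v))) (at z)"
    and a: "continuous_on \<H> a"
    and uinv: "\<And>A z. A \<in> G \<Longrightarrow> z \<in> \<H> \<Longrightarrow> u (mob A z) = u z + \<rho> A"
  shows "(\<forall>A\<in>G. \<rho> A = 0) \<longleftrightarrow>
    (\<forall>\<omega>. invariant_differential \<omega> \<longrightarrow> hF_int (\<lambda>z. of_real ((Im z)\<^sup>2) * a z * \<omega> z) = 0)"
proof
  assume \<rho>: "\<forall>A\<in>G. \<rho> A = 0"
  show "\<forall>\<omega>. invariant_differential \<omega> \<longrightarrow> hF_int (\<lambda>z. of_real ((Im z)\<^sup>2) * a z * \<omega> z) = 0"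
  proof (intro allI impI)
    fix \<omega> assume \<omega>: "invariant_differential \<omega>"
    obtain W \<sigma> where W: "\<And>z. z \<in> \<H> \<Longrightarrow> (W has_field_derivative \<omega> z) (at z)"
      "\<And>A z. A \<in> G \<Longrightarrow> z \<in> \<H> \<Longrightarrow> W (mob A z) = W z + \<sigma> A"
      using invariant_differential_primitive[OF \<omega>] by metis
    have \<omega>c: "continuous_on \<H> \<omega>"
      using \<omega> by (auto simp: invariant_differential_def intro: holomorphic_on_imp_continuous_on)
    show "hF_int (\<lambda>z. of_real ((Im z)\<^sup>2) * a z * \<omega> z) = 0"
      by (rule exact_orthogonal[OF du a _ W(1) \<omega>c W(2)]) (use uinv \<rho> in auto)
  qed
next
  assume orth: "\<forall>\<omega>. invariant_differential \<omega> \<longrightarrow> hF_int (\<lambda>z. of_real ((Im z)\<^sup>2) * a z * \<omega> z) = 0"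
  have uc: "continuous_on \<H> u"
    by (rule has_derivative_continuous_on) (rule has_derivative_at_withinI[OF du])
  obtain h where h: "continuous_on \<H> h" "\<And>A z. A \<in> G \<Longrightarrow> z \<in> \<H> \<Longrightarrow> h (mob A z) = h z + \<rho> A"
    "\<And>s z. 0 < s \<Longrightarrow> s < 1 \<Longrightarrow> z \<in> \<H> \<Longrightarrow> disc_avg s h z = h z"
    using disc_avg_fixed_point[OF uc uinv] by metis
  obtain W where W: "W holomorphic_on \<H>" "\<And>z. z \<in> \<H> \<Longrightarrow> h z = Re (W z)"
    using mean_value_Re_holomorphic[OF h(1,3)] by metis
  define \<omega> where "\<omega> = deriv W"
  have dW: "(W has_field_derivative \<omega> z) (at z)" if "z \<in> \<H>" for z
    unfolding \<omega>_def by (rule holomorphic_derivI[OF W(1) open_H that])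
  have \<omega>: "invariant_differential \<omega>"
    unfolding \<omega>_def
  proof (rule invariant_differential_of_Re_equivariant[OF W(1)])
    show "Re (W (mob A z)) = Re (W z) + \<rho> A" if "A \<in> G" "z \<in> \<H>" for A z
      using h(2)[OF that] W(2)[OF that(2)] W(2)[OF mob_in_H[OF det_one[OF that(1)] that(2)]] by simp
  qed
  have \<omega>c: "continuous_on \<H> \<omega>"
    using \<omega> by (auto simp: invariant_differential_def intro: holomorphic_on_imp_continuous_on)
  \<comment> \<open>For \<open>W\<close> only periods of the real part are at hand; \<open>V\<close>
    is a primitive of \<omega> with constant complex periods, as \<open>exact_orthogonal\<close>
    requires.\<close>
  obtain V \<sigma> where V: "\<And>z. z \<in> \<H> \<Longrightarrow> (V has_field_derivative \<omega> z) (at z)"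
    "\<And>A z. A \<in> G \<Longrightarrow> z \<in> \<H> \<Longrightarrow> V (mob A z) = V z + \<sigma> A"
    using invariant_differential_primitive[OF \<omega>] by metis
  \<comment> \<open>In the form \<open>Re (cnj a * v)\<close> the gradient of \<open>h\<close> is
    \<open>cnj (\<omega> z)\<close>, so its pairing with \<omega> is the squared norm of
    \<omega>.\<close>
  have dh: "(h has_derivative (\<lambda>v. Re (cnj (cnj (\<omega> z)) * v))) (at z)" if z: "z \<in> \<H>" for z
  proof -
    have "((\<lambda>z. Re (W z)) has_derivative (\<lambda>v. Re (\<omega> z * v))) (at z)"
      using dW[OF z] unfolding has_field_derivative_def
      by (rule bounded_linear.has_derivative[OF bounded_linear_Re])
    then show ?thesis
      unfolding complex_cnj_cnj
      by (rule has_derivative_transform_within_open[OF _ open_H z]) (use W(2) in auto)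
  qed
  have c': "continuous_on \<H> (\<lambda>z. cnj (\<omega> z))" by (intro continuous_intros \<omega>c)
  have "hF_int (\<lambda>z. of_real ((Im z)\<^sup>2) * (a z - cnj (\<omega> z)) * \<omega> z) = 0"
  proof (rule exact_orthogonal[of "\<lambda>z. u z - h z", OF _ _ _ V(1) \<omega>c V(2)])
    show "((\<lambda>z. u z - h z) has_derivative (\<lambda>v. Re (cnj (a z - cnj (\<omega> z)) * v))) (at z)" if "z \<in> \<H>" for z
      using has_derivative_diff[OF du[OF that] dh[OF that]] by (simp add: algebra_simps)
    show "continuous_on \<H> (\<lambda>z. a z - cnj (\<omega> z))" by (intro continuous_intros a \<omega>c)
  qed (use uinv h(2) in auto)
  moreover have i1: "set_integrable hF \<H> (\<lambda>z. of_real ((Im z)\<^sup>2) * a z * \<omega> z)"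
    using energy_limit(2)[OF du a uinv V(1) \<omega>c V(2)] disc_second_moment_pos
    by (simp add: mult.assoc[symmetric]) (simp add: mult.assoc)
  moreover have i2: "set_integrable hF \<H> (\<lambda>z. of_real ((Im z)\<^sup>2) * cnj (\<omega> z) * \<omega> z)"
    using energy_limit(2)[OF dh c' h(2) V(1) \<omega>c V(2)] disc_second_moment_pos
    by (simp add: mult.assoc[symmetric]) (simp add: mult.assoc)
  moreover have "hF_int (\<lambda>z. of_real ((Im z)\<^sup>2) * (a z - cnj (\<omega> z)) * \<omega> z)
      = hF_int (\<lambda>z. of_real ((Im z)\<^sup>2) * a z * \<omega> z) - hF_int (\<lambda>z. of_real ((Im z)\<^sup>2) * cnj (\<omega> z) * \<omega> z)"
    by (subst set_integral_diff(2)[OF i1 i2, symmetric]) (simp add: algebra_simps)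
  ultimately have z: "hF_int (\<lambda>z. of_real ((Im z)\<^sup>2) * cnj (\<omega> z) * \<omega> z) = 0"
    using orth \<omega> by simp
  have e: "of_real ((Im z)\<^sup>2) * cnj (\<omega> z) * \<omega> z = complex_of_real ((Im z)\<^sup>2 * (cmod (\<omega> z))\<^sup>2)" for z
    unfolding of_real_mult complex_norm_square by (simp add: mult_ac)
  have 0: "hF_int (\<lambda>z. (Im z)\<^sup>2 * (cmod (\<omega> z))\<^sup>2) = 0"
    using z unfolding e by (simp only: set_integral_complex_of_real of_real_eq_0_iff)
  have int: "set_integrable hF \<H> (\<lambda>z. (Im z)\<^sup>2 * (cmod (\<omega> z))\<^sup>2)"
    using integrable_Re[OF i2[unfolded e set_integrable_def]] by (simp add: set_integrable_def)
  have \<omega>0: "\<omega> z = 0" if "z \<in> \<H>" for z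
    by (rule invariant_differential_eq_zero[OF \<omega> int 0 that])
  have "\<exists>c. \<forall>z\<in>\<H>. h z = c"
  proof (rule has_derivative_zero_constant[OF convex_H])
    fix z assume z: "z \<in> \<H>"
    show "(h has_derivative (\<lambda>v. 0)) (at z within \<H>)"
      using has_derivative_at_withinI[OF dh[OF z], of \<H>] by (simp add: \<omega>0[OF z])
  qed
  then obtain c where c: "\<And>z. z \<in> \<H> \<Longrightarrow> h z = c" by blast
  show "\<forall>A\<in>G. \<rho> A = 0"
  proof
    fix A assume A: "A \<in> G"
    have "\<i> \<in> \<H>" by simp
    then have "h (mob A \<i>) = c" "h \<i> = c" using c mob_in_H[OF det_one[OF A]] by blast+
    then show "\<rho> A = 0" using h(2)[OF A \<open>\<i> \<in> \<H>\<close>] by simp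
  qed
qed

end

section \<open>From matrices to the quotient surface\<close>

lemma carrier_SL2R [simp]: "A \<in> carrier SL2R \<longleftrightarrow> det A = 1"
  and mult_SL2R [simp]: "A \<otimes>\<^bsub>SL2R\<^esub> B = A ** B"
  and one_SL2R [simp]: "\<one>\<^bsub>SL2R\<^esub> = mat 1"
  by (auto simp: SL2R_def)

lemma group_SL2R: "group SL2R"
proof (rule groupI)
  fix A assume "A \<in> carrier SL2R"
  then have "matrix_inv A \<in> carrier SL2R" "matrix_inv A \<otimes>\<^bsub>SL2R\<^esub> A = \<one>\<^bsub>SL2R\<^esub>"
    using det_matrix_inv by auto
  then show "\<exists>B\<in>carrier SL2R. B \<otimes>\<^bsub>SL2R\<^esub> A = \<one>\<^bsub>SL2R\<^esub>" by blast
qed (auto simp: det_mul matrix_mul_assoc)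

lemma matrix_uminus_mult:
  fixes A B :: "real^2^2"
  shows "(- A) ** B = - (A ** B)" "A ** (- B) = - (A ** B)"
  by (simp_all add: vec_eq_iff matrix_matrix_mult_def sum_2)

lemma det_uminus_2: "det (- A) = det (A :: real^2^2)"
  by (simp add: det_2)

abbreviation center_SL2R :: "(real^2^2) set" where
  "center_SL2R \<equiv> {mat 1, - mat 1}"

lemma inv_SL2R: "det A = 1 \<Longrightarrow> inv\<^bsub>SL2R\<^esub> A = matrix_inv A"
  by (rule group.inv_equality[OF group_SL2R]) (auto simp: det_matrix_inv)

lemma normal_center_SL2R: "center_SL2R \<lhd> SL2R"
proof -
  interpret group SL2R by (rule group_SL2R)
  have 1: "matrix_inv (mat 1) = (mat 1 :: real^2^2)" "matrix_inv (- mat 1) = (- mat 1 :: real^2^2)"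
    using inv_SL2R[of "mat 1"] inv_equality[of "- mat 1" "- mat 1"] inv_SL2R[of "- mat 1"] inv_one
    by (auto simp: matrix_uminus_mult det_uminus_2)
  have "subgroup center_SL2R SL2R"
    by (rule subgroupI) (auto simp: det_uminus_2 inv_SL2R 1 matrix_uminus_mult)
  then show ?thesis
    by (rule normal_invI) (auto simp: matrix_uminus_mult inv_SL2R det_matrix_inv)
qed

lemma group_PSL2R: "group PSL2R"
  unfolding PSL2R_def by (rule normal.factorgroup_is_group[OF normal_center_SL2R])

lemma carrier_PSL2R: "\<gamma> \<in> carrier PSL2R \<Longrightarrow> A \<in> \<gamma> \<Longrightarrow> det A = 1 \<and> \<gamma> = {A, - A}"
  by (auto simp: PSL2R_def FactGroup_def RCOSETS_def r_coset_def matrix_uminus_mult det_uminus_2)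

lemma one_PSL2R: "\<one>\<^bsub>PSL2R\<^esub> = center_SL2R"
  by (simp add: PSL2R_def FactGroup_def)

lemma mult_PSL2R: "A \<in> \<gamma> \<Longrightarrow> B \<in> \<delta> \<Longrightarrow> A ** B \<in> \<gamma> \<otimes>\<^bsub>PSL2R\<^esub> \<delta>"
  by (auto simp: PSL2R_def FactGroup_def set_mult_def)

text \<open>Countably many of the neighbourhoods cover \<open>S\<close>, by Lindelof, and each
  contains finitely many of its points.\<close>

lemma countable_locally_finite:
  fixes S :: "'a::second_countable_topology set"
  assumes "\<And>x. x \<in> S \<Longrightarrow> \<exists>U. open U \<and> x \<in> U \<and> finite (U \<inter> S)"
  shows "countable S"
proof -
  let ?\<U> = "{U. open U \<and> finite (U \<inter> S)}"
  obtain \<V> where \<V>: "\<V> \<subseteq> ?\<U>" "countable \<V>" "\<Union>\<V> = \<Union>?\<U>"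
    using Lindelof[of ?\<U>] by blast
  have "S \<subseteq> (\<Union>U\<in>\<V>. U \<inter> S)" using assms \<V>(3) by blast
  moreover have "countable (\<Union>U\<in>\<V>. U \<inter> S)"
    using \<V> by (intro countable_UN) (auto intro: countable_finite)
  ultimately show ?thesis by (rule countable_subset)
qed

text \<open>Passes from cosets to matrices: the union of \<Lambda> is the matrix group that becomes
  \<open>G\<close> in \<open>surface_group\<close>.\<close>

locale PSL2R_subgroup =
  fixes \<Lambda> :: "(real^2^2) set set"
  assumes sub: "subgroup \<Lambda> PSL2R"
begin

lemma det_one: "A \<in> \<Union>\<Lambda> \<Longrightarrow> det A = 1"
  using carrier_PSL2R subgroup.subset[OF sub] by blast

lemma class_eq: "\<gamma> \<in> \<Lambda> \<Longrightarrow> A \<in> \<gamma> \<Longrightarrow> \<gamma> = {A, - A}"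
  using carrier_PSL2R subgroup.subset[OF sub] by blast

lemma one_mem: "mat 1 \<in> \<Union>\<Lambda>"
  using subgroup.one_closed[OF sub] one_PSL2R by auto

lemma mult_mem: "A \<in> \<Union>\<Lambda> \<Longrightarrow> B \<in> \<Union>\<Lambda> \<Longrightarrow> A ** B \<in> \<Union>\<Lambda>"
  using subgroup.m_closed[OF sub] mult_PSL2R by blast

lemma uminus_mem: "A \<in> \<Union>\<Lambda> \<Longrightarrow> - A \<in> \<Union>\<Lambda>"
  using class_eq by blast

text \<open>A representative of the inverse coset is the inverse matrix only up to sign, which
  \<open>uminus_mem\<close> absorbs.\<close>

lemma inv_mem:
  assumes "A \<in> \<Union>\<Lambda>" shows "matrix_inv A \<in> \<Union>\<Lambda>"
proof -
  obtain \<gamma> where \<gamma>: "\<gamma> \<in> \<Lambda>" "A \<in> \<gamma>" using assms by blast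
  define \<delta> where "\<delta> = inv\<^bsub>PSL2R\<^esub> \<gamma>"
  have \<delta>: "\<delta> \<in> \<Lambda>" unfolding \<delta>_def by (rule subgroup.m_inv_closed[OF sub \<gamma>(1)])
  have "\<gamma> \<otimes>\<^bsub>PSL2R\<^esub> \<delta> = center_SL2R"
    unfolding \<delta>_def one_PSL2R[symmetric]
    using group.r_inv[OF group_PSL2R] \<gamma> subgroup.subset[OF sub] by blast
  have "\<delta> \<in> carrier PSL2R" using \<delta> subgroup.subset[OF sub] by blast
  then obtain B where B: "B \<in> \<delta>"
    by (auto simp: PSL2R_def FactGroup_def RCOSETS_def r_coset_def)
  then have "A ** B \<in> center_SL2R"
    using mult_PSL2R[OF \<gamma>(2) B] \<open>\<gamma> \<otimes>\<^bsub>PSL2R\<^esub> \<delta> = center_SL2R\<close> by simp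
  moreover have "matrix_inv A ** (A ** B) = B"
    using det_matrix_inv(2)[OF det_one[OF assms]] by (simp add: matrix_mul_assoc)
  ultimately have "matrix_inv A = B \<or> matrix_inv A = - B"
    by (auto simp: matrix_uminus_mult)
  moreover have "B \<in> \<Union>\<Lambda>" using B \<delta> by blast
  ultimately show ?thesis using uminus_mem by metis
qed

lemma orbit_of_eq_iff: 
  assumes "x \<in> \<H>" "y \<in> \<H>"
  shows "orbit_of \<Lambda> x = orbit_of \<Lambda> y \<longleftrightarrow> (\<exists>A\<in>\<Union>\<Lambda>. mob A x = y)"
proof
  assume eq: "orbit_of \<Lambda> x = orbit_of \<Lambda> y"
  have "mob (mat 1) y \<in> orbit_of \<Lambda> y" using one_mem unfolding orbit_of_def by blast
  then have "y \<in> orbit_of \<Lambda> x" using eq by simp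
  then show "\<exists>A\<in>\<Union>\<Lambda>. mob A x = y" unfolding orbit_of_def by auto
next
  assume "\<exists>A\<in>\<Union>\<Lambda>. mob A x = y"
  then obtain A where A: "A \<in> \<Union>\<Lambda>" "mob A x = y" by blast
  have "orbit_of \<Lambda> (mob B z) \<subseteq> orbit_of \<Lambda> z" if "B \<in> \<Union>\<Lambda>" "z \<in> \<H>" for B z
  proof -
    have "mob C (mob B z) \<in> orbit_of \<Lambda> z" if "C \<in> \<Union>\<Lambda>" for C
      using mob_mult[OF det_one[OF \<open>B \<in> \<Union>\<Lambda>\<close>] \<open>z \<in> \<H>\<close>, of C] mult_mem[OF that \<open>B \<in> \<Union>\<Lambda>\<close>]
      unfolding orbit_of_def by (metis (mono_tags, lifting) mem_Collect_eq)
    then show ?thesis unfolding orbit_of_def[of _ "mob B z"] by blast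
  qed
  from this[OF A(1) assms(1)] this[OF inv_mem[OF A(1)] assms(2)] A(2) mob_inverse(1)[OF det_one[OF A(1)] assms(1)]
  show "orbit_of \<Lambda> x = orbit_of \<Lambda> y" by auto
qed

text \<open>An open set isolating the class of \<open>A\<close> pulls back to an open set of
  matrices that meets the union of \<Lambda> in at most \<open>A\<close> and
  \<open>- A\<close>.\<close>

lemma countable_of_discrete:
  assumes "subtopology PSL2R_topology \<Lambda> = discrete_topology \<Lambda>"
  shows "countable (\<Union>\<Lambda>)"
proof (rule countable_locally_finite)
  fix A assume "A \<in> \<Union>\<Lambda>"
  then obtain \<gamma> where \<gamma>: "\<gamma> \<in> \<Lambda>" "A \<in> \<gamma>" by blast
  have "openin (subtopology PSL2R_topology \<Lambda>) {\<gamma>}" using assms \<gamma> by simp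
  then obtain V where V: "openin PSL2R_topology V" "{\<gamma>} = V \<inter> \<Lambda>"
    by (auto simp: openin_subtopology)
  have "openin (top_of_set (carrier SL2R)) {A \<in> carrier SL2R. {A, - A} \<in> V}"
    using V(1) by (simp add: PSL2R_topology_def openin_quotient_topology_of)
  then obtain U where U: "open U" "{A \<in> carrier SL2R. {A, - A} \<in> V} = carrier SL2R \<inter> U"
    by (auto simp: openin_open)
  have "\<gamma> \<in> V" using V(2) by blast
  then have eqv: "{A, - A} \<in> V" using class_eq[OF \<gamma>] by metis
  have "A \<in> U" using U(2) eqv det_one[of A] \<gamma> by auto
  moreover have "U \<inter> \<Union>\<Lambda> \<subseteq> \<gamma>"
  proof
    fix B assume B: "B \<in> U \<inter> \<Union>\<Lambda>"
    then obtain \<delta> where \<delta>: "\<delta> \<in> \<Lambda>" "B \<in> \<delta>" by blast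
    have "det B = 1" "B \<in> U" using B det_one by blast+
    then have "B \<in> {A \<in> carrier SL2R. {A, - A} \<in> V}" unfolding U(2) by simp
    then have BV: "{B, - B} \<in> V" by (simp only: mem_Collect_eq)
    have "\<delta> = {B, - B}" by (rule class_eq[OF \<delta>])
    then have "\<delta> \<in> V" by (rule ssubst) (rule BV)
    then have "\<delta> \<in> {\<gamma>}" unfolding V(2) using \<delta>(1) by blast
    then have "\<delta> = \<gamma>" by simp
    then show "B \<in> \<gamma>" using \<delta> by simp
  qed
  moreover have "finite \<gamma>" by (subst class_eq[OF \<gamma>]) simp
  ultimately show "\<exists>U. open U \<and> A \<in> U \<and> finite (U \<inter> \<Union>\<Lambda>)"
    using U(1) finite_subset by blast
qed

text \<open>The half-plane is exhausted by bounded open sets that stay away from the real axis.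
  Their images form an increasing open cover of the quotient, so one of them suffices, and the
  corresponding closed set is compact.\<close>

lemma compact_fundamental_region:
  assumes "compact_space (quotient_surface \<Lambda>)"
  obtains K where "compact K" "K \<subseteq> \<H>" "\<And>z. z \<in> \<H> \<Longrightarrow> \<exists>A\<in>\<Union>\<Lambda>. mob A z \<in> K"
proof -
  define B where "B n = {z. Im z > 1 / real (Suc n)} \<inter> ball 0 (real (Suc n))" for n
  have BH: "B n \<subseteq> \<H>" for n
    by (auto simp: B_def intro: less_trans[of 0 "1 / real (Suc n)"])
  have Bmono: "B m \<subseteq> B n" if "m \<le> n" for m n
  proof -
    have "1 / real (Suc n) \<le> 1 / real (Suc m)" using that by (simp add: frac_le)
    then show ?thesis using that by (auto simp: B_def)
  qed
  have Bop: "open (B n)" for n by (auto simp: B_def open_halfspace_Im_gt)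
  have top: "topspace (quotient_surface \<Lambda>) = orbit_of \<Lambda> ` \<H>"
    by (simp add: quotient_surface_def topspace_quotient_topology_of)
  have op: "openin (quotient_surface \<Lambda>) (orbit_of \<Lambda> ` B n)" for n
  proof -
    \<comment> \<open>The saturation of \<open>B n\<close> is a union of preimages under continuous
      maps, so the quotient map is open on it.\<close>
    have "{x \<in> \<H>. orbit_of \<Lambda> x \<in> orbit_of \<Lambda> ` B n} = (\<Union>A\<in>\<Union>\<Lambda>. \<H> \<inter> mob A -` B n)"
    proof (rule Set.set_eqI, rule iffI)
      fix x assume "x \<in> {x \<in> \<H>. orbit_of \<Lambda> x \<in> orbit_of \<Lambda> ` B n}"
      then obtain y where "x \<in> \<H>" "y \<in> B n" "orbit_of \<Lambda> x = orbit_of \<Lambda> y" by auto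
      then show "x \<in> (\<Union>A\<in>\<Union>\<Lambda>. \<H> \<inter> mob A -` B n)"
        using orbit_of_eq_iff[of x y] BH by blast
    next
      fix x assume "x \<in> (\<Union>A\<in>\<Union>\<Lambda>. \<H> \<inter> mob A -` B n)"
      then obtain A where A: "A \<in> \<Union>\<Lambda>" "x \<in> \<H>" "mob A x \<in> B n" by blast
      then have "orbit_of \<Lambda> x = orbit_of \<Lambda> (mob A x)"
        using orbit_of_eq_iff[of x "mob A x"] BH by blast
      then show "x \<in> {x \<in> \<H>. orbit_of \<Lambda> x \<in> orbit_of \<Lambda> ` B n}" using A by blast
    qed
    moreover have "open (\<Union>A\<in>\<Union>\<Lambda>. \<H> \<inter> mob A -` B n)"
      using det_one mob_holomorphic holomorphic_on_imp_continuous_on Bop open_H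
      by (intro open_UN ballI continuous_open_preimage) blast+
    ultimately have "openin (top_of_set \<H>) {x \<in> \<H>. orbit_of \<Lambda> x \<in> orbit_of \<Lambda> ` B n}"
      by (simp add: openin_open_eq[OF open_H])
    then show ?thesis
      using BH by (auto simp: quotient_surface_def openin_quotient_topology_of)
  qed
  have cov: "orbit_of \<Lambda> ` \<H> \<subseteq> \<Union>(range (\<lambda>n. orbit_of \<Lambda> ` B n))"
  proof
    fix y assume "y \<in> orbit_of \<Lambda> ` \<H>"
    then obtain z where z: "z \<in> \<H>" "y = orbit_of \<Lambda> z" by blast
    obtain m where m: "1 / Im z < real m" using reals_Archimedean2 by blast
    obtain n where n: "cmod z < real n" using reals_Archimedean2 by blast
    define k where "k = max m n"
    have "1 / Im z < real (Suc k)" using m by (simp add: k_def)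
    then have "1 / real (Suc k) < Im z" using z by (simp add: divide_less_eq mult.commute)
    moreover have "cmod z < real (Suc k)" using n by (simp add: k_def)
    ultimately have "z \<in> B k" by (simp add: B_def)
    then show "y \<in> \<Union>(range (\<lambda>n. orbit_of \<Lambda> ` B n))" using z by blast
  qed
  have "\<exists>\<F>. finite \<F> \<and> \<F> \<subseteq> range (\<lambda>n. orbit_of \<Lambda> ` B n) \<and> orbit_of \<Lambda> ` \<H> \<subseteq> \<Union>\<F>"
    using assms cov op unfolding compact_space_def compactin_def top
    by (elim conjE allE[of _ "range (\<lambda>n. orbit_of \<Lambda> ` B n)"]) blast
  then obtain \<F> where \<F>: "finite \<F>" "\<F> \<subseteq> range (\<lambda>n. orbit_of \<Lambda> ` B n)" "orbit_of \<Lambda> ` \<H> \<subseteq> \<Union>\<F>"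
    by blast
  then obtain I where I: "finite I" "\<F> = (\<lambda>n. orbit_of \<Lambda> ` B n) ` I"
    by (metis finite_subset_image)
  \<comment> \<open>The inserted 0 keeps \<open>Max\<close> meaningful if \<open>I\<close> is
    empty.\<close>
  define N where "N = Max (insert 0 I)"
  have le: "n \<le> N" if "n \<in> I" for n using I(1) that by (simp add: N_def)
  define K where "K = {z. Im z \<ge> 1 / real (Suc N)} \<inter> cball 0 (real (Suc N))"
  show ?thesis
  proof (rule that[of K])
    show "compact K" unfolding K_def
      by (intro closed_Int_compact closed_halfspace_Im_ge compact_cball)
    show "K \<subseteq> \<H>"
      by (auto simp: K_def intro: less_le_trans[of 0 "1 / real (Suc N)"])
    fix z assume z: "z \<in> \<H>"
    then obtain n where n: "n \<in> I" "orbit_of \<Lambda> z \<in> orbit_of \<Lambda> ` B n"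
      using \<F>(3) I(2) by blast
    then obtain y where y: "y \<in> B n" "orbit_of \<Lambda> z = orbit_of \<Lambda> y" by blast
    then obtain A where "A \<in> \<Union>\<Lambda>" "mob A z = y" using orbit_of_eq_iff[of z y] z BH by blast
    moreover have "y \<in> B N" using y Bmono[OF le[OF n(1)]] by blast
    then have "y \<in> K" by (auto simp: B_def K_def)
    ultimately show "\<exists>A\<in>\<Union>\<Lambda>. mob A z \<in> K" by blast
  qed
qed

lemma surface_group_of_lattice:
  assumes "lattice_PSL2R \<Lambda>" "acts_freely \<Lambda>" "compact_space (quotient_surface \<Lambda>)"
    and F: "fundamental_set \<Lambda> F"
  obtains K where "surface_group (\<Union>\<Lambda>) F K"
proof -
  obtain K where K: "compact K" "K \<subseteq> \<H>" "\<And>z. z \<in> \<H> \<Longrightarrow> \<exists>A\<in>\<Union>\<Lambda>. mob A z \<in> K"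
    using compact_fundamental_region[OF assms(3)] by metis
  have Fb: "F \<in> sets borel" "F \<subseteq> \<H>" and F1: "\<And>z. z \<in> \<H> \<Longrightarrow> \<exists>!w. w \<in> F \<and> w \<in> orbit_of \<Lambda> z"
    using F by (auto simp: fundamental_set_def)
  have "surface_group (\<Union>\<Lambda>) F K"
  proof
    show "A = mat 1 \<or> A = - mat 1" if A: "A \<in> \<Union>\<Lambda>" "z \<in> \<H>" "mob A z = z" for A z
    proof -
      obtain \<gamma> where \<gamma>: "\<gamma> \<in> \<Lambda>" "A \<in> \<gamma>" using A by blast
      then have "\<gamma> = \<one>\<^bsub>PSL2R\<^esub>" using assms(2) A unfolding acts_freely_def by blast
      then show ?thesis using \<gamma> one_PSL2R by auto
    qed
    show "countable (\<Union>\<Lambda>)"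
      using assms(1) by (intro countable_of_discrete) (simp add: lattice_PSL2R_def)
    show "\<exists>A\<in>\<Union>\<Lambda>. mob A z \<in> F" if "z \<in> \<H>" for z
      using F1[OF that] unfolding orbit_of_def by blast
    show "mob A z = z" if A: "A \<in> \<Union>\<Lambda>" "z \<in> F" "mob A z \<in> F" for A z
    proof -
      have "z \<in> \<H>" using A Fb by blast
      moreover have "mob A z \<in> orbit_of \<Lambda> z" using A unfolding orbit_of_def by blast
      moreover have "mob (mat 1) z \<in> orbit_of \<Lambda> z" using one_mem unfolding orbit_of_def by blast
      ultimately show ?thesis using F1[of z] A by auto
    qed
  qed (use Fb K det_one mult_mem inv_mem uminus_mem in blast)+
  then show ?thesis by (rule that)
qed

end

section \<open>Gradients of the coordinates of the Weierstrass map\<close>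

lemma C1_on_H_imp_continuous_on: "C1_on_H f \<Longrightarrow> continuous_on \<H> f"
  unfolding C1_on_H_def
  by (intro continuous_at_imp_continuous_on ballI differentiable_imp_continuous_within) auto

text \<open>Differentiability is given, so only the value of the derivative is sought; difference
  quotients along short segments, where the path integral is an average of a continuous function,
  determine it.\<close>

lemma path_integral_imp_has_derivative:
  fixes u :: "complex \<Rightarrow> real"
  assumes du: "\<And>z. z \<in> \<H> \<Longrightarrow> (u has_derivative D z) (at z)"
    and a: "continuous_on \<H> a"
    and path: "\<And>c. valid_path c \<Longrightarrow> path_image c \<subseteq> \<H> \<Longrightarrow>
      complex_of_real (u (pathfinish c) - u (pathstart c)) =
        integral {0..1} (\<lambda>t. of_real (Re (cnj (a (c t)) * vector_derivative c (at t within {0..1}))))"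
    and z: "z \<in> \<H>"
  shows "(u has_derivative (\<lambda>v. Re (cnj (a z) * v))) (at z)"
proof -
  have "D z v = Re (cnj (a z) * v)" for v
  proof -
    let ?g = "\<lambda>w. complex_of_real (Re (cnj (a w) * v))"
    have gc: "continuous_on \<H> ?g" by (intro continuous_intros a)
    have gz: "isCont ?g z" using gc z continuous_on_eq_continuous_at[OF open_H] by blast
    have lim1: "((\<lambda>s. complex_of_real ((1 / s) *\<^sub>R (u (z + s *\<^sub>R v) - u z))) \<longlongrightarrow> of_real (D z v)) (at_right 0)"
      by (intro tendsto_of_real filterlim_mono[OF has_derivative_directional_limit[OF du[OF z]]]) (auto simp: at_within_le_at)
    have "((\<lambda>s. complex_of_real ((1 / s) *\<^sub>R (u (z + s *\<^sub>R v) - u z))) \<longlongrightarrow> ?g z) (at_right 0)"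
    proof (rule tendstoI)
      fix e :: real assume e: "e > 0"
      obtain d where d: "d > 0" "\<And>w. dist w z < d \<Longrightarrow> dist (?g w) (?g z) < e / 2"
        using gz e unfolding continuous_at_eps_delta by (metis half_gt_zero)
      obtain d' where d': "d' > 0" "ball z d' \<subseteq> \<H>" using open_H z open_contains_ball by blast
      \<comment> \<open>Below \<delta> the segment stays within both radii; the summand 1 covers
        \<open>v = 0\<close>.\<close>
      define \<delta> where "\<delta> = min d d' / (cmod v + 1)"
      have \<delta>: "\<delta> > 0" using d d' by (simp add: \<delta>_def add_nonneg_pos)
      have "dist (complex_of_real ((1 / s) *\<^sub>R (u (z + s *\<^sub>R v) - u z))) (?g z) < e" if s: "0 < s" "s < \<delta>" for s
      proof -
        let ?c = "linepath z (z + s *\<^sub>R v)"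
        have ct: "?c t = z + (t * s) *\<^sub>R v" for t
          by (simp add: linepath_def algebra_simps)
        have near: "dist (?c t) z < min d d'" if "t \<in> {0..1}" for t
        proof -
          have "cmod ((t * s) *\<^sub>R v) = t * (s * cmod v)" using that s by (simp add: mult.assoc)
          also have "\<dots> \<le> 1 * (s * cmod v)" using that s by (intro mult_right_mono) auto
          also have "\<dots> \<le> s * (cmod v + 1)" using s by simp
          also have "\<dots> < \<delta> * (cmod v + 1)" using s by (intro mult_strict_right_mono) (auto intro: add_nonneg_pos)
          also have "\<dots> = min d d'"
          proof -
            have "cmod v + 1 \<noteq> 0" using norm_ge_zero[of v] by linarith
            then show ?thesis by (simp add: \<delta>_def)
          qed
          finally show ?thesis unfolding ct by (simp add: dist_norm)
        qed
        have im: "path_image ?c \<subseteq> \<H>"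
        proof
          fix w assume "w \<in> path_image ?c"
          then obtain t where "t \<in> {0..1}" "w = ?c t" by (auto simp: path_image_def)
          then have "dist w z < d'" using near by fastforce
          then have "w \<in> ball z d'" by (simp add: dist_commute)
          then show "w \<in> \<H>" using d'(2) by blast
        qed
        have vd: "vector_derivative ?c (at t within {0..1}) = s *\<^sub>R v" if "t \<in> {0..1}" for t
          using that by (simp add: vector_derivative_linepath_within)
        have gcc: "continuous_on {0..1} (\<lambda>t. ?g (?c t))"
          by (rule continuous_on_compose2[OF gc]) (use im in \<open>auto simp: path_image_def intro!: continuous_on_linepath\<close>)
        have "complex_of_real (u (z + s *\<^sub>R v) - u z) = integral {0..1} (\<lambda>t. of_real (Re (cnj (a (?c t)) * vector_derivative ?c (at t within {0..1}))))"
          using path[OF valid_path_linepath im] by simp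
        also have "\<dots> = integral {0..1} (\<lambda>t. of_real s * ?g (?c t))"
          by (rule Henstock_Kurzweil_Integration.integral_cong) (simp add: vd algebra_simps)
        also have "\<dots> = of_real s * integral {0..1} (\<lambda>t. ?g (?c t))"
          by (rule integral_mult_right)
        finally have eq: "complex_of_real ((1 / s) *\<^sub>R (u (z + s *\<^sub>R v) - u z)) = integral {0..1} (\<lambda>t. ?g (?c t))"
          using s by (simp add: field_simps)
        have hi: "((\<lambda>t. ?g (?c t) - ?g z) has_integral (integral {0..1} (\<lambda>t. ?g (?c t)) - ?g z)) {0..1}"
          using has_integral_diff[OF integrable_integral[OF integrable_continuous_interval[OF gcc]] has_integral_const_real[of "?g z" 0 1]]
          by simp
        have "norm (integral {0..1} (\<lambda>t. ?g (?c t)) - ?g z) \<le> e / 2 * measure lborel {0..(1::real)}"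
        proof (rule has_integral_bound_real[OF _ finite.emptyI hi])
          fix t :: real assume "t \<in> {0..1} - {}"
          then have "dist (?c t) z < d" using near[of t] by simp
          from d(2)[OF this] show "norm (?g (?c t) - ?g z) \<le> e / 2" by (simp only: dist_norm less_imp_le)
        qed (use e in simp)
        then show ?thesis unfolding eq using e by (simp add: dist_norm)
      qed
      then show "\<forall>\<^sub>F s in at_right 0. dist (complex_of_real ((1 / s) *\<^sub>R (u (z + s *\<^sub>R v) - u z))) (?g z) < e"
        using \<delta> by (auto simp: eventually_at_right_field)
    qed
    from tendsto_unique[OF _ lim1 this] show ?thesis
      by (simp only: of_real_eq_iff trivial_limit_at_right_real) simp
  qed
  then have "D z = (\<lambda>v. Re (cnj (a z) * v))" by blast
  then show ?thesis using du[OF z] by simp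
qed

text \<open>Each integrand is a number plus its own conjugate, hence real; the right-hand sides read
  off the gradients.\<close>

lemma weierstrass_components_real:
  fixes p q v :: complex
  shows "\<i> / 2 * (((cnj q)\<^sup>2 + p\<^sup>2) * v - ((cnj p)\<^sup>2 + q\<^sup>2) * cnj v)
      = of_real (Re (cnj (- \<i> * ((cnj p)\<^sup>2 + q\<^sup>2)) * v))"
    and "1 / 2 * (((cnj q)\<^sup>2 - p\<^sup>2) * v - ((cnj p)\<^sup>2 - q\<^sup>2) * cnj v)
      = of_real (Re (cnj (q\<^sup>2 - (cnj p)\<^sup>2) * v))"
    and "p * cnj q * v + cnj p * q * cnj v = of_real (Re (cnj (2 * (cnj p * q)) * v))"
proof -
  have r: "of_real (Re w) = (w + cnj w) / 2" for w by (simp add: complex_eq_iff)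
  show "\<i> / 2 * (((cnj q)\<^sup>2 + p\<^sup>2) * v - ((cnj p)\<^sup>2 + q\<^sup>2) * cnj v)
      = of_real (Re (cnj (- \<i> * ((cnj p)\<^sup>2 + q\<^sup>2)) * v))"
    "1 / 2 * (((cnj q)\<^sup>2 - p\<^sup>2) * v - ((cnj p)\<^sup>2 - q\<^sup>2) * cnj v)
      = of_real (Re (cnj (q\<^sup>2 - (cnj p)\<^sup>2) * v))"
    "p * cnj q * v + cnj p * q * cnj v = of_real (Re (cnj (2 * (cnj p * q)) * v))"
    unfolding r by (simp_all add: field_simps)
qed

text \<open>Twice the coefficient of \<open>d(cnj z)\<close> in the \<open>k\<close>-th form, so
  that the form is \<open>Re (cnj a * v)\<close>.\<close>

definition weierstrass_gradient ::
  "(complex \<Rightarrow> complex) \<Rightarrow> (complex \<Rightarrow> complex) \<Rightarrow> 3 \<Rightarrow> complex \<Rightarrow> complex" where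
  "weierstrass_gradient \<psi>1 \<psi>2 k z =
     vector [- \<i> * ((cnj (\<psi>1 z))\<^sup>2 + (\<psi>2 z)\<^sup>2), (\<psi>2 z)\<^sup>2 - (cnj (\<psi>1 z))\<^sup>2, 2 * (cnj (\<psi>1 z) * \<psi>2 z)] $ k"

lemma weierstrass_form_eq_gradient:
  "weierstrass_form (\<psi>1, \<psi>2) z v $ k = of_real (Re (cnj (weierstrass_gradient \<psi>1 \<psi>2 k z) * v))"
proof -
  have "\<forall>k. weierstrass_form (\<psi>1, \<psi>2) z v $ k = of_real (Re (cnj (weierstrass_gradient \<psi>1 \<psi>2 k z) * v))"
    unfolding forall_3 weierstrass_form_def weierstrass_gradient_def Let_def fst_conv snd_conv vector_3
    by (intro conjI weierstrass_components_real)
  then show ?thesis by blast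
qed

section \<open>Wedge integrals as integrals over the quotient\<close>

context surface_group begin

lemma hF_eq_density: "hF = density lborel (\<lambda>z. ennreal (indicator F z * (1 / (Im z)\<^sup>2)))"
proof -
  have "hF = density lborel (\<lambda>z. (indicator \<H> z * ennreal (1 / (Im z)\<^sup>2)) * indicator F z)"
    unfolding hF_def hyp_def by (rule density_density_eq) auto
  also have "\<dots> = density lborel (\<lambda>z. ennreal (indicator F z * (1 / (Im z)\<^sup>2)))"
    by (rule density_cong) (use F_sub in \<open>auto simp: indicator_def intro!: AE_I2\<close>)
  finally show ?thesis .
qed

text \<open>The factor \<open>(Im z)\<^sup>2\<close> of the energy density cancels the density of
  the hyperbolic area.\<close>

lemma hF_int_eq_lborel:
  fixes f :: "complex \<Rightarrow> complex"
  assumes f: "continuous_on \<H> f"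
  shows "hF_int (\<lambda>z. of_real ((Im z)\<^sup>2) * f z) = (LINT z:F|lborel. f z)"
proof -
  have m: "(\<lambda>z. indicator \<H> z *\<^sub>R (of_real ((Im z)\<^sup>2) * f z)) \<in> borel_measurable borel"
    by (intro borel_measurable_continuous_on_indicator continuous_intros f) simp
  have "hF_int (\<lambda>z. of_real ((Im z)\<^sup>2) * f z)
      = (\<integral>z. (indicator F z * (1 / (Im z)\<^sup>2)) *\<^sub>R (indicator \<H> z *\<^sub>R (of_real ((Im z)\<^sup>2) * f z)) \<partial>lborel)"
    unfolding set_lebesgue_integral_def hF_eq_density
    by (rule integral_density) (use m in \<open>auto simp: indicator_def\<close>)
  also have "\<dots> = (LINT z:F|lborel. f z)"
    unfolding set_lebesgue_integral_def
    by (intro Bochner_Integration.integral_cong) (use F_sub in \<open>auto simp: indicator_def scaleR_conv_of_real\<close>)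
  finally show ?thesis .
qed

text \<open>The modulus is invariant: \<open>(Im z)\<^sup>2\<close> contributes
  \<open>|aut_factor A z|^(-4)\<close>, and \<open>p\<close> and \<omega> contribute a square each.
  Invariant continuous functions are bounded by compactness.\<close>

lemma set_integrable_hF_wedge:
  assumes p: "continuous_on \<H> p"
    and pinv: "\<And>A z. A \<in> G \<Longrightarrow> z \<in> \<H> \<Longrightarrow> p (mob A z) = (cnj (aut_factor A z))\<^sup>2 * p z"
    and \<omega>: "invariant_differential \<omega>"
  shows "set_integrable hF \<H> (\<lambda>z. of_real ((Im z)\<^sup>2) * (p z * \<omega> z))"
proof -
  have \<omega>c: "continuous_on \<H> \<omega>" and inv: "\<And>A z. A \<in> G \<Longrightarrow> z \<in> \<H> \<Longrightarrow> \<omega> (mob A z) * deriv (mob A) z = \<omega> z"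
    using \<omega> by (auto simp: invariant_differential_def intro: holomorphic_on_imp_continuous_on)
  have c: "continuous_on \<H> (\<lambda>z. complex_of_real ((Im z)\<^sup>2) * (p z * \<omega> z))"
    by (intro continuous_intros p \<omega>c)
  obtain C where "\<And>z. z \<in> \<H> \<Longrightarrow> norm (complex_of_real ((Im z)\<^sup>2) * (p z * \<omega> z)) \<le> C"
  proof (rule bounded_invariant[OF c])
    fix A z assume A: "A \<in> G" and z: "z \<in> \<H>"
    have d: "det A = 1" using A by (rule det_one)
    have nz: "aut_factor A z \<noteq> 0" using aut_factor_nonzero[OF d, of z] z by simp
    have w: "\<omega> (mob A z) = \<omega> z * (aut_factor A z)\<^sup>2"
      using inv[OF A z] nz by (simp add: deriv_mob[OF d z] field_simps)
    have i: "Im (mob A z) = Im z / (cmod (aut_factor A z))\<^sup>2" using z by (intro Im_mob d) auto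
    show "norm (complex_of_real ((Im (mob A z))\<^sup>2) * (p (mob A z) * \<omega> (mob A z)))
        = norm (complex_of_real ((Im z)\<^sup>2) * (p z * \<omega> z))"
      unfolding w pinv[OF A z] i using nz
      by (simp add: norm_mult norm_power norm_divide power_divide field_simps)
  qed (rule that)
  then show ?thesis by (rule set_integrable_hF[OF c])
qed

end

theorem theorem8:
  fixes \<Lambda> :: "(real^2^2) set set" and g :: nat
    and U :: "complex \<Rightarrow> real" and \<psi>1 \<psi>2 :: "complex \<Rightarrow> complex"
    and X :: "complex \<Rightarrow> real^3"
  assumes "lattice_PSL2R \<Lambda>" and "acts_freely \<Lambda>"
    and "compact_space (quotient_surface \<Lambda>)"
    and "has_genus (quotient_surface \<Lambda>) g" and "g \<ge> 2"
    and "C1_on_H \<psi>1" and "C1_on_H \<psi>2"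
    and "\<forall>z\<in>\<H>. dirac U (\<psi>1, \<psi>2) z = (0, 0)"
    and "automorphic \<Lambda> U (\<psi>1, \<psi>2)"
    and "weierstrass_map (\<psi>1, \<psi>2) X" and "immersion_of_H X"
  shows "descends_to_quotient \<Lambda> X \<longleftrightarrow>
    (\<forall>\<omega>. holomorphic_differential \<Lambda> \<omega> \<longrightarrow>
       wedge_integral \<Lambda> (\<lambda>z. (cnj (\<psi>1 z))\<^sup>2) \<omega> = 0 \<and>
       wedge_integral \<Lambda> (\<lambda>z. (\<psi>2 z)\<^sup>2) \<omega> = 0 \<and>
       wedge_integral \<Lambda> (\<lambda>z. cnj (\<psi>1 z) * \<psi>2 z) \<omega> = 0)"
proof -
  define F where "F = (SOME F. fundamental_set \<Lambda> F)"
  have "\<exists>F. fundamental_set \<Lambda> F" using assms(1) unfolding lattice_PSL2R_def by blast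
  then have F: "fundamental_set \<Lambda> F" unfolding F_def by (rule someI_ex)
  interpret P: PSL2R_subgroup \<Lambda>
    using assms(1) unfolding lattice_PSL2R_def by (intro PSL2R_subgroup.intro) blast
  obtain K where "surface_group (\<Union>\<Lambda>) F K"
    using P.surface_group_of_lattice[OF assms(1-3) F] by blast
  then interpret S: surface_group "\<Union>\<Lambda>" F K .
  let ?a = "weierstrass_gradient \<psi>1 \<psi>2"
  let ?p = "\<lambda>z. (cnj (\<psi>1 z))\<^sup>2" and ?q = "\<lambda>z. (\<psi>2 z)\<^sup>2" and ?r = "\<lambda>z. cnj (\<psi>1 z) * \<psi>2 z"
  have c1: "continuous_on \<H> \<psi>1" and c2: "continuous_on \<H> \<psi>2"
    using assms(6,7) by (auto intro: C1_on_H_imp_continuous_on)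
  have pc: "continuous_on \<H> ?p" and qc: "continuous_on \<H> ?q" and rc: "continuous_on \<H> ?r"
    by (intro continuous_intros c1 c2)+
  have a3: "?a 1 z = - \<i> * (?p z + ?q z)" "?a 2 z = ?q z - ?p z" "?a 3 z = 2 * ?r z" for z
    by (simp_all add: weierstrass_gradient_def)
  have "\<forall>k. continuous_on \<H> (?a k)"
    unfolding forall_3 a3[abs_def] by (intro conjI continuous_intros pc qc rc)
  then have ac: "continuous_on \<H> (?a k)" for k by blast
  \<comment> \<open>The transformation law of the spinors is given for one matrix \<open>B\<close>
    of each class only. The sign \<open>e\<close> relating it to \<open>A\<close> disappears in
    quadratic expressions, so these obey the law for every matrix.\<close>
  have law: "?p (mob A z) = (cnj (aut_factor A z))\<^sup>2 * ?p z"
      "?q (mob A z) = (cnj (aut_factor A z))\<^sup>2 * ?q z"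
      "?r (mob A z) = (cnj (aut_factor A z))\<^sup>2 * ?r z" if A: "A \<in> \<Union>\<Lambda>" and z: "z \<in> \<H>" for A z
  proof -
    obtain \<gamma> where \<gamma>: "\<gamma> \<in> \<Lambda>" "A \<in> \<gamma>" using A by blast
    obtain B where B: "B \<in> \<gamma>" and Bz: "\<psi>1 (mob B z) = aut_factor B z * \<psi>1 z"
        "\<psi>2 (mob B z) = aut_factor B (cnj z) * \<psi>2 z"
      using assms(9) \<gamma>(1) z unfolding automorphic_def aut_factor_def fst_conv snd_conv by blast
    have "B = A \<or> B = - A" using P.class_eq[OF \<gamma>] B by blast
    then obtain e :: complex where e: "e * e = 1" "mob B z = mob A z" "aut_factor B z = e * aut_factor A z" "cnj e = e"
    proof
      assume "B = A"
      then show ?thesis by (intro that[of 1]) auto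
    next
      assume "B = - A"
      then show ?thesis by (intro that[of "- 1"]) (auto simp: aut_factor_def)
    qed
    have 1: "\<psi>1 (mob A z) = e * aut_factor A z * \<psi>1 z" "\<psi>2 (mob A z) = e * cnj (aut_factor A z) * \<psi>2 z"
      using Bz e by (simp_all add: aut_factor_cnj)
    have e2: "e\<^sup>2 = 1" using e(1) by (simp add: power2_eq_square)
    show "?p (mob A z) = (cnj (aut_factor A z))\<^sup>2 * ?p z"
      "?q (mob A z) = (cnj (aut_factor A z))\<^sup>2 * ?q z"
      by (simp_all add: 1 e(4) power_mult_distrib e2)
    have "?r (mob A z) = (e * e) * ((cnj (aut_factor A z))\<^sup>2 * ?r z)"
      by (simp add: 1 e(4) power2_eq_square mult_ac)
    then show "?r (mob A z) = (cnj (aut_factor A z))\<^sup>2 * ?r z" by (simp add: e(1))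
  qed
  have alaw: "?a k (mob A z) = (cnj (aut_factor A z))\<^sup>2 * ?a k z" if "A \<in> \<Union>\<Lambda>" "z \<in> \<H>" for k A z
  proof -
    have "\<forall>k. ?a k (mob A z) = (cnj (aut_factor A z))\<^sup>2 * ?a k z"
      unfolding forall_3 a3 law[OF that] by (simp add: algebra_simps)
    then show ?thesis by blast
  qed
  \<comment> \<open>The immersion supplies differentiability of \<open>X\<close>; the path integrals
    then supply the value of the derivative.\<close>
  obtain X' where X': "\<And>z. z \<in> \<H> \<Longrightarrow> (X has_derivative blinfun_apply (X' z)) (at z)"
    using assms(11) unfolding immersion_of_H_def by blast
  have dX: "((\<lambda>z. X z $ k) has_derivative (\<lambda>v. Re (cnj (?a k z) * v))) (at z)" if z: "z \<in> \<H>" for k z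
  proof (rule path_integral_imp_has_derivative[OF _ ac _ z])
    show "((\<lambda>z. X z $ k) has_derivative (\<lambda>v. blinfun_apply (X' z) v $ k)) (at z)" if "z \<in> \<H>" for z
      using bounded_linear.has_derivative[OF bounded_linear_vec_nth X'[OF that]] .
    show "complex_of_real (X (pathfinish c) $ k - X (pathstart c) $ k)
        = integral {0..1} (\<lambda>t. of_real (Re (cnj (?a k (c t)) * vector_derivative c (at t within {0..1}))))"
      if "valid_path c" "path_image c \<subseteq> \<H>" for c
      using assms(10) that unfolding weierstrass_map_def weierstrass_form_eq_gradient by blast
  qed
  \<comment> \<open>The law of the gradient makes the differential of each coordinate invariant:
    after conjugation its factor cancels the derivative \<open>1 / (aut_factor A z)\<^sup>2\<close>.
    So a coordinate changes under \<open>A\<close> by a constant, its period.\<close>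
  have const: "\<exists>c. \<forall>z\<in>\<H>. X (mob A z) $ k - X z $ k = c" if A: "A \<in> \<Union>\<Lambda>" for A k
  proof (rule has_derivative_zero_constant[OF convex_H])
    fix z assume z: "z \<in> \<H>"
    have d: "det A = 1" by (rule P.det_one[OF A])
    have nz: "aut_factor A z \<noteq> 0" using aut_factor_nonzero[OF d, of z] z by simp
    have "(mob A has_derivative (*) (1 / (aut_factor A z)\<^sup>2)) (at z within \<H>)"
      using mob_has_field_derivative[OF d z] by (simp add: has_field_derivative_def)
    from has_derivative_compose[OF this dX[OF mob_in_H[OF d z], of k]]
    have "((\<lambda>z. X (mob A z) $ k) has_derivative (\<lambda>v. Re (cnj (?a k (mob A z)) * (1 / (aut_factor A z)\<^sup>2 * v)))) (at z within \<H>)" .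
    also have "(\<lambda>v. Re (cnj (?a k (mob A z)) * (1 / (aut_factor A z)\<^sup>2 * v))) = (\<lambda>v. Re (cnj (?a k z) * v))"
      using nz by (simp add: alaw[OF A z])
    finally have "((\<lambda>z. X (mob A z) $ k) has_derivative (\<lambda>v. Re (cnj (?a k z) * v))) (at z within \<H>)" .
    from has_derivative_diff[OF this has_derivative_at_withinI[OF dX[OF z, of k]]]
    show "((\<lambda>z. X (mob A z) $ k - X z $ k) has_derivative (\<lambda>v. 0)) (at z within \<H>)"
      by (simp only: diff_self)
  qed
  define \<rho> where "\<rho> k A = X (mob A \<i>) $ k - X \<i> $ k" for k A
  have \<rho>: "X (mob A z) $ k = X z $ k + \<rho> k A" if A: "A \<in> \<Union>\<Lambda>" and z: "z \<in> \<H>" for A k z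
  proof -
    have i: "\<i> \<in> \<H>" by simp
    obtain c where "\<forall>z\<in>\<H>. X (mob A z) $ k - X z $ k = c" using const[OF A, of k] by blast
    from bspec[OF this z] bspec[OF this i] show ?thesis unfolding \<rho>_def by simp
  qed
  have "descends_to_quotient \<Lambda> X \<longleftrightarrow> (\<forall>k. \<forall>A\<in>\<Union>\<Lambda>. \<rho> k A = 0)"
  proof
    assume d: "descends_to_quotient \<Lambda> X"
    show "\<forall>k. \<forall>A\<in>\<Union>\<Lambda>. \<rho> k A = 0"
    proof (intro allI ballI)
      fix k A assume A: "A \<in> \<Union>\<Lambda>"
      have i: "\<i> \<in> \<H>" by simp
      have "X (mob A \<i>) = X \<i>" using d A i unfolding descends_to_quotient_def by blast
      then show "\<rho> k A = 0" using \<rho>[OF A i, of k] by simp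
    qed
  next
    assume "\<forall>k. \<forall>A\<in>\<Union>\<Lambda>. \<rho> k A = 0"
    then show "descends_to_quotient \<Lambda> X"
      unfolding descends_to_quotient_def vec_eq_iff using \<rho> by simp
  qed
  also have "\<dots> \<longleftrightarrow> (\<forall>\<omega>. S.invariant_differential \<omega> \<longrightarrow> (\<forall>k. S.hF_int (\<lambda>z. of_real ((Im z)\<^sup>2) * ?a k z * \<omega> z) = 0))"
    using S.periods_vanish_iff[OF dX ac \<rho>] by blast
  also have "\<dots> \<longleftrightarrow> (\<forall>\<omega>. holomorphic_differential \<Lambda> \<omega> \<longrightarrow> wedge_integral \<Lambda> ?p \<omega> = 0 \<and>
      wedge_integral \<Lambda> ?q \<omega> = 0 \<and> wedge_integral \<Lambda> ?r \<omega> = 0)"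
  proof -
    have "(\<forall>k. S.hF_int (\<lambda>z. of_real ((Im z)\<^sup>2) * ?a k z * \<omega> z) = 0) \<longleftrightarrow>
        wedge_integral \<Lambda> ?p \<omega> = 0 \<and> wedge_integral \<Lambda> ?q \<omega> = 0 \<and> wedge_integral \<Lambda> ?r \<omega> = 0"
      if \<omega>: "S.invariant_differential \<omega>" for \<omega>
    proof -
      have \<omega>c: "continuous_on \<H> \<omega>"
        using \<omega> by (auto simp: S.invariant_differential_def intro: holomorphic_on_imp_continuous_on)
      let ?I = "\<lambda>p. S.hF_int (\<lambda>z. of_real ((Im z)\<^sup>2) * (p z * \<omega> z))"
      have wedge: "wedge_integral \<Lambda> p \<omega> = 2 * \<i> * ?I p" if "continuous_on \<H> p" for p
        unfolding wedge_integral_def F_def[symmetric]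
        by (subst S.hF_int_eq_lborel) (intro continuous_intros that \<omega>c, simp)
      have ip: "set_integrable S.hF \<H> (\<lambda>z. of_real ((Im z)\<^sup>2) * (?p z * \<omega> z))"
        and iq: "set_integrable S.hF \<H> (\<lambda>z. of_real ((Im z)\<^sup>2) * (?q z * \<omega> z))"
        by (rule S.set_integrable_hF_wedge[OF pc law(1) \<omega>], assumption+)
           (rule S.set_integrable_hF_wedge[OF qc law(2) \<omega>], assumption+)
      have "S.hF_int (\<lambda>z. of_real ((Im z)\<^sup>2) * ?a 1 z * \<omega> z) = - \<i> * (?I ?p + ?I ?q)"
        unfolding set_integral_add(2)[OF ip iq, symmetric] a3
        by (subst set_integral_mult_right[symmetric]) (simp add: algebra_simps)
      moreover have "S.hF_int (\<lambda>z. of_real ((Im z)\<^sup>2) * ?a 2 z * \<omega> z) = ?I ?q - ?I ?p"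
        unfolding set_integral_diff(2)[OF iq ip, symmetric] a3 by (simp add: algebra_simps)
      moreover have "S.hF_int (\<lambda>z. of_real ((Im z)\<^sup>2) * ?a 3 z * \<omega> z) = 2 * ?I ?r"
        unfolding a3 by (subst set_integral_mult_right[symmetric]) (simp add: mult_ac)
      ultimately have "(\<forall>k. S.hF_int (\<lambda>z. of_real ((Im z)\<^sup>2) * ?a k z * \<omega> z) = 0) \<longleftrightarrow>
          ?I ?p + ?I ?q = 0 \<and> ?I ?q - ?I ?p = 0 \<and> ?I ?r = 0"
        unfolding forall_3 by simp
      also have "\<dots> \<longleftrightarrow> ?I ?p = 0 \<and> ?I ?q = 0 \<and> ?I ?r = 0"
        by auto
      finally show ?thesis
        unfolding wedge[OF pc] wedge[OF qc] wedge[OF rc] by simp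
    qed
    then show ?thesis
      unfolding holomorphic_differential_def S.invariant_differential_def by blast
  qed
  finally show ?thesis .
qed

end
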